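(* Let $m,n\ge 1$ be integers. For any $\epsilon>0$, there exists $\delta>0$ such that $$\dim_H\{A\in M_{m,n}(\mathbb{R}) : \dim_H \mathbf{Bad}_A(\epsilon)\ge m-\delta\}<mn .$$
   Context: $M_{m,n}(\mathbb{R})$ is the set of $m\times n$ real matrices, identified with $\mathbb{R}^{mn}$; $\|\cdot\|$ is the Euclidean norm; $\dim_H$ is Hausdorff dimension. For $v\in\mathbb{R}^m$, $\langle v\rangle:=\inf_{p\in\mathbb{Z}^m}\|v-p\|$. For $\epsilon>0$, a matrix $A\in M_{m,n}(\mathbb{R})$ is called $\epsilon$-bad for $b\in\mathbb{R}^m$ if $$\liminf_{q\in\mathbb{Z}^n,\ \|q\|\to\infty}\|q\|^{n/m}\langle Aq-b\rangle\ge\epsilon .$$ $\mathbf{Bad}_A(\epsilon):=\{b\in\mathbb{R}^m: A \text{ is } \epsilon\text{-bad for } b\}$. *)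

theory Defs
  imports "HOL-Analysis.Analysis"
begin

section \<open>Hausdorff measure and Hausdorff dimension\<close>

text \<open>
  The summand \<open>diam U ^ s\<close> with the conventions that the empty set contributes \<open>0\<close> and that
  \<open>0 ^ 0 = 1\<close> (whereas \<open>0 powr 0 = 0\<close>), so that the measure for \<open>s = 0\<close> counts points.
\<close>
definition diam_power :: "real \<Rightarrow> 'a::metric_space set \<Rightarrow> ennreal" where
  "diam_power s U =
     (if U = {} then 0 else if s = 0 then 1 else ennreal (diameter U powr s))"

text \<open>
  Boundedness is required explicitly because \<^const>\<open>diameter\<close> is unspecified on unbounded sets.
  Finite covers are included, since members of the sequence may be empty.
\<close>
definition hausdorff_premeasure :: "real \<Rightarrow> real \<Rightarrow> 'a::metric_space set \<Rightarrow> ennreal" where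
  "hausdorff_premeasure s r E =
     (INF U \<in> {U :: nat \<Rightarrow> 'a set. E \<subseteq> (\<Union>i. U i) \<and> (\<forall>i. bounded (U i) \<and> diameter (U i) \<le> r)}.
        \<Sum>i. diam_power s (U i))"

definition hausdorff_measure :: "real \<Rightarrow> 'a::metric_space set \<Rightarrow> ennreal" where
  "hausdorff_measure s E = (SUP r\<in>{0<..}. hausdorff_premeasure s r E)"

text \<open>The empty set gets dimension \<open>0\<close>.\<close>
definition hausdorff_dim :: "'a::metric_space set \<Rightarrow> ereal" where
  "hausdorff_dim E = (INF s\<in>{s. 0 \<le> s \<and> hausdorff_measure s E = 0}. ereal s)"

section \<open>Badly approximable targets\<close>

text \<open>
  Matrices in \<open>M\<^sub>m\<^sub>,\<^sub>n(\<real>)\<close> have type \<open>real ^ 'n ^ 'm\<close>; the norm and distance of this type are the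
  Euclidean ones of the identification with \<open>\<real>\<^sup>m\<^sup>n\<close>, not the operator norm.
\<close>

definition int_vecs :: "(real ^ 'k) set" where
  "int_vecs = {v. \<forall>i. v $ i \<in> \<int>}"

definition dist_int :: "real ^ 'k \<Rightarrow> real" where
  "dist_int v = (INF p\<in>int_vecs. norm (v - p))"

text \<open>The filter describing \<open>\<parallel>q\<parallel> \<rightarrow> \<infinity>\<close> along integer vectors \<open>q\<close>.\<close>
definition int_vecs_at_infinity :: "(real ^ 'k) filter" where
  "int_vecs_at_infinity = inf at_infinity (principal int_vecs)"

definition is_bad_for :: "real \<Rightarrow> real ^ 'n ^ 'm \<Rightarrow> real ^ 'm \<Rightarrow> bool" where
  "is_bad_for \<epsilon> A b \<longleftrightarrow>
     Liminf int_vecs_at_infinity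
       (\<lambda>q :: real ^ 'n.
          ereal (norm q powr (real CARD('n) / real CARD('m)) * dist_int (A *v q - b)))
     \<ge> ereal \<epsilon>"

definition Bad :: "real ^ 'n ^ 'm \<Rightarrow> real \<Rightarrow> (real ^ 'm) set" where
  "Bad A \<epsilon> = {b. is_bad_for \<epsilon> A b}"

end

theory Submission
  imports Defs
begin

text \<open>
  Put \<open>Q = T\<^sup>m\<^sup>k\<close> and \<open>\<rho> = T\<^sup>-\<^sup>n\<^sup>k\<close> at level \<open>k\<close>, and let the height of \<open>A\<close> at level \<open>k\<close> be the number
  of integer pairs \<open>(q, p)\<close> with \<open>\<bar>q\<bar> \<le> Q\<close> and \<open>\<bar>A q + p\<bar> \<le> \<rho>\<close>, that is, of short vectors of a unimodular
  lattice. If the height is bounded, so is the covering radius of the lattice; then every cube of targets of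
  side comparable to \<open>\<rho>\<close> contains a point \<open>A q + p\<close> with \<open>\<bar>q\<bar>\<close> comparable to \<open>Q\<close>, and \<open>Bad A \<epsilon>\<close> misses
  a fixed proportion of the cube. Hence \<open>Bad A \<epsilon>\<close> has dimension bounded away from \<open>m\<close> whenever a fifth of the
  levels up to \<open>N\<close> have bounded height, for infinitely many \<open>N\<close>.

  The other matrices are counted by a drift argument. When a cube of matrices of level \<open>k\<close> is subdivided,
  the average height of the subcubes is at most half of the height of the cube plus a constant: either the
  relevant vectors span, and there are boundedly many of them, or they lie in a hyperplane, and then a ball of
  radius \<open>R\<close> contains at most \<open>O(R\<^sup>d\<^sup>-\<^sup>1)\<close> times as many of them as the unit ball, where \<open>d = m + n\<close>. So only
  an exponentially small proportion of the cubes of level \<open>N\<close> have bounded height at few levels.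
\<close>

section \<open>Null sets for Hausdorff measure\<close>

text \<open>The height counts all short vectors instead of measuring the shortest one because a
  count can be averaged over subcubes by exchanging summations. Let q have size R Q, where Q =
  T^(mk). Over the subcubes, A q spreads over a range of about R T^(-nk) in each of m coordinates
  and has to hit a window of size T^(-n(k+1)), so (q, p) is short in a proportion of about (T^n
  R)^(-m) of them. With R^d relevant vectors, the scale R = T^m alone would contribute T^(-nm)
  T^(nm) = 1 times the height, and nothing would be gained. The power of R saved in a hyperplane
  turns this into T^(-m); as there are O(log T) dyadic scales, a large T makes their sum small. If q
  is much smaller than Q, varying the subcube does not help, and the gain comes from the at least
  linear growth of the number of lattice points with the radius; the zero vector escapes this and
  gives part of the additive constant. The two regimes meet because T = 4^t: a cut at R = 2^(-t)
  gains a factor of order 2^(-t) on either side.\<close>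

lemma hausdorff_measure_zeroI:
  assumes "\<And>r e. r > 0 \<Longrightarrow> e > 0 \<Longrightarrow> \<exists>U :: nat \<Rightarrow> 'a::metric_space set.
      E \<subseteq> (\<Union>i. U i) \<and> (\<forall>i. bounded (U i) \<and> diameter (U i) \<le> r) \<and> (\<Sum>i. diam_power s (U i)) \<le> ennreal e"
  shows "hausdorff_measure s E = 0"
proof -
  have "hausdorff_premeasure s r E \<le> 0" if r: "r > 0" for r
  proof (rule ennreal_le_epsilon)
    fix e :: real assume "e > 0"
    from assms[OF r this]
    obtain U :: "nat \<Rightarrow> 'a set" where U: "E \<subseteq> (\<Union>i. U i)"
      "\<forall>i. bounded (U i) \<and> diameter (U i) \<le> r" "(\<Sum>i. diam_power s (U i)) \<le> ennreal e" by blast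
    then show "hausdorff_premeasure s r E \<le> 0 + ennreal e"
      unfolding hausdorff_premeasure_def by (simp add: INF_lower2)
  qed
  then have "hausdorff_measure s E \<le> 0"
    unfolding hausdorff_measure_def by (intro SUP_least) simp
  then show ?thesis by simp
qed

lemma hausdorff_measure_zeroD:
  fixes E :: "'a::metric_space set"
  assumes "hausdorff_measure s E = 0" "r > 0" "e > 0"
  shows "\<exists>U :: nat \<Rightarrow> 'a set.
      E \<subseteq> (\<Union>i. U i) \<and> (\<forall>i. bounded (U i) \<and> diameter (U i) \<le> r) \<and> (\<Sum>i. diam_power s (U i)) \<le> ennreal e"
proof -
  have "hausdorff_premeasure s r E \<le> hausdorff_measure s E"
    unfolding hausdorff_measure_def using assms(2) by (intro SUP_upper) simp
  also have "\<dots> < ennreal e" using assms by simp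
  finally show ?thesis
    unfolding hausdorff_premeasure_def Inf_less_iff by (auto intro: less_imp_le)
qed

lemma hausdorff_measure_UN_zero:
  fixes E :: "nat \<Rightarrow> 'a::metric_space set"
  assumes "\<And>i. hausdorff_measure s (E i) = 0"
  shows "hausdorff_measure s (\<Union>i. E i) = 0"
proof (rule hausdorff_measure_zeroI)
  fix r e :: real assume r: "r > 0" and e: "e > 0"
  have "\<exists>U :: nat \<Rightarrow> 'a set. E i \<subseteq> (\<Union>j. U j) \<and> (\<forall>j. bounded (U j) \<and> diameter (U j) \<le> r)
      \<and> (\<Sum>j. diam_power s (U j)) \<le> ennreal (e * (1 / 2) ^ Suc i)" for i
    by (rule hausdorff_measure_zeroD[OF assms r]) (use e in simp)
  then obtain U :: "nat \<Rightarrow> nat \<Rightarrow> 'a set" where U: "\<And>i. E i \<subseteq> (\<Union>j. U i j)"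
    "\<And>i j. bounded (U i j) \<and> diameter (U i j) \<le> r"
    "\<And>i. (\<Sum>j. diam_power s (U i j)) \<le> ennreal (e * (1 / 2) ^ Suc i)"
    by metis
  let ?V = "\<lambda>k. case prod_decode k of (i, j) \<Rightarrow> U i j"
  have "(\<Union>i. E i) \<subseteq> (\<Union>k. ?V k)"
  proof
    fix x assume "x \<in> (\<Union>i. E i)"
    then obtain i where "x \<in> E i" by blast
    then obtain j where "x \<in> U i j" using U(1)[of i] by blast
    then have "x \<in> ?V (prod_encode (i, j))" by simp
    then show "x \<in> (\<Union>k. ?V k)" by (rule UN_I[OF UNIV_I])
  qed
  moreover have "bounded (?V k) \<and> diameter (?V k) \<le> r" for k
    using U(2) by (simp split: prod.split)
  moreover have "(\<Sum>k. diam_power s (?V k)) \<le> ennreal e"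
  proof -
    have "(\<Sum>k. diam_power s (?V k)) = (\<Sum>k. (\<lambda>(i, j). diam_power s (U i j)) (prod_decode k))"
      by (simp add: case_prod_unfold)
    also have "\<dots> = (\<Sum>i. \<Sum>j. diam_power s (U i j))"
      by (rule suminf_ennreal_2dimen) simp
    also have "\<dots> \<le> (\<Sum>i. ennreal (e * (1 / 2) ^ Suc i))"
      by (intro suminf_le U(3) summableI)
    also have "\<dots> = ennreal (\<Sum>i. e * (1 / 2) ^ Suc i)"
      using e by (intro suminf_ennreal2) (auto intro: summable_mult sums_summable[OF power_half_series])
    also have "(\<Sum>i. e * (1 / 2) ^ Suc i) = e"
      using suminf_mult[OF sums_summable[OF power_half_series], of e] sums_unique[OF power_half_series] by simp
    finally show ?thesis .
  qed
  ultimately show "\<exists>U :: nat \<Rightarrow> 'a set. (\<Union>i. E i) \<subseteq> (\<Union>i. U i) \<and> (\<forall>i. bounded (U i) \<and> diameter (U i) \<le> r)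
      \<and> (\<Sum>i. diam_power s (U i)) \<le> ennreal e" by blast
qed

text \<open>In the applications, \<open>\<phi>\<close> maps a point to the index of its cube.\<close>

lemma hausdorff_measure_zero_fibres:
  fixes E :: "'a::real_normed_vector set"
  assumes s: "s > 0"
    and cover: "\<And>r e. r > 0 \<Longrightarrow> e > 0 \<Longrightarrow> \<exists>(\<phi> :: 'a \<Rightarrow> 'b) \<rho>. finite (\<phi> ` E) \<and> 0 \<le> \<rho> \<and> \<rho> \<le> r \<and>
      (\<forall>x\<in>E. \<forall>y\<in>E. \<phi> x = \<phi> y \<longrightarrow> norm (x - y) \<le> \<rho>) \<and> real (card (\<phi> ` E)) * \<rho> powr s \<le> e"
  shows "hausdorff_measure s E = 0"
proof (rule hausdorff_measure_zeroI)
  fix r e :: real assume "r > 0" "e > 0"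
  from cover[OF this] obtain \<phi> :: "'a \<Rightarrow> 'b" and \<rho> where fin: "finite (\<phi> ` E)" and \<rho>: "0 \<le> \<rho>" "\<rho> \<le> r"
    and close: "\<And>x y. x \<in> E \<Longrightarrow> y \<in> E \<Longrightarrow> \<phi> x = \<phi> y \<Longrightarrow> norm (x - y) \<le> \<rho>"
    and small: "real (card (\<phi> ` E)) * \<rho> powr s \<le> e" by blast
  define c where "c = card (\<phi> ` E)"
  obtain h where h: "bij_betw h {0..<c} (\<phi> ` E)"
    using ex_bij_betw_nat_finite[OF fin] c_def by blast
  \<comment> \<open>Empty sets pad the finite cover to a sequence at no cost, since
    \<open>diam_power\<close> gives the empty set the value 0.\<close>
  define U where "U i = (if i < c then {x \<in> E. \<phi> x = h i} else {})" for i
  have diam: "diameter (U i) \<le> \<rho>" for i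
    by (rule diameter_le) (use \<rho>(1) close in \<open>auto simp: U_def split: if_splits\<close>)
  have bdd: "bounded (U i)" for i
  proof (cases "U i = {}")
    case False
    then obtain x where x: "x \<in> U i" by blast
    then have "dist x y \<le> \<rho>" if "y \<in> U i" for y
      using that close by (auto simp: U_def dist_norm split: if_splits)
    then show ?thesis by (auto simp: bounded_def)
  qed simp
  have "E \<subseteq> (\<Union>i. U i)"
  proof
    fix x assume x: "x \<in> E"
    then have "\<phi> x \<in> h ` {0..<c}" using h by (auto simp: bij_betw_def)
    then obtain i where "i < c" "\<phi> x = h i" by auto
    then have "x \<in> U i" using x by (simp add: U_def)
    then show "x \<in> (\<Union>i. U i)" by blast
  qed
  moreover have "(\<Sum>i. diam_power s (U i)) \<le> ennreal e"
  proof -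
    have "(\<Sum>i. diam_power s (U i)) = (\<Sum>i<c. diam_power s (U i))"
      by (rule suminf_finite) (auto simp: U_def diam_power_def)
    also have "\<dots> \<le> (\<Sum>i<c. ennreal (\<rho> powr s))"
    proof (rule sum_mono)
      fix i
      show "diam_power s (U i) \<le> ennreal (\<rho> powr s)"
        using s diam[of i] diameter_ge_0[OF bdd[of i]]
        by (auto simp: diam_power_def intro!: ennreal_leI powr_mono2)
    qed
    also have "\<dots> = ennreal (real c * \<rho> powr s)"
      by (simp add: ennreal_mult ennreal_of_nat_eq_real_of_nat)
    also have "\<dots> \<le> ennreal e" using small by (intro ennreal_leI) (simp add: c_def)
    finally show ?thesis .
  qed
  ultimately show "\<exists>U :: nat \<Rightarrow> 'a set. E \<subseteq> (\<Union>i. U i) \<and> (\<forall>i. bounded (U i) \<and> diameter (U i) \<le> r)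
      \<and> (\<Sum>i. diam_power s (U i)) \<le> ennreal e"
    using bdd diam \<rho>(2) by (meson order_trans)
qed

lemma hausdorff_measure_mono: "E \<subseteq> F \<Longrightarrow> hausdorff_measure s E \<le> hausdorff_measure s F"
  unfolding hausdorff_measure_def hausdorff_premeasure_def
  by (intro SUP_mono') (rule INF_superset_mono, auto)

lemma hausdorff_dim_le:
  "0 \<le> s \<Longrightarrow> hausdorff_measure s E = 0 \<Longrightarrow> hausdorff_dim E \<le> ereal s"
  unfolding hausdorff_dim_def by (rule INF_lower) simp

section \<open>Counting\<close>

lemma bij_betw_vec_nth:
  "bij_betw vec_nth {v :: 'a ^ 'd. \<forall>i. v $ i \<in> S i} (PiE UNIV S)"
  by (rule bij_betwI[where g = vec_lambda]) auto

lemma card_vec_Pi: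
  "card {v :: 'a ^ 'd. \<forall>i. v $ i \<in> S i} = (\<Prod>i\<in>UNIV. card (S i))"
  using bij_betw_same_card[OF bij_betw_vec_nth[of S]] by (simp add: card_PiE)

lemma finite_vec_Pi:
  assumes "\<And>i. finite (S i)"
  shows "finite {v :: 'a ^ 'd. \<forall>i. v $ i \<in> S i}"
  using bij_betw_finite[OF bij_betw_vec_nth[of S]] assms by (simp add: finite_PiE)

lemma card_le_card_image_mult:
  assumes "finite S" and "\<And>y. y \<in> f ` S \<Longrightarrow> card {x \<in> S. f x = y} \<le> w"
  shows "card S \<le> card (f ` S) * w"
proof -
  have "S = (\<Union>y\<in>f ` S. {x \<in> S. f x = y})" by auto
  then have "card S \<le> (\<Sum>y\<in>f ` S. card {x \<in> S. f x = y})"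
    using card_UN_le[of "f ` S" "\<lambda>y. {x \<in> S. f x = y}"] assms(1) by simp
  also have "\<dots> \<le> card (f ` S) * w"
    using sum_bounded_above[of "f ` S" "\<lambda>y. card {x \<in> S. f x = y}" w] assms(2) by simp
  finally show ?thesis .
qed

lemma int_ball_subset:
  fixes \<beta> \<gamma> \<rho> :: real
  assumes "\<gamma> \<noteq> 0"
  shows "{x::int. \<bar>\<beta> + \<gamma> * x\<bar> \<le> \<rho>} \<subseteq> {\<lceil>- \<beta> / \<gamma> - \<rho> / \<bar>\<gamma>\<bar>\<rceil>..\<lfloor>- \<beta> / \<gamma> + \<rho> / \<bar>\<gamma>\<bar>\<rfloor>}"
proof
  fix x :: int assume "x \<in> {x::int. \<bar>\<beta> + \<gamma> * x\<bar> \<le> \<rho>}"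
  then have "\<bar>\<gamma>\<bar> * \<bar>\<beta> / \<gamma> + x\<bar> \<le> \<rho>"
    using assms by (simp add: abs_mult[symmetric] distrib_left)
  then have "\<bar>\<beta> / \<gamma> + x\<bar> \<le> \<rho> / \<bar>\<gamma>\<bar>"
    using assms by (simp add: pos_le_divide_eq mult.commute)
  then have "- \<beta> / \<gamma> - \<rho> / \<bar>\<gamma>\<bar> \<le> x" "x \<le> - \<beta> / \<gamma> + \<rho> / \<bar>\<gamma>\<bar>"
    by (auto simp: abs_le_iff)
  then show "x \<in> {\<lceil>- \<beta> / \<gamma> - \<rho> / \<bar>\<gamma>\<bar>\<rceil>..\<lfloor>- \<beta> / \<gamma> + \<rho> / \<bar>\<gamma>\<bar>\<rfloor>}"
    by (simp add: ceiling_le_iff le_floor_iff)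
qed

lemma finite_int_ball:
  fixes \<beta> \<gamma> \<rho> :: real
  assumes "\<gamma> \<noteq> 0"
  shows "finite {x::int. \<bar>\<beta> + \<gamma> * x\<bar> \<le> \<rho>}"
  using finite_subset[OF int_ball_subset[OF assms]] by blast

text \<open>The affine form \<beta> + \<gamma> x is what a linear form becomes when all integer
  variables but one are fixed; x is then confined to an interval of length 2 \<rho> /
  |\<gamma>|.\<close>

lemma card_int_ball:
  fixes \<beta> \<gamma> \<rho> :: real
  assumes "\<gamma> \<noteq> 0" "\<rho> \<ge> 0"
  shows "real (card {x::int. \<bar>\<beta> + \<gamma> * x\<bar> \<le> \<rho>}) \<le> 2 * \<rho> / \<bar>\<gamma>\<bar> + 1"
proof -
  let ?a = "- \<beta> / \<gamma> - \<rho> / \<bar>\<gamma>\<bar>" and ?b = "- \<beta> / \<gamma> + \<rho> / \<bar>\<gamma>\<bar>"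
  have ab: "?b = ?a + 2 * \<rho> / \<bar>\<gamma>\<bar>" by simp
  have nn: "0 \<le> 2 * \<rho> / \<bar>\<gamma>\<bar>" using assms by simp
  have "card {x::int. \<bar>\<beta> + \<gamma> * x\<bar> \<le> \<rho>} \<le> card {\<lceil>?a\<rceil>..\<lfloor>?b\<rfloor>}"
    by (intro card_mono int_ball_subset assms) auto
  also have "\<dots> = nat (\<lfloor>?b\<rfloor> - \<lceil>?a\<rceil> + 1)" by simp
  finally have "real (card {x::int. \<bar>\<beta> + \<gamma> * x\<bar> \<le> \<rho>}) \<le> real (nat (\<lfloor>?b\<rfloor> - \<lceil>?a\<rceil> + 1))"
    by linarith
  also have "\<dots> \<le> 2 * \<rho> / \<bar>\<gamma>\<bar> + 1"
  proof (cases "\<lfloor>?b\<rfloor> - \<lceil>?a\<rceil> + 1 \<ge> 0")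
    case True
    have "of_int (\<lfloor>?b\<rfloor> - \<lceil>?a\<rceil> + 1) \<le> ?b - ?a + 1"
      using of_int_floor_le[of ?b] le_of_int_ceiling[of ?a] by (simp del: of_int_floor_le le_of_int_ceiling)
    then show ?thesis using True ab by (simp add: of_nat_nat)
  next
    case False
    then show ?thesis using nn by simp
  qed
  finally show ?thesis .
qed

lemma infnorm_le_iff_cart: "infnorm (x :: real ^ 'd) \<le> r \<longleftrightarrow> (\<forall>i. \<bar>x $ i\<bar> \<le> r)"
proof
  assume "infnorm x \<le> r"
  then show "\<forall>i. \<bar>x $ i\<bar> \<le> r"
    using component_le_infnorm_cart order_trans by blast
next
  assume "\<forall>i. \<bar>x $ i\<bar> \<le> r"
  then show "infnorm x \<le> r"
    by (auto simp: infnorm_cart intro!: cSup_least)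
qed

section \<open>Short vectors of lattices\<close>

text \<open>A discrete subgroup of R^d, parametrised injectively. The counts in this locale compare
  balls of one and the same lattice; the covolume enters later, through determinants.\<close>

locale lattice_map =
  fixes f :: "'g::ab_group_add \<Rightarrow> real ^ 'd"
  assumes map_diff: "f (x - y) = f x - f y"
    and map_eq_0: "f x = 0 \<Longrightarrow> x = 0"
    and finite_ball: "finite {z. infnorm (f z) \<le> r}"
begin

lemma map_0: "f 0 = 0"
  using map_diff[of 0 0] by simp

lemma map_uminus: "f (- x) = - f x"
  using map_diff[of 0 x] map_0 by simp

lemma map_add: "f (x + y) = f x + f y"
  using map_diff[of x "- y"] map_uminus by simp

text \<open>The group has no scalar multiplication, so natural multiples are iterated
  additions.\<close>

definition multiple :: "nat \<Rightarrow> 'g \<Rightarrow> 'g" where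
  "multiple j x = ((+) x ^^ j) 0"

lemma map_multiple: "f (multiple j x) = real j *\<^sub>R f x"
  unfolding multiple_def
  by (induction j) (simp_all add: map_0 map_add algebra_simps)

text \<open>
  Translating the small ball by multiples of three times its longest vector gives disjoint copies.
\<close>

lemma card_small_ball:
  fixes r :: real and y :: nat
  assumes "r > 0"
  shows "card {z. infnorm (f z) \<le> r} \<le> 1 \<or>
         card {z. infnorm (f z) \<le> r} * (y + 1) \<le> card {z. infnorm (f z) \<le> (3 * real y + 1) * r}"
proof (cases "\<exists>e. e \<noteq> 0 \<and> infnorm (f e) \<le> r")
  case False
  then have "{z. infnorm (f z) \<le> r} \<subseteq> {0}" by auto
  then have "card {z. infnorm (f z) \<le> r} \<le> card {0::'g}" by (intro card_mono) auto
  then show ?thesis by simp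
next
  case True
  let ?B = "{z. infnorm (f z) \<le> r}"
  let ?N = "(\<lambda>z. infnorm (f z)) ` ?B"
  have fin: "finite ?N" using finite_ball by blast
  have ne: "?N \<noteq> {}" using True by blast
  obtain e where e: "e \<in> ?B" "infnorm (f e) = Max ?N"
    using Max_in[OF fin ne] by force
  have emax: "infnorm (f z) \<le> infnorm (f e)" if "z \<in> ?B" for z
    using Max_ge[OF fin] that e(2) by auto
  have epos: "infnorm (f e) > 0"
  proof -
    obtain e' where "e' \<noteq> 0" "e' \<in> ?B" using True by blast
    then show ?thesis using emax[of e'] map_eq_0[of e'] infnorm_pos_lt[of "f e'"] by force
  qed
  let ?h = "\<lambda>(z, j). z + multiple (3 * j) e"
  \<comment> \<open>Two vectors of the ball differ by at most 2 \<open>infnorm (f e)\<close>,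
    because e is longest in the ball, whereas distinct translations differ by at least 3
    \<open>infnorm (f e)\<close>.\<close>
  have "inj_on ?h (?B \<times> {..y})"
  proof (rule inj_onI, clarsimp simp del: of_nat_mult)
    fix z i z' j
    assume z: "infnorm (f z) \<le> r" and z': "infnorm (f z') \<le> r"
      and eq: "z + multiple (3 * i) e = z' + multiple (3 * j) e"
    have "f z - f z' = (real (3 * j) - real (3 * i)) *\<^sub>R f e"
      using arg_cong[OF eq, of f] by (simp add: map_add map_multiple algebra_simps)
    then have "\<bar>real (3 * j) - real (3 * i)\<bar> * infnorm (f e) = infnorm (f z - f z')"
      by (simp add: infnorm_mul)
    also have "\<dots> \<le> infnorm (f z) + infnorm (f z')"
      using infnorm_triangle[of "f z" "- f z'"] by (simp add: infnorm_neg)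
    also have "\<dots> \<le> 2 * infnorm (f e)" using emax[of z] emax[of z'] z z' by simp
    finally have "\<bar>real (3 * j) - real (3 * i)\<bar> \<le> 2" using epos by simp
    then have "i = j" by linarith
    then show "z = z' \<and> i = j" using eq by simp
  qed
  then have "card ?B * (y + 1) = card (?h ` (?B \<times> {..y}))"
    by (simp add: card_image card_cartesian_product)
  also have "\<dots> \<le> card {z. infnorm (f z) \<le> (3 * real y + 1) * r}"
  proof (intro card_mono finite_ball, clarsimp)
    fix z j assume z: "infnorm (f z) \<le> r" and j: "j \<le> y"
    have "infnorm (f (z + multiple (3 * j) e)) \<le> infnorm (f z) + 3 * real j * infnorm (f e)"
      using infnorm_triangle[of "f z" "real (3 * j) *\<^sub>R f e"]
      by (simp add: map_add map_multiple infnorm_mul)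
    also have "\<dots> \<le> r + 3 * real y * r"
      using z j e(1) infnorm_pos_le[of "f e"] by (intro add_mono mult_mono) auto
    finally show "infnorm (f (z + multiple (3 * j) e)) \<le> (3 * real y + 1) * r"
      by (simp add: algebra_simps)
  qed
  finally show ?thesis by simp
qed

lemma card_translate_le:
  assumes "S \<subseteq> {z. infnorm (f z - f z0) \<le> r}"
  shows "card S \<le> card {z. infnorm (f z) \<le> r}"
proof (rule card_inj_on_le[where f = "\<lambda>z. z - z0"])
  show "inj_on (\<lambda>z. z - z0) S" by (simp add: inj_on_def)
  show "(\<lambda>z. z - z0) ` S \<subseteq> {z. infnorm (f z) \<le> r}" using assms by (auto simp: map_diff)
qed (rule finite_ball)

text \<open>On the hyperplane, the coordinate in which the normal a is largest is controlled by the
  other d - 1 coordinates. So a small box in those coordinates holds no more vectors than the unit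
  ball, and about s^(d-1) boxes occur: one power of s is saved compared with a full lattice.\<close>

lemma card_ball_hyperplane:
  fixes a :: "real ^ 'd"
  assumes a: "a \<noteq> 0" and hyp: "\<And>z. infnorm (f z) \<le> s \<Longrightarrow> a \<bullet> f z = 0" and s: "s \<ge> 1"
  shows "real (card {z. infnorm (f z) \<le> s}) \<le>
         (4 * real CARD('d) * s) ^ (CARD('d) - 1) * card {z. infnorm (f z) \<le> 1}"
proof -
  let ?d = "real CARD('d)"
  let ?B = "{z. infnorm (f z) \<le> s}"
  have d1: "?d \<ge> 1" by (simp add: Suc_leI)
  obtain i0 where i0: "\<And>i. \<bar>a $ i\<bar> \<le> \<bar>a $ i0\<bar>"
  proof -
    have "Max (range (\<lambda>i. \<bar>a $ i\<bar>)) \<in> range (\<lambda>i. \<bar>a $ i\<bar>)"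
      by (intro Max_in) auto
    then obtain i0 where "Max (range (\<lambda>i. \<bar>a $ i\<bar>)) = \<bar>a $ i0\<bar>" by blast
    then show ?thesis using that Max_ge[of "range (\<lambda>i. \<bar>a $ i\<bar>)"] by force
  qed
  have ai0: "\<bar>a $ i0\<bar> > 0"
  proof (rule ccontr)
    assume "\<not> \<bar>a $ i0\<bar> > 0"
    then have "\<And>i. a $ i = 0" using i0 by (metis abs_le_zero_iff abs_ge_zero antisym not_less)
    then show False using a by (simp add: vec_eq_iff)
  qed
  \<comment> \<open>The mesh is 1 / d in the coordinates other than \<open>i0\<close>: for two
    vectors in the same box, the hyperplane equation bounds the remaining coordinate of the
    difference by (d - 1) / d, hence by 1.\<close>
  define \<phi> :: "'g \<Rightarrow> int ^ 'd" where "\<phi> z = (\<chi> i. if i = i0 then 0 else \<lfloor>?d * f z $ i\<rfloor>)" for z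
  define S :: "'d \<Rightarrow> int set" where
    "S i = (if i = i0 then {0} else {\<lfloor>- (?d * s)\<rfloor>..\<lfloor>?d * s\<rfloor>})" for i
  have img: "\<phi> ` ?B \<subseteq> {v. \<forall>i. v $ i \<in> S i}"
  proof (clarsimp simp: S_def \<phi>_def)
    fix z i assume "infnorm (f z) \<le> s"
    then have "\<bar>f z $ i\<bar> \<le> s" by (simp add: infnorm_le_iff_cart)
    then have "- s \<le> f z $ i" "f z $ i \<le> s" by auto
    then have "?d * (- s) \<le> ?d * f z $ i" "?d * f z $ i \<le> ?d * s"
      by (intro mult_left_mono; simp)+
    then show "\<lfloor>- (?d * s)\<rfloor> \<le> \<lfloor>?d * f z $ i\<rfloor> \<and> \<lfloor>?d * f z $ i\<rfloor> \<le> \<lfloor>?d * s\<rfloor>"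
      by (auto intro: floor_mono)
  qed
  have cardS: "real (card (S i)) \<le> 4 * ?d * s" if "i \<noteq> i0" for i
  proof -
    have ds: "?d * s \<ge> 1" using d1 s by (metis mult_mono' mult_1 zero_le_one)
    have "real (card (S i)) = real (nat (\<lfloor>?d * s\<rfloor> - \<lfloor>- (?d * s)\<rfloor> + 1))"
      using that by (simp add: S_def)
    also have "\<dots> = of_int (\<lfloor>?d * s\<rfloor> - \<lfloor>- (?d * s)\<rfloor> + 1)"
      using ds by (intro of_nat_nat) linarith
    \<comment> \<open>The count is at most 2 d s + 2, and d s is at least 1.\<close>
    also have "\<dots> \<le> 4 * (?d * s)" using ds by simp linarith
    finally show ?thesis by (simp add: mult.assoc)
  qed
  have "card (\<phi> ` ?B) \<le> card {v. \<forall>i. v $ i \<in> S i}"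
    by (intro card_mono img finite_vec_Pi) (simp add: S_def)
  also have "\<dots> = (\<Prod>i\<in>UNIV. card (S i))" by (rule card_vec_Pi)
  also have "\<dots> = (\<Prod>i\<in>UNIV - {i0}. card (S i))"
    by (subst prod.remove[of _ i0]) (auto simp: S_def)
  finally have "real (card (\<phi> ` ?B)) \<le> real (\<Prod>i\<in>UNIV - {i0}. card (S i))" by linarith
  also have "\<dots> = (\<Prod>i\<in>UNIV - {i0}. real (card (S i)))" by simp
  also have "\<dots> \<le> (\<Prod>i\<in>UNIV - {i0}. 4 * ?d * s)"
    by (intro prod_mono) (auto simp: cardS)
  also have "\<dots> = (4 * ?d * s) ^ (CARD('d) - 1)" by (simp add: card_Diff_singleton)
  finally have card_img: "real (card (\<phi> ` ?B)) \<le> (4 * ?d * s) ^ (CARD('d) - 1)" .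
  have "card ?B \<le> card (\<phi> ` ?B) * card {z. infnorm (f z) \<le> 1}"
  proof (intro card_le_card_image_mult finite_ball)
    fix y assume "y \<in> \<phi> ` ?B"
    then obtain z0 where z0: "infnorm (f z0) \<le> s" "y = \<phi> z0" by blast
    show "card {z \<in> ?B. \<phi> z = y} \<le> card {z. infnorm (f z) \<le> 1}"
    proof (intro card_translate_le[of _ z0] subsetI, clarsimp simp: z0(2))
      fix z assume z: "infnorm (f z) \<le> s" "\<phi> z = \<phi> z0"
      define x where "x = f z - f z0"
      have xi: "\<bar>x $ i\<bar> \<le> 1 / ?d" if "i \<noteq> i0" for i
      proof -
        have "\<lfloor>?d * f z $ i\<rfloor> = \<lfloor>?d * f z0 $ i\<rfloor>"
          using arg_cong[OF z(2), of "\<lambda>v. v $ i"] that by (simp add: \<phi>_def)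
        then have "\<bar>?d * f z $ i - ?d * f z0 $ i\<bar> \<le> 1" by linarith
        then have "\<bar>?d * x $ i\<bar> \<le> 1" by (simp add: x_def right_diff_distrib)
        then show ?thesis using d1 by (simp add: abs_mult field_simps)
      qed
      have "a \<bullet> x = 0" using hyp z z0 by (simp add: x_def inner_diff_right)
      then have "a $ i0 * x $ i0 + (\<Sum>i\<in>UNIV - {i0}. a $ i * x $ i) = 0"
        by (simp add: inner_vec_def sum.remove[of UNIV i0])
      then have "\<bar>a $ i0\<bar> * \<bar>x $ i0\<bar> = \<bar>\<Sum>i\<in>UNIV - {i0}. a $ i * x $ i\<bar>"
        by (simp add: abs_mult[symmetric])
      also have "\<dots> \<le> (\<Sum>i\<in>UNIV - {i0}. \<bar>a $ i0\<bar> * (1 / ?d))"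
      proof (rule order_trans[OF sum_abs], rule sum_mono)
        fix i assume "i \<in> UNIV - {i0}"
        then show "\<bar>a $ i * x $ i\<bar> \<le> \<bar>a $ i0\<bar> * (1 / ?d)"
          unfolding abs_mult by (intro mult_mono xi i0) auto
      qed
      also have "\<dots> = \<bar>a $ i0\<bar> * ((?d - 1) / ?d)"
        using d1 by (simp add: card_Diff_singleton of_nat_diff)
      finally have "\<bar>x $ i0\<bar> \<le> (?d - 1) / ?d"
        by (rule mult_left_le_imp_le) (rule ai0)
      also have "\<dots> \<le> 1" using d1 by simp
      finally have "\<bar>x $ i0\<bar> \<le> 1" .
      moreover have "1 / ?d \<le> 1" using d1 by simp
      ultimately show "infnorm (f z - f z0) \<le> 1"
        unfolding x_def[symmetric] infnorm_le_iff_cart using xi by (metis order_trans)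
    qed
  qed
  then have "real (card ?B) \<le> real (card (\<phi> ` ?B) * card {z. infnorm (f z) \<le> 1})" by linarith
  also have "\<dots> \<le> (4 * ?d * s) ^ (CARD('d) - 1) * card {z. infnorm (f z) \<le> 1}"
    using card_img by (simp add: mult_right_mono)
  finally show ?thesis .
qed

end

section \<open>Lattices given by a matrix, and Cramer's rule for determinant 1\<close>

definition real_vec :: "int ^ 'd \<Rightarrow> real ^ 'd" where
  "real_vec z = (\<chi> i. real_of_int (z $ i))"

lemma real_vec_nth [simp]: "real_vec z $ i = real_of_int (z $ i)"
  by (simp add: real_vec_def)

text \<open>The inverse matrix bounds the integer coordinates of a vector in terms of its image,
  which makes balls finite.\<close>

lemma lattice_map_matrix:
  fixes G :: "real ^ 'd ^ 'd"
  assumes "det G \<noteq> 0"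
  shows "lattice_map (\<lambda>z. G *v real_vec z)"
proof
  obtain H where H: "H ** G = mat 1"
    using assms invertible_det_nz[of G] by (auto simp: invertible_def)
  have inv: "H *v (G *v real_vec z) = real_vec z" for z
    by (simp add: matrix_vector_mul_assoc H)
  show "G *v real_vec (x - y) = G *v real_vec x - G *v real_vec y" for x y
  proof -
    have "real_vec (x - y) = real_vec x - real_vec y" by (simp add: vec_eq_iff)
    then show ?thesis by (simp add: matrix_vector_mult_diff_distrib)
  qed
  show "x = 0" if "G *v real_vec x = 0" for x
  proof -
    have "real_vec x = 0" using inv[of x] that by (simp add: matrix_vector_mult_0_right)
    then show ?thesis by (simp add: vec_eq_iff)
  qed
  show "finite {z. infnorm (G *v real_vec z) \<le> r}" for r
  proof (rule finite_subset)
    show "finite {z :: int ^ 'd. \<forall>i. z $ i \<in> {- \<lceil>\<Sum>j\<in>UNIV. \<bar>H $ i $ j\<bar> * r\<rceil>..\<lceil>\<Sum>j\<in>UNIV. \<bar>H $ i $ j\<bar> * r\<rceil>}}"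
      by (rule finite_vec_Pi) simp
    show "{z. infnorm (G *v real_vec z) \<le> r} \<subseteq>
          {z. \<forall>i. z $ i \<in> {- \<lceil>\<Sum>j\<in>UNIV. \<bar>H $ i $ j\<bar> * r\<rceil>..\<lceil>\<Sum>j\<in>UNIV. \<bar>H $ i $ j\<bar> * r\<rceil>}}"
    proof (intro subsetI CollectI allI)
      fix z i assume "z \<in> {z. infnorm (G *v real_vec z) \<le> r}"
      then have r: "\<bar>(G *v real_vec z) $ j\<bar> \<le> r" for j by (simp add: infnorm_le_iff_cart)
      have "real_vec z $ i = (\<Sum>j\<in>UNIV. H $ i $ j * (G *v real_vec z) $ j)"
        by (subst inv[symmetric]) (simp add: matrix_vector_mult_def)
      then have "\<bar>real_of_int (z $ i)\<bar> \<le> (\<Sum>j\<in>UNIV. \<bar>H $ i $ j\<bar> * r)"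
        by (auto simp: abs_mult intro!: order_trans[OF sum_abs] sum_mono mult_left_mono r)
      also have "\<dots> \<le> of_int \<lceil>\<Sum>j\<in>UNIV. \<bar>H $ i $ j\<bar> * r\<rceil>" by (rule le_of_int_ceiling)
      finally have "\<bar>z $ i\<bar> \<le> \<lceil>\<Sum>j\<in>UNIV. \<bar>H $ i $ j\<bar> * r\<rceil>" by linarith
      then show "z $ i \<in> {- \<lceil>\<Sum>j\<in>UNIV. \<bar>H $ i $ j\<bar> * r\<rceil>..\<lceil>\<Sum>j\<in>UNIV. \<bar>H $ i $ j\<bar> * r\<rceil>}"
        by (auto simp: abs_le_iff)
    qed
  qed
qed

lemma det_in_Ints:
  fixes X :: "real ^ 'd ^ 'd"
  assumes "\<And>i j. X $ i $ j \<in> \<int>"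
  shows "det X \<in> \<int>"
  unfolding det_def by (intro Ints_sum Ints_mult Ints_prod assms) simp

lemma abs_det_le:
  fixes X :: "real ^ 'd ^ 'd"
  assumes "\<And>i j. \<bar>X $ i $ j\<bar> \<le> s"
  shows "\<bar>det X\<bar> \<le> fact CARD('d) * s ^ CARD('d)"
proof -
  have "\<bar>det X\<bar> \<le> (\<Sum>p | p permutes (UNIV :: 'd set). s ^ CARD('d))"
    unfolding det_def
  proof (rule order_trans[OF sum_abs], rule sum_mono)
    fix p assume "p \<in> {p. p permutes (UNIV :: 'd set)}"
    have "\<bar>of_int (sign p) * (\<Prod>i\<in>UNIV. X $ i $ p i)\<bar> = (\<Prod>i\<in>UNIV. \<bar>X $ i $ p i\<bar>)"
      by (simp add: abs_mult abs_prod sign_def)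
    also have "\<dots> \<le> (\<Prod>i\<in>(UNIV :: 'd set). s)"
      by (intro prod_mono) (use assms in auto)
    finally show "\<bar>of_int (sign p) * (\<Prod>i\<in>UNIV. X $ i $ p i)\<bar> \<le> s ^ CARD('d)" by simp
  qed
  also have "\<dots> = fact CARD('d) * s ^ CARD('d)"
    by (simp add: card_permutations)
  finally show ?thesis .
qed

text \<open>
  By Cramer's rule, the coordinates of a lattice vector in a basis of short lattice vectors are
  determined by integer determinants of bounded size.
\<close>

lemma card_ball_spanning:
  fixes G :: "real ^ 'd ^ 'd"
  assumes detG: "det G = 1"
    and span: "span ((\<lambda>z. G *v real_vec z) ` {z. infnorm (G *v real_vec z) \<le> s}) = UNIV"
  shows "real (card {z. infnorm (G *v real_vec z) \<le> s})
    \<le> (2 * (fact CARD('d) * s ^ CARD('d)) + 1) ^ CARD('d)"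
proof -
  define f where "f = (\<lambda>z. G *v real_vec z)"
  interpret lattice_map f unfolding f_def by (rule lattice_map_matrix) (simp add: detG)
  let ?B = "{z. infnorm (f z) \<le> s}"
  obtain Bs where Bs: "Bs \<subseteq> f ` ?B" "independent Bs" "f ` ?B \<subseteq> span Bs" "card Bs = dim (f ` ?B)"
    using basis_exists by blast
  have "span Bs = UNIV"
    using span Bs(3) span_mono[OF Bs(3)] by (auto simp: f_def span_span)
  moreover have "card Bs = CARD('d)"
    using Bs(4) span dim_span[of "f ` ?B"] by (simp add: f_def dim_UNIV)
  ultimately obtain h where h: "bij_betw h (UNIV :: 'd set) Bs"
    using finite_same_card_bij[of "UNIV :: 'd set" Bs] Bs(2) independent_imp_finite by auto
  define w where "w i = (SOME z. z \<in> ?B \<and> f z = h i)" for i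
  have w: "w i \<in> ?B \<and> f (w i) = h i" for i
  proof -
    have "h i \<in> f ` ?B" using h Bs(1) by (auto simp: bij_betw_def)
    then have "\<exists>z. z \<in> ?B \<and> f z = h i" by force
    then show ?thesis unfolding w_def by (rule someI_ex)
  qed
  define W :: "('d \<Rightarrow> int ^ 'd) \<Rightarrow> real ^ 'd ^ 'd" where "W b = (\<chi> a i. f (b i) $ a)" for b
  have W_int: "det (W b) \<in> \<int>" for b
  proof -
    \<comment> \<open>The columns are G times integer vectors, so det G = 1 makes the determinant an
      integer although G is real.\<close>
    have "W b = G ** (\<chi> a i. real_of_int (b i $ a))"
      by (simp add: W_def f_def vec_eq_iff matrix_matrix_mult_def matrix_vector_mult_def)
    then have "det (W b) = det (\<chi> a i. real_of_int (b i $ a))"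
      by (simp add: det_mul detG)
    then show ?thesis by (simp add: det_in_Ints)
  qed
  have W_le: "\<bar>det (W b)\<bar> \<le> fact CARD('d) * s ^ CARD('d)" if "\<And>i. b i \<in> ?B" for b
    by (rule abs_det_le) (use that in \<open>auto simp: W_def infnorm_le_iff_cart\<close>)
  have "columns (W w) = Bs"
    using h w by (force simp: columns_def column_def W_def bij_betw_def vec_eq_iff)
  then obtain X where "W w ** X = mat 1"
    using \<open>span Bs = UNIV\<close> matrix_right_invertible_span_columns[of "W w"]
    by (auto simp: span_vec_eq)
  then have "det (W w) * det X = 1" by (metis det_mul det_I)
  then have detW: "det (W w) \<noteq> 0" by auto
  \<comment> \<open>The components are the numerators in Cramer's rule. They are integers already;
    the floor only moves them to the type \<open>int\<close>.\<close>
  define \<phi> :: "int ^ 'd \<Rightarrow> int ^ 'd" where "\<phi> v = (\<chi> k. \<lfloor>det (W (w(k := v)))\<rfloor>)" for v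
  have \<phi>: "real_of_int (\<phi> v $ k) = det (W (w(k := v)))" for v k
    using W_int[of "w(k := v)"] by (auto simp: \<phi>_def elim: Ints_cases)
  have recover: "f v = W w *v (\<chi> k. \<phi> v $ k / det (W w))" for v
  proof -
    have "W (w(k := v)) = (\<chi> i j. if j = k then f v $ i else W w $ i $ j)" for k
      by (simp add: W_def vec_eq_iff)
    then show ?thesis
      using cramer[OF detW, of "\<chi> k. \<phi> v $ k / det (W w)" "f v"] by (simp add: \<phi>)
  qed
  have "inj_on \<phi> ?B"
  proof (rule inj_onI)
    fix u v assume "\<phi> u = \<phi> v"
    then have "f (u - v) = 0" using recover[of u] recover[of v] by (simp add: map_diff)
    then show "u = v" using map_eq_0 by fastforce
  qed
  then have "card ?B = card (\<phi> ` ?B)" by (simp add: card_image)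
  also have "\<dots> \<le> card {v :: int ^ 'd. \<forall>i. v $ i \<in> {x. \<bar>0 + 1 * real_of_int x\<bar> \<le> fact CARD('d) * s ^ CARD('d)}}"
  proof (rule card_mono)
    show "finite {v :: int ^ 'd. \<forall>i. v $ i \<in> {x. \<bar>0 + 1 * real_of_int x\<bar> \<le> fact CARD('d) * s ^ CARD('d)}}"
      by (intro finite_vec_Pi finite_int_ball) simp
    show "\<phi> ` ?B \<subseteq> {v. \<forall>i. v $ i \<in> {x. \<bar>0 + 1 * real_of_int x\<bar> \<le> fact CARD('d) * s ^ CARD('d)}}"
    proof (clarsimp simp: \<phi> simp del: of_int_abs)
      fix v i assume "infnorm (f v) \<le> s"
      then show "\<bar>det (W (w(i := v)))\<bar> \<le> fact CARD('d) * s ^ CARD('d)"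
        using conjunct1[OF w] by (intro W_le) simp
    qed
  qed
  also have "\<dots> = (card {x. \<bar>0 + 1 * real_of_int x\<bar> \<le> fact CARD('d) * s ^ CARD('d)}) ^ CARD('d)"
    by (subst card_vec_Pi) simp
  finally have "real (card ?B) \<le> real (card {x. \<bar>0 + 1 * real_of_int x\<bar> \<le> fact CARD('d) * s ^ CARD('d)}) ^ CARD('d)"
    by (metis of_nat_le_iff of_nat_power)
  also have "\<dots> \<le> (2 * (fact CARD('d) * s ^ CARD('d)) + 1) ^ CARD('d)"
  proof (intro power_mono)
    have "0 \<le> fact CARD('d) * s ^ CARD('d)"
      using W_le[of w] w abs_ge_zero order_trans by blast
    then show "real (card {x. \<bar>0 + 1 * real_of_int x\<bar> \<le> fact CARD('d) * s ^ CARD('d)})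
       \<le> 2 * (fact CARD('d) * s ^ CARD('d)) + 1"
      using card_int_ball[of 1 "fact CARD('d) * s ^ CARD('d)" 0] by simp
  qed simp
  finally show ?thesis by (simp add: f_def)
qed

section \<open>The lattice of a matrix\<close>

text \<open>
  An integer vector is a pair \<open>(q, p)\<close> with \<open>q\<close> in the \<open>Inl\<close> and \<open>p\<close> in the \<open>Inr\<close> components;
  the lattice vectors are \<open>(q / T\<^sup>m\<^sup>k, T\<^sup>n\<^sup>k (A q + p))\<close>.
\<close>

definition lattice_matrix :: "nat \<Rightarrow> nat \<Rightarrow> real ^ 'n ^ 'm \<Rightarrow> real ^ ('n + 'm) ^ ('n + 'm)" where
  "lattice_matrix T k A = (\<chi> s u. case s of
     Inl j \<Rightarrow> (if u = Inl j then 1 / real T ^ (CARD('m) * k) else 0)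
   | Inr i \<Rightarrow> real T ^ (CARD('n) * k) *
       (case u of Inl j \<Rightarrow> A $ i $ j | Inr i' \<Rightarrow> if i' = i then 1 else 0))"

definition embed :: "nat \<Rightarrow> nat \<Rightarrow> real ^ 'n ^ 'm \<Rightarrow> int ^ ('n + 'm) \<Rightarrow> real ^ ('n + 'm)" where
  "embed T k A z = lattice_matrix T k A *v real_vec z"

lemma UNIV_sum_Plus: "(UNIV :: ('n + 'm) set) = Inl ` UNIV \<union> Inr ` UNIV"
  using UNIV_Plus_UNIV by (metis Plus_def)

lemma sum_UNIV_Plus:
  fixes g :: "'n::finite + 'm::finite \<Rightarrow> 'a::comm_monoid_add"
  shows "(\<Sum>s\<in>UNIV. g s) = (\<Sum>j\<in>UNIV. g (Inl j)) + (\<Sum>i\<in>UNIV. g (Inr i))"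
  unfolding UNIV_sum_Plus by (subst sum.union_disjoint) (auto simp: sum.reindex)

lemma prod_UNIV_Plus:
  fixes g :: "'n::finite + 'm::finite \<Rightarrow> 'a::comm_monoid_mult"
  shows "(\<Prod>s\<in>UNIV. g s) = (\<Prod>j\<in>UNIV. g (Inl j)) * (\<Prod>i\<in>UNIV. g (Inr i))"
  unfolding UNIV_sum_Plus by (subst prod.union_disjoint) (auto simp: prod.reindex)

lemma embed_Inl:
  "embed T k (A :: real ^ 'n ^ 'm) z $ Inl j = z $ Inl j / real T ^ (CARD('m) * k)"
  unfolding embed_def lattice_matrix_def matrix_vector_mult_def
  by (simp add: if_distrib[of "\<lambda>x. x * _"] sum.delta' cong: if_cong)

lemma embed_Inr:
  "embed T k (A :: real ^ 'n ^ 'm) z $ Inr i =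
     real T ^ (CARD('n) * k) * ((\<Sum>j\<in>UNIV. A $ i $ j * z $ Inl j) + z $ Inr i)"
  unfolding embed_def lattice_matrix_def matrix_vector_mult_def
  by (simp add: sum_UNIV_Plus distrib_left sum_distrib_left mult.assoc
      if_distrib[of "\<lambda>x. x * _"] if_distrib[of "\<lambda>x. _ * x"] sum.delta cong: if_cong)

text \<open>The matrix is block triangular: a permutation with nonzero product fixes every
  \<open>Inl j\<close>, hence by injectivity cannot send an \<open>Inr i\<close> there, and is the
  identity. On the diagonal, T^(-mk) occurs n times and T^(nk) occurs m times.\<close>

lemma det_lattice_matrix:
  assumes "T > 0"
  shows "det (lattice_matrix T k (A :: real ^ 'n ^ 'm)) = 1"
proof -
  let ?G = "lattice_matrix T k A"
  have diag: "(\<Prod>s\<in>UNIV. ?G $ s $ s) = 1"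
    using assms by (simp add: prod_UNIV_Plus lattice_matrix_def power_mult[symmetric] power_one_over
      field_simps)
  have "det ?G = (\<Sum>p\<in>{id}. of_int (sign p) * (\<Prod>s\<in>UNIV. ?G $ s $ p s))"
    unfolding det_def
  proof (rule sum.mono_neutral_right)
    show "\<forall>p\<in>{p. p permutes UNIV} - {id}. of_int (sign p) * (\<Prod>s\<in>UNIV. ?G $ s $ p s) = 0"
    proof (rule ballI, rule ccontr)
      fix p :: "'n + 'm \<Rightarrow> 'n + 'm"
      assume p: "p \<in> {p. p permutes UNIV} - {id}"
        and "of_int (sign p) * (\<Prod>s\<in>UNIV. ?G $ s $ p s) \<noteq> 0"
      then have nz: "?G $ s $ p s \<noteq> 0" for s by simp
      have inl: "p (Inl j) = Inl j" for j
        using nz[of "Inl j"] by (auto simp: lattice_matrix_def split: if_splits)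
      have "p (Inr i) = Inr i" for i
      proof (cases "p (Inr i)")
        case (Inl j)
        then have "p (Inr i) = p (Inl j)" using inl by simp
        then show ?thesis using p permutes_inj[of p UNIV] by (auto dest: injD)
      next
        case (Inr i')
        then show ?thesis using nz[of "Inr i"] by (auto simp: lattice_matrix_def split: if_splits)
      qed
      with inl have "p = id" by (metis eq_id_iff sum.exhaust)
      then show False using p by simp
    qed
  qed (auto simp: permutes_id)
  then show ?thesis using diag by simp
qed

lemma lattice_map_embed:
  assumes "T > 0"
  shows "lattice_map (embed T k A)"
  using lattice_map_matrix[of "lattice_matrix T k A"] det_lattice_matrix[OF assms, of k A]
  by (simp add: embed_def[abs_def])

section \<open>Short vectors of the lattice of A\<close>

definition short :: "nat \<Rightarrow> nat \<Rightarrow> real ^ 'n ^ 'm \<Rightarrow> real \<Rightarrow> (int ^ ('n + 'm)) set" where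
  "short T k A r = {z. infnorm (embed T k A z) \<le> r}"

lemma finite_short: "T > 0 \<Longrightarrow> finite (short T k A r)"
  unfolding short_def using lattice_map.finite_ball[OF lattice_map_embed] .

lemma short_iff:
  assumes "T > 0"
  shows "z \<in> short T k (A :: real ^ 'n ^ 'm) r \<longleftrightarrow>
    (\<forall>j. \<bar>real_of_int (z $ Inl j)\<bar> \<le> r * real T ^ (CARD('m) * k)) \<and>
    (\<forall>i. \<bar>(\<Sum>j\<in>UNIV. A $ i $ j * z $ Inl j) + z $ Inr i\<bar> \<le> r / real T ^ (CARD('n) * k))"
proof -
  have T: "real T ^ e > 0" for e using assms by simp
  have *: "(\<forall>s. P s) \<longleftrightarrow> (\<forall>j. P (Inl j)) \<and> (\<forall>i. P (Inr i))" for P :: "'n + 'm \<Rightarrow> bool"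
    by (metis sum.exhaust)
  show ?thesis
    unfolding short_def mem_Collect_eq infnorm_le_iff_cart *
    using T by (simp add: embed_Inl embed_Inr abs_mult pos_divide_le_eq pos_le_divide_eq mult.commute)
qed

lemma short_mono: "r \<le> s \<Longrightarrow> short T k A r \<subseteq> short T k A s"
  by (auto simp: short_def)

lemma card_short_spanning:
  fixes A :: "real ^ 'n ^ 'm"
  assumes "T > 0" "span (embed T k A ` short T k A s) = UNIV"
  shows "real (card (short T k A s))
    \<le> (2 * (fact CARD('n + 'm) * s ^ CARD('n + 'm)) + 1) ^ CARD('n + 'm)"
  using card_ball_spanning[OF det_lattice_matrix[OF assms(1), of k A], of s] assms(2)
  unfolding short_def embed_def[abs_def] .

text \<open>The hyperplane is taken at the radius S, so one and the same failure to span gives the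
  bound for every radius s up to S.\<close>

lemma card_short_not_spanning:
  fixes A :: "real ^ 'n ^ 'm"
  assumes "T > 0" "span (embed T k A ` short T k A S) \<noteq> UNIV" "1 \<le> s" "s \<le> S"
  shows "real (card (short T k A s))
    \<le> (4 * real CARD('n + 'm) * s) ^ (CARD('n + 'm) - 1) * card (short T k A 1)"
proof -
  obtain a where a: "a \<noteq> 0" "span (embed T k A ` short T k A S) \<subseteq> {x. a \<bullet> x = 0}"
    using span_not_univ_subset_hyperplane[OF assms(2)] by blast
  have "a \<bullet> embed T k A z = 0" if "infnorm (embed T k A z) \<le> s" for z
  proof -
    have "z \<in> short T k A S" using that assms(4) by (simp add: short_def)
    then show ?thesis using a(2) span_base by blast
  qed
  then show ?thesis
    using lattice_map.card_ball_hyperplane[OF lattice_map_embed[OF assms(1)] a(1), where s = s] assms(3)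
    unfolding short_def by simp
qed

text \<open>The summand 1 covers the case in which only the zero vector is short. Otherwise the ball
  is so much smaller than the enlarged one that a factor of about y is gained.\<close>

lemma card_short_small:
  fixes A :: "real ^ 'n ^ 'm" and y :: nat
  assumes "T > 0" "r > 0"
  shows "real (card (short T k A r)) \<le> 1 + real (card (short T k A ((3 * real y + 1) * r))) / (y + 1)"
proof -
  consider "card (short T k A r) \<le> 1"
    | "card (short T k A r) * (y + 1) \<le> card (short T k A ((3 * real y + 1) * r))"
    using lattice_map.card_small_ball[OF lattice_map_embed[OF assms(1)] assms(2), of k A y]
    unfolding short_def by blast
  then show ?thesis
  proof cases
    case 1
    then show ?thesis
      by (smt (verit) divide_nonneg_nonneg of_nat_0_le_iff of_nat_1 of_nat_mono)
  next
    case 2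
    then have "real (card (short T k A r)) * (real y + 1) \<le> real (card (short T k A ((3 * real y + 1) * r)))"
      by (metis of_nat_Suc of_nat_le_iff of_nat_mult Suc_eq_plus1 add.commute)
    then show ?thesis by (simp add: pos_le_divide_eq add_increasing add.commute)
  qed
qed

section \<open>Averaging over subcubes\<close>

definition digits :: "nat \<Rightarrow> (int ^ 'n ^ 'm) set" where
  "digits M = {J. \<forall>i j. J $ i $ j \<in> {0..<int M}}"

definition scaled :: "real \<Rightarrow> int ^ 'n ^ 'm \<Rightarrow> real ^ 'n ^ 'm" where
  "scaled r J = (\<chi> i j. r * real_of_int (J $ i $ j))"

lemma scaled_nth [simp]: "scaled r J $ i $ j = r * real_of_int (J $ i $ j)"
  by (simp add: scaled_def)

lemma digits_eq: "digits M = {J. \<forall>i. J $ i \<in> {v. \<forall>j. v $ j \<in> {0..<int M}}}"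
  by (auto simp: digits_def)

lemma finite_digits: "finite (digits M)"
  unfolding digits_eq by (intro finite_vec_Pi) simp

lemma card_digits: "card (digits M :: (int ^ 'n ^ 'm) set) = M ^ (CARD('m) * CARD('n))"
  unfolding digits_eq card_vec_Pi by (simp add: power_mult[symmetric] mult.commute)

text \<open>The n - 1 entries other than \<open>v $ l\<close> range freely. Once they are fixed, the
  inequality confines \<open>v $ l\<close> to an interval, because its coefficient
  \<open>r * q $ l\<close> is nonzero.\<close>

lemma card_row_solutions:
  fixes q :: "int ^ 'n" and \<alpha> r \<rho> :: real
  assumes ql: "q $ l \<noteq> 0" and r: "r > 0" and \<rho>: "\<rho> \<ge> 0"
  shows "real (card {v. (\<forall>j. v $ j \<in> {0..<int M}) \<and> \<bar>\<alpha> + r * (\<Sum>j\<in>UNIV. real_of_int (v $ j * q $ j))\<bar> \<le> \<rho>})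
    \<le> real M ^ (CARD('n) - 1) * (2 * \<rho> / (r * \<bar>q $ l\<bar>) + 1)"
    (is "real (card ?S) \<le> _ * ?w")
proof -
  have fin: "finite ?S"
    by (rule finite_subset[OF _ finite_vec_Pi[of "\<lambda>j. {0..<int M}"]]) auto
  define f :: "int ^ 'n \<Rightarrow> int ^ 'n" where "f v = (\<chi> j. if j = l then 0 else v $ j)" for v
  define D where "D j = (if j = l then {0} else {0..<int M})" for j
  have w: "?w \<ge> 0" using r \<rho> by simp
  have "card ?S \<le> card (f ` ?S) * nat \<lfloor>?w\<rfloor>"
  proof (rule card_le_card_image_mult[OF fin])
    fix y assume "y \<in> f ` ?S"
    define \<beta> where "\<beta> = \<alpha> + r * (\<Sum>j\<in>UNIV - {l}. real_of_int (y $ j * q $ j))"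
    define \<gamma> where "\<gamma> = r * real_of_int (q $ l)"
    have \<gamma>: "\<gamma> \<noteq> 0" using r ql by (simp add: \<gamma>_def)
    have "card {v \<in> ?S. f v = y} \<le> card {x::int. \<bar>\<beta> + \<gamma> * x\<bar> \<le> \<rho>}"
    proof (rule card_inj_on_le)
      show "inj_on (\<lambda>v. v $ l) {v \<in> ?S. f v = y}"
      proof (rule inj_onI)
        fix u v assume uv: "u \<in> {v \<in> ?S. f v = y}" "v \<in> {v \<in> ?S. f v = y}" "u $ l = v $ l"
        then have "f u = f v" by simp
        then have "u $ j = v $ j" if "j \<noteq> l" for j
        proof -
          have "f u $ j = f v $ j" using \<open>f u = f v\<close> by simp
          then show ?thesis using that by (simp add: f_def)
        qed
        then show "u = v" using uv(3) by (metis vec_eq_iff)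
      qed
      show "finite {x::int. \<bar>\<beta> + \<gamma> * x\<bar> \<le> \<rho>}" by (rule finite_int_ball[OF \<gamma>])
      show "(\<lambda>v. v $ l) ` {v \<in> ?S. f v = y} \<subseteq> {x::int. \<bar>\<beta> + \<gamma> * x\<bar> \<le> \<rho>}"
      proof clarify
        fix v assume v: "\<bar>\<alpha> + r * (\<Sum>j\<in>UNIV. real_of_int (v $ j * q $ j))\<bar> \<le> \<rho>" and "y = f v"
        have "(\<Sum>j\<in>UNIV. real_of_int (v $ j * q $ j))
          = real_of_int (v $ l * q $ l) + (\<Sum>j\<in>UNIV - {l}. real_of_int (v $ j * q $ j))"
          by (rule sum.remove) auto
        also have "(\<Sum>j\<in>UNIV - {l}. real_of_int (v $ j * q $ j))
          = (\<Sum>j\<in>UNIV - {l}. real_of_int (y $ j * q $ j))"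
          by (rule sum.cong) (auto simp: \<open>y = f v\<close> f_def)
        finally have "\<alpha> + r * (\<Sum>j\<in>UNIV. real_of_int (v $ j * q $ j)) = \<beta> + \<gamma> * v $ l"
          by (simp add: \<beta>_def \<gamma>_def algebra_simps)
        then show "\<bar>\<beta> + \<gamma> * v $ l\<bar> \<le> \<rho>" using v by simp
      qed
    qed
    then have "real (card {v \<in> ?S. f v = y}) \<le> ?w"
      using card_int_ball[OF \<gamma> \<rho>, of \<beta>] r by (simp add: \<gamma>_def abs_mult)
    then show "card {v \<in> ?S. f v = y} \<le> nat \<lfloor>?w\<rfloor>" by linarith
  qed
  also have "card (f ` ?S) \<le> card {v. \<forall>j. v $ j \<in> D j}"
    by (intro card_mono finite_vec_Pi) (auto simp: f_def D_def)
  also have "\<dots> = (\<Prod>j\<in>UNIV - {l}. card (D j))"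
    unfolding card_vec_Pi by (subst prod.remove[of _ l]) (auto simp: D_def)
  also have "\<dots> = M ^ (CARD('n) - 1)"
    by (simp add: D_def card_Diff_singleton)
  finally have "card ?S \<le> M ^ (CARD('n) - 1) * nat \<lfloor>?w\<rfloor>" by simp
  then have "real (card ?S) \<le> real (M ^ (CARD('n) - 1) * nat \<lfloor>?w\<rfloor>)" by linarith
  also have "\<dots> = real M ^ (CARD('n) - 1) * real (nat \<lfloor>?w\<rfloor>)" by (simp only: of_nat_mult of_nat_power)
  also have "\<dots> \<le> real M ^ (CARD('n) - 1) * ?w"
    by (rule mult_left_mono) (use w in \<open>linarith, simp\<close>)
  finally show ?thesis .
qed

text \<open>The conditions on different rows of J involve disjoint sets of entries, so the counts
  multiply; this produces the exponent m.\<close>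

lemma card_matrix_solutions:
  fixes q :: "int ^ 'n" and \<alpha> :: "'m::finite \<Rightarrow> real" and r \<rho> :: real
  assumes "q $ l \<noteq> 0" "r > 0" "\<rho> \<ge> 0"
  shows "real (card {J :: int ^ 'n ^ 'm. J \<in> digits M \<and>
      (\<forall>i. \<bar>\<alpha> i + r * (\<Sum>j\<in>UNIV. real_of_int (J $ i $ j * q $ j))\<bar> \<le> \<rho>)})
    \<le> (real M ^ (CARD('n) - 1) * (2 * \<rho> / (r * \<bar>q $ l\<bar>) + 1)) ^ CARD('m)"
proof -
  let ?S = "\<lambda>i. {v. (\<forall>j. v $ j \<in> {0..<int M}) \<and> \<bar>\<alpha> i + r * (\<Sum>j\<in>UNIV. real_of_int (v $ j * q $ j))\<bar> \<le> \<rho>}"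
  have "{J :: int ^ 'n ^ 'm. J \<in> digits M \<and>
      (\<forall>i. \<bar>\<alpha> i + r * (\<Sum>j\<in>UNIV. real_of_int (J $ i $ j * q $ j))\<bar> \<le> \<rho>)} = {J. \<forall>i. J $ i \<in> ?S i}"
    by (auto simp: digits_def)
  then have "real (card {J :: int ^ 'n ^ 'm. J \<in> digits M \<and>
      (\<forall>i. \<bar>\<alpha> i + r * (\<Sum>j\<in>UNIV. real_of_int (J $ i $ j * q $ j))\<bar> \<le> \<rho>)}) = (\<Prod>i\<in>UNIV. real (card (?S i)))"
    by (simp only: card_vec_Pi of_nat_prod)
  also have "\<dots> \<le> (\<Prod>i\<in>(UNIV :: 'm set). real M ^ (CARD('n) - 1) * (2 * \<rho> / (r * \<bar>q $ l\<bar>) + 1))"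
    by (intro prod_mono conjI card_row_solutions assms) simp
  finally show ?thesis by simp
qed

text \<open>The corner of a subcube. Cubes of level k have side T^(-(m+n)k) = \<rho> / Q, the size
  of perturbation that moves A q by a multiple of \<rho> when q has size Q; each splits into T^(m+n)
  parts in every direction.\<close>

definition child_matrix :: "nat \<Rightarrow> nat \<Rightarrow> real ^ 'n ^ 'm \<Rightarrow> int ^ 'n ^ 'm \<Rightarrow> real ^ 'n ^ 'm" where
  "child_matrix T k A J = A + scaled (1 / real T ^ ((CARD('m) + CARD('n)) * (k + 1))) J"

text \<open>Passing from the subcube back to A changes each coordinate of A q by at most n s
  T^(-nk). The lower bound on s lets one further s T^(-nk) absorb the window T^(-n(k+1)) of the
  finer level, which gives the factor n + 1.\<close>

lemma short_child_imp_short: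
  fixes A :: "real ^ 'n ^ 'm"
  assumes T: "T > 0" and J: "J \<in> digits (T ^ (CARD('m) + CARD('n)))"
    and z: "z \<in> short T (k + 1) (child_matrix T k A J) 1"
    and q: "\<And>j. \<bar>real_of_int (z $ Inl j)\<bar> \<le> s * real T ^ (CARD('m) * k)"
    and s: "1 / real T ^ CARD('n) \<le> s"
  shows "z \<in> short T k A ((real CARD('n) + 1) * s)"
proof -
  let ?m = "CARD('m)" and ?n = "CARD('n)"
  let ?R = "real T ^ ((?m + ?n) * k)"
  have T0: "real T ^ e > 0" for e using T by simp
  have "s > 0" using s T0[of ?n] by (smt (verit) divide_pos_pos)
  show ?thesis unfolding short_iff[OF T]
  proof (intro conjI allI)
    fix j
    have "s * real T ^ (?m * k) \<le> (real ?n + 1) * s * real T ^ (?m * k)"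
      using \<open>s > 0\<close> T0 by (intro mult_right_mono) auto
    then show "\<bar>real_of_int (z $ Inl j)\<bar> \<le> (real ?n + 1) * s * real T ^ (?m * k)"
      using q[of j] by linarith
  next
    fix i
    let ?x = "(\<Sum>j\<in>UNIV. A $ i $ j * z $ Inl j) + z $ Inr i"
    let ?c = "\<lambda>j. J $ i $ j / real T ^ ((?m + ?n) * (k + 1))"
    have c: "\<bar>?c j\<bar> \<le> 1 / ?R" for j
    proof -
      have "0 \<le> J $ i $ j" "J $ i $ j \<le> int T ^ (?m + ?n)"
        using J by (auto simp: digits_def le_less)
      then have "\<bar>real_of_int (J $ i $ j)\<bar> \<le> real T ^ (?m + ?n)"
        by (metis abs_of_nonneg of_int_le_iff of_int_of_nat_eq of_int_power of_int_0_le_iff)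
      then have "\<bar>real_of_int (J $ i $ j)\<bar> / real T ^ ((?m + ?n) * (k + 1))
        \<le> real T ^ (?m + ?n) / real T ^ ((?m + ?n) * (k + 1))"
        by (intro divide_right_mono) auto
      also have "\<dots> = 1 / ?R" using T by (simp add: power_add field_simps)
      finally show ?thesis by (simp add: abs_divide)
    qed
    have "\<bar>(\<Sum>j\<in>UNIV. child_matrix T k A J $ i $ j * z $ Inl j) + z $ Inr i\<bar>
        \<le> 1 / real T ^ (?n * (k + 1))"
      using z[unfolded short_iff[OF T]] by auto
    also have "(\<Sum>j\<in>UNIV. child_matrix T k A J $ i $ j * z $ Inl j) + z $ Inr i
        = ?x + (\<Sum>j\<in>UNIV. ?c j * z $ Inl j)"
      by (simp add: child_matrix_def distrib_right sum.distrib)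
    finally have "\<bar>?x\<bar> \<le> 1 / real T ^ (?n * (k + 1)) + \<bar>\<Sum>j\<in>UNIV. ?c j * z $ Inl j\<bar>" by linarith
    also have "\<bar>\<Sum>j\<in>UNIV. ?c j * z $ Inl j\<bar> \<le> (\<Sum>j\<in>(UNIV :: 'n set). 1 / ?R * (s * real T ^ (?m * k)))"
      unfolding abs_mult[symmetric]
      by (rule order_trans[OF sum_abs], rule sum_mono, unfold abs_mult, intro mult_mono c q) auto
    also have "\<dots> = real ?n * s / real T ^ (?n * k)"
      using T by (simp add: add_mult_distrib power_add field_simps)
    also have "1 / real T ^ (?n * (k + 1)) \<le> s / real T ^ (?n * k)"
      using divide_right_mono[OF s, of "real T ^ (?n * k)"] by (simp add: power_add mult.commute)
    finally show "\<bar>?x\<bar> \<le> (real ?n + 1) * s / real T ^ (?n * k)"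
      by (simp add: add_divide_distrib distrib_right)
  qed
qed

text \<open>The right-hand side is the number of all subcubes times (3 / (T^n s))^m. In each of the
  m rows, the value of the linear form sweeps a range of order s T^(-nk) as the digits vary, while
  the window has size T^(-n(k+1)).\<close>

lemma card_children_short:
  fixes A :: "real ^ 'n ^ 'm"
  assumes T: "T > 0" and s: "s > 0"
    and ql: "\<bar>real_of_int (z $ Inl l)\<bar> > s * real T ^ (CARD('m) * k)"
  shows "real (card {J \<in> digits (T ^ (CARD('m) + CARD('n))). z \<in> short T (k + 1) (child_matrix T k A J) 1})
    \<le> real (T ^ (CARD('m) + CARD('n))) ^ (CARD('m) * CARD('n)) * (3 / (real T ^ CARD('n) * s)) ^ CARD('m)"
    (is "real (card ?S) \<le> ?rhs")
proof (cases "?S = {}")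
  case True
  then show ?thesis using s by (simp only: card.empty) (simp add: T)
next
  case False
  let ?m = "CARD('m)" and ?n = "CARD('n)"
  define M where "M = T ^ (?m + ?n)"
  define r where "r = 1 / real T ^ ((?m + ?n) * (k + 1))"
  define \<rho> where "\<rho> = 1 / real T ^ (?n * (k + 1))"
  define Q where "Q = real T ^ (?m * (k + 1))"
  define \<alpha> where "\<alpha> i = (\<Sum>j\<in>UNIV. A $ i $ j * z $ Inl j) + z $ Inr i" for i
  define a where "a = \<bar>real_of_int (z $ Inl l)\<bar>"
  have T0: "real T ^ e > 0" for e using T by simp
  have a0: "a > 0" using ql s T0[of "?m * k"] unfolding a_def
    by (smt (verit) mult_pos_pos)
  \<comment> \<open>Some subcube makes z short, which bounds q by Q. Hence Q / a is at least 1, and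
    the rounding term 1 in the count is absorbed by replacing the factor 2 by 3.\<close>
  have aQ: "a \<le> Q" using False T unfolding a_def Q_def by (auto simp: short_iff)
  have \<rho>r: "\<rho> / r = Q"
    using T by (simp add: \<rho>_def r_def Q_def power_add[symmetric] field_simps add_mult_distrib)
  have n1: "?n - 1 + 1 = ?n" by (simp add: Suc_leI)
  have "?S \<subseteq> {J. J \<in> digits M \<and>
      (\<forall>i. \<bar>\<alpha> i + r * (\<Sum>j\<in>UNIV. real_of_int (J $ i $ j * (\<chi> j. z $ Inl j) $ j))\<bar> \<le> \<rho>)}"
  proof clarify
    fix J :: "int ^ 'n ^ 'm"
    assume J: "J \<in> digits (T ^ (?m + ?n))" and z: "z \<in> short T (k + 1) (child_matrix T k A J) 1"
    have "\<bar>\<alpha> i + r * (\<Sum>j\<in>UNIV. real_of_int (J $ i $ j * (\<chi> j. z $ Inl j) $ j))\<bar> \<le> \<rho>" for i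
    proof -
      have "\<bar>(\<Sum>j\<in>UNIV. child_matrix T k A J $ i $ j * z $ Inl j) + z $ Inr i\<bar> \<le> \<rho>"
        using z[unfolded short_iff[OF T]] by (auto simp: \<rho>_def)
      also have "(\<Sum>j\<in>UNIV. child_matrix T k A J $ i $ j * z $ Inl j) + z $ Inr i
          = \<alpha> i + r * (\<Sum>j\<in>UNIV. real_of_int (J $ i $ j * (\<chi> j. z $ Inl j) $ j))"
        by (simp add: child_matrix_def r_def \<alpha>_def distrib_right sum.distrib sum_distrib_left mult.assoc)
      finally show ?thesis .
    qed
    then show "J \<in> digits M \<and> (\<forall>i. \<bar>\<alpha> i + r * (\<Sum>j\<in>UNIV. real_of_int (J $ i $ j * (\<chi> j. z $ Inl j) $ j))\<bar> \<le> \<rho>)"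
      using J by (simp add: M_def)
  qed
  then have "card ?S \<le> card {J. J \<in> digits M \<and>
      (\<forall>i. \<bar>\<alpha> i + r * (\<Sum>j\<in>UNIV. real_of_int (J $ i $ j * (\<chi> j. z $ Inl j) $ j))\<bar> \<le> \<rho>)}"
    using finite_digits[of M] by (intro card_mono) auto
  also have "real \<dots> \<le> (real M ^ (?n - 1) * (2 * \<rho> / (r * \<bar>(\<chi> j. z $ Inl j) $ l\<bar>) + 1)) ^ ?m"
    by (rule card_matrix_solutions) (use a0 T in \<open>auto simp: a_def r_def \<rho>_def\<close>)
  also have "2 * \<rho> / (r * real_of_int \<bar>(\<chi> j. z $ Inl j) $ l\<bar>) = 2 * (Q / a)"
    by (simp add: a_def \<rho>r[symmetric])
  also have "(real M ^ (?n - 1) * (2 * (Q / a) + 1)) ^ ?m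
      \<le> (real M ^ (?n - 1) * (3 * (Q / (s * real T ^ (?m * k))))) ^ ?m"
  proof (intro power_mono mult_left_mono)
    have "Q / a \<ge> 1" using a0 aQ by simp
    moreover have "Q / a \<le> Q / (s * real T ^ (?m * k))"
      using ql s T0[of "?m * k"] T0 a0 by (intro divide_left_mono) (auto simp: a_def Q_def)
    ultimately show "2 * (Q / a) + 1 \<le> 3 * (Q / (s * real T ^ (?m * k)))" by linarith
  qed (use a0 in \<open>auto simp: Q_def\<close>)
  also have "3 * (Q / (s * real T ^ (?m * k))) = real M * (3 / (real T ^ ?n * s))"
    using T s by (simp add: Q_def M_def power_add field_simps)
  also have "real M ^ (?n - 1) * (real M * (3 / (real T ^ ?n * s))) = real M ^ ?n * (3 / (real T ^ ?n * s))"
    using n1 by (metis mult.assoc power_Suc2 Suc_eq_plus1)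
  also have "(real M ^ ?n * (3 / (real T ^ ?n * s))) ^ ?m = real M ^ (?m * ?n) * (3 / (real T ^ ?n * s)) ^ ?m"
    by (metis power_mult_distrib power_mult mult.commute)
  finally show ?thesis by (simp add: M_def)
qed

text \<open>
  Vectors \<open>(q, p)\<close> are grouped into zones according to the size of \<open>q\<close>. For \<open>q\<close> beyond the radius of zone
  \<open>i\<close>, the weight of zone \<open>i + 1\<close> bounds the proportion of subcubes in which \<open>(q, p)\<close> is short.
\<close>

definition zone_radius :: "nat \<Rightarrow> nat \<Rightarrow> real" where
  "zone_radius t i = (case i of 0 \<Rightarrow> 1 / 2 ^ t | Suc i \<Rightarrow> 2 ^ i)"

definition zone_weight :: "nat \<Rightarrow> nat \<Rightarrow> nat \<Rightarrow> nat \<Rightarrow> real" where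
  "zone_weight t m n i = (case i of 0 \<Rightarrow> 1 | Suc i \<Rightarrow> (3 / ((4 ^ t) ^ n * zone_radius t i)) ^ m)"

lemma zone_radius_pos: "zone_radius t i > 0"
  by (simp add: zone_radius_def split: nat.split)

text \<open>Double counting of pairs of a subcube and a vector short in it. A vector in zone i is
  short for A itself up to a radius comparable to that of the zone, and the weight bounds the
  proportion of subcubes in which it is short.\<close>

lemma sum_children_le:
  fixes A :: "real ^ 'n ^ 'm" and t k :: nat
  defines "T \<equiv> 4 ^ t"
  shows "(\<Sum>J\<in>digits (T ^ (CARD('m) + CARD('n))). real (card (short T (k + 1) (child_matrix T k A J) 1)))
    \<le> real (T ^ (CARD('m) + CARD('n))) ^ (CARD('m) * CARD('n)) *
      (\<Sum>i\<le>2 * t * CARD('m) + 1. zone_weight t CARD('m) CARD('n) i *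
         card (short T k A ((real CARD('n) + 1) * zone_radius t i)))"
proof -
  let ?m = "CARD('m)" and ?n = "CARD('n)"
  let ?D = "digits (T ^ (?m + ?n)) :: (int ^ 'n ^ 'm) set"
  let ?S = "\<lambda>J. short T (k + 1) (child_matrix T k A J) 1"
  let ?I = "{..2 * t * ?m + 1}"
  have T: "T > 0" by (simp add: T_def)
  define P where "P = real (T ^ (?m + ?n)) ^ (?m * ?n)"
  define Z where "Z = (\<Union>J\<in>?D. ?S J)"
  define cnt where "cnt z = real (card {J \<in> ?D. z \<in> ?S J})" for z
  define small where "small z i \<longleftrightarrow> (\<forall>j. \<bar>real_of_int (z $ Inl j)\<bar> \<le> zone_radius t i * real T ^ (?m * k))"
    for z :: "int ^ ('n + 'm)" and i
  \<comment> \<open>By leastness, some coordinate of q exceeds the radius of the preceding zone,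
    which is what \<open>card_children_short\<close> asks for.\<close>
  define \<zeta> where "\<zeta> z = (LEAST i. small z i)" for z
  have last_small: "small z (2 * t * ?m + 1)" if "z \<in> Z" for z
  proof -
    \<comment> \<open>The bound on q grows by T^m = 2^(2tm) in one step; this fixes the number of
      dyadic zones.\<close>
    have "real T ^ (?m * (k + 1)) = zone_radius t (2 * t * ?m + 1) * real T ^ (?m * k)"
      by (simp add: T_def zone_radius_def power_add power_mult)
    then show ?thesis
      using that T unfolding small_def Z_def by (auto simp: short_iff)
  qed
  have finZ: "finite Z" unfolding Z_def by (intro finite_UN_I finite_digits finite_short T)
  have "real (card (?S J)) = (\<Sum>z\<in>Z. if z \<in> ?S J then 1 else 0)" if "J \<in> ?D" for J
  proof -
    have "?S J = Z \<inter> ?S J" using that by (auto simp: Z_def)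
    then show ?thesis using finZ by (simp add: sum.If_cases)
  qed
  then have "(\<Sum>J\<in>?D. real (card (?S J))) = (\<Sum>J\<in>?D. \<Sum>z\<in>Z. if z \<in> ?S J then 1 else 0)"
    by simp
  also have "\<dots> = (\<Sum>z\<in>Z. \<Sum>J\<in>?D. if z \<in> ?S J then 1 else 0)" by (rule sum.swap)
  also have "\<dots> = (\<Sum>z\<in>Z. cnt z)"
    unfolding cnt_def by (simp add: sum.inter_filter[OF finite_digits, symmetric])
  also have "\<dots> = (\<Sum>i\<in>?I. \<Sum>z\<in>{z \<in> Z. \<zeta> z = i}. cnt z)"
  proof (rule sum.group[symmetric, OF finZ])
    show "\<zeta> ` Z \<subseteq> ?I"
    proof
      fix i assume "i \<in> \<zeta> ` Z"
      then obtain z where z: "z \<in> Z" "i = \<zeta> z" by blast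
      from last_small[OF z(1)] show "i \<in> ?I" unfolding z(2) \<zeta>_def by (simp add: Least_le)
    qed
  qed simp
  also have "\<dots> \<le> (\<Sum>i\<in>?I. P * (zone_weight t ?m ?n i * card (short T k A ((real ?n + 1) * zone_radius t i))))"
  proof (rule sum_mono)
    fix i assume "i \<in> ?I"
    let ?Zi = "{z \<in> Z. \<zeta> z = i}"
    have small_zone: "small z (\<zeta> z)" if "z \<in> Z" for z
      unfolding \<zeta>_def using last_small[OF that] by (rule LeastI)
    have sub: "?Zi \<subseteq> short T k A ((real ?n + 1) * zone_radius t i)"
    proof clarify
      fix z assume z: "z \<in> Z" "i = \<zeta> z"
      \<comment> \<open>Even the smallest zone radius 2^(-t) is at least T^(-n), as
        \<open>short_child_imp_short\<close> demands.\<close>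
      have "(2::real) ^ t \<le> (4 ^ t) ^ ?n"
      proof -
        have "(2::real) ^ t \<le> 2 ^ (2 * t * ?n)"
          by (rule power_increasing) (auto simp: Suc_leI)
        also have "\<dots> = (4 ^ t) ^ ?n" by (simp add: power_mult)
        finally show ?thesis .
      qed
      moreover have "(1::real) \<le> 2 ^ i" for i by simp
      moreover have "(1::real) \<le> (4 ^ t) ^ ?n" by simp
      ultimately have "1 / real T ^ ?n \<le> zone_radius t i" for i
        unfolding T_def zone_radius_def
        by (auto split: nat.split intro!: divide_left_mono mult_ge1_I simp: divide_le_eq)
      then show "z \<in> short T k A ((real ?n + 1) * zone_radius t (\<zeta> z))"
        using z small_zone[OF z(1)] T unfolding Z_def small_def
        by (auto intro!: short_child_imp_short)
    qed
    have cnt: "cnt z \<le> P * zone_weight t ?m ?n i" if "z \<in> ?Zi" for z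
    proof (cases i)
      case 0
      have "card {J \<in> ?D. z \<in> ?S J} \<le> card ?D" by (intro card_mono finite_digits) auto
      then have "cnt z \<le> real (card ?D)" by (simp add: cnt_def)
      then show ?thesis using 0 by (simp add: zone_weight_def P_def card_digits)
    next
      case (Suc i')
      then have "\<not> small z i'" using that not_less_Least[of i' "small z"] by (auto simp: \<zeta>_def)
      then obtain l where "\<bar>real_of_int (z $ Inl l)\<bar> > zone_radius t i' * real T ^ (?m * k)"
        by (auto simp: small_def not_le)
      from card_children_short[OF T zone_radius_pos this, of A] show ?thesis
        unfolding cnt_def P_def Suc zone_weight_def T_def by simp
    qed
    have w0: "P * zone_weight t ?m ?n i \<ge> 0"
      using zone_radius_pos less_imp_le[OF zone_radius_pos]
      by (auto simp: P_def zone_weight_def split: nat.split)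
    have "(\<Sum>z\<in>?Zi. cnt z) \<le> real (card ?Zi) * (P * zone_weight t ?m ?n i)"
      using sum_bounded_above[of ?Zi cnt] cnt by simp
    also have "\<dots> \<le> real (card (short T k A ((real ?n + 1) * zone_radius t i))) * (P * zone_weight t ?m ?n i)"
      by (intro mult_right_mono w0 of_nat_mono card_mono finite_short T sub)
    finally show "(\<Sum>z\<in>?Zi. cnt z) \<le> P * (zone_weight t ?m ?n i * card (short T k A ((real ?n + 1) * zone_radius t i)))"
      by (simp add: mult_ac)
  qed
  also have "\<dots> = P * (\<Sum>i\<in>?I. zone_weight t ?m ?n i * card (short T k A ((real ?n + 1) * zone_radius t i)))"
    by (rule sum_distrib_left[symmetric])
  finally show ?thesis by (simp only: P_def)
qed

lemma drift:
  "\<exists>T\<ge>2. \<exists>C>0. \<forall>k. \<forall>A :: real ^ 'n ^ 'm.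
     (\<Sum>J\<in>digits (T ^ (CARD('m) + CARD('n))). real (card (short T (k + 1) (child_matrix T k A J) 1)))
     \<le> real (T ^ (CARD('m) + CARD('n))) ^ (CARD('m) * CARD('n)) * (card (short T k A 1) / 2 + C)"
proof -
  let ?m = "CARD('m)" and ?n = "CARD('n)" and ?d = "CARD('n + 'm)"
  have m1: "?m \<ge> 1" and n1: "?n \<ge> 1" by (simp_all add: Suc_leI)
  define K0 where "K0 = (4 * real ?d * (real ?n + 1)) ^ (?d - 1)"
  have d1: "real ?d \<ge> 1" by (simp add: Suc_leI del: card_sum)
  have K0: "K0 \<ge> 1" unfolding K0_def
    by (intro one_le_power mult_ge1_I) (use d1 in linarith)+
  define K2 where "K2 = 3 ^ ?m * 2 ^ (?d - 1) * K0"
  \<comment> \<open>Zones 0 and 1 contribute 3 \<open>K0\<close> / 2^t each, the 2 t m zones beyond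
    them at most 2 m \<open>K2\<close> / 2^t together. None of these constants involves t, so t can
    be chosen after \<open>K1\<close>.\<close>
  define K1 where "K1 = 6 * K0 + 2 * real ?m * K2"
  obtain t0 where t0: "2 * K1 < 2 ^ t0" using real_arch_pow[of 2 "2 * K1"] by auto
  \<comment> \<open>The summand 2 makes 2^t at least 4, so that 3 / 2^t is below 1 and its m-th
    power is at most itself.\<close>
  define t where "t = t0 + 2"
  define T :: nat where "T = 4 ^ t"
  have "(2::real) ^ t0 \<le> 2 ^ t" unfolding t_def by (intro power_increasing) auto
  then have t: "2 * K1 < 2 ^ t" using t0 by linarith
  have t4: "(4::real) \<le> 2 ^ t" unfolding t_def by (simp add: power_add)
  have T2: "T \<ge> 2" unfolding T_def t_def by (simp add: power_add)
  then have T: "T > 0" by simp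
  have T4: "real T = 2 ^ t * 2 ^ t" by (simp add: T_def power_mult_distrib[symmetric])
  have T1: "real T \<ge> 1" using T2 by simp
  define I where "I = 2 * t * ?m + 1"
  define W where "W = (\<Sum>i\<le>I. zone_weight t ?m ?n i)"
  \<comment> \<open>The largest radius that occurs: the last zone, enlarged by the factor n + 1 from
    \<open>short_child_imp_short\<close>.\<close>
  define S where "S = (real ?n + 1) * 2 ^ (2 * t * ?m)"
  define C1 where "C1 = (2 * (fact ?d * S ^ ?d) + 1) ^ ?d"
  define C where "C = 1 + C1 * W"
  have S0: "S \<ge> 0" by (simp add: S_def)
  have w0: "zone_weight t ?m ?n i \<ge> 0" for i
    using less_imp_le[OF zone_radius_pos] by (auto simp: zone_weight_def split: nat.split)
  have W0: "W \<ge> 0" unfolding W_def by (intro sum_nonneg w0)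
  have C10: "C1 \<ge> 0" unfolding C1_def using S0 by simp
  have C0: "C > 0" unfolding C_def using W0 C10 by (simp add: add_pos_nonneg)
  have rad: "(real ?n + 1) * zone_radius t i \<le> S" if "i \<le> I" for i
    unfolding S_def
  proof (rule mult_left_mono)
    show "zone_radius t i \<le> 2 ^ (2 * t * ?m)"
    proof (cases i)
      case 0
      have "1 / 2 ^ t \<le> (1::real)" by simp
      also have "1 \<le> (2::real) ^ (2 * t * ?m)" by simp
      finally show ?thesis using 0 by (simp add: zone_radius_def)
    next
      case (Suc i')
      then show ?thesis using that by (simp add: zone_radius_def I_def)
    qed
  qed simp
  have key: "(\<Sum>i\<le>I. zone_weight t ?m ?n i * card (short T k A ((real ?n + 1) * zone_radius t i)))
      \<le> card (short T k A 1) / 2 + C" (is "?lhs \<le> ?V / 2 + C") for k and A :: "real ^ 'n ^ 'm"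
  proof (cases "span (embed T k A ` short T k A S) = UNIV")
    case True
    have "?lhs \<le> (\<Sum>i\<le>I. zone_weight t ?m ?n i * C1)"
    proof (rule sum_mono, rule mult_left_mono[OF _ w0])
      fix i assume "i \<in> {..I}"
      then have "card (short T k A ((real ?n + 1) * zone_radius t i)) \<le> card (short T k A S)"
        by (intro card_mono finite_short T short_mono rad) simp
      also have "real \<dots> \<le> C1" unfolding C1_def by (rule card_short_spanning[OF T True])
      finally show "real (card (short T k A ((real ?n + 1) * zone_radius t i))) \<le> C1" by simp
    qed
    also have "\<dots> \<le> C" by (simp add: C_def W_def sum_distrib_left mult.commute)
    finally show ?thesis by (simp add: add_increasing)
  next
    case False
    let ?V = "real (card (short T k A 1))"
    have zone: "real (card (short T k A ((real ?n + 1) * zone_radius t (Suc i)))) \<le> K0 * 2 ^ (i * (?d - 1)) * ?V"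
      if "i < I" for i
    proof -
      have "real (card (short T k A ((real ?n + 1) * zone_radius t (Suc i))))
        \<le> (4 * real ?d * ((real ?n + 1) * zone_radius t (Suc i))) ^ (?d - 1) * ?V"
      proof (rule card_short_not_spanning[OF T False])
        show "1 \<le> (real ?n + 1) * zone_radius t (Suc i)"
          by (simp add: zone_radius_def mult_ge1_I)
        show "(real ?n + 1) * zone_radius t (Suc i) \<le> S" using that by (intro rad) simp
      qed
      also have "(4 * real ?d * ((real ?n + 1) * zone_radius t (Suc i))) ^ (?d - 1) = K0 * 2 ^ (i * (?d - 1))"
        by (simp add: K0_def zone_radius_def power_mult_distrib power_mult mult.assoc)
      finally show ?thesis .
    qed
    have split: "(\<Sum>i\<le>N + 1. h i) = h 0 + (h 1 + (\<Sum>i<N. h (Suc (Suc i))))" for h :: "nat \<Rightarrow> real" and N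
      by (simp only: Suc_eq_plus1[symmetric] lessThan_Suc_atMost[symmetric] sum.lessThan_Suc_shift)
        (simp only: One_nat_def)
    have z0: "zone_weight t ?m ?n 0 * card (short T k A ((real ?n + 1) * zone_radius t 0)) \<le> 1 + 3 * K0 * ?V / 2 ^ t"
    proof -
      \<comment> \<open>The largest y with 3 y + 1 \<le> 2^t: the enlarged ball of
        \<open>card_short_small\<close> then stays within radius n + 1, where the hyperplane bound
        applies, and 1 / (y + 1) is at most 3 / 2^t.\<close>
      define y where "y = (2 ^ t - 1) div (3::nat)"
      have "(1::nat) \<le> 2 ^ t" by simp
      then have y: "3 * (y + 1) \<ge> 2 ^ t" "3 * y + 1 \<le> 2 ^ t" unfolding y_def by presburger+
      have "real (2 ^ t) \<le> real (3 * (y + 1))" "real (3 * y + 1) \<le> real (2 ^ t)"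
        using y by (simp_all only: of_nat_le_iff)
      then have y': "(2::real) ^ t \<le> 3 * (real y + 1)" "3 * real y + 1 \<le> 2 ^ t" by simp_all
      define r where "r = (real ?n + 1) / 2 ^ t"
      let ?c = "real (card (short T k A ((3 * real y + 1) * r)))"
      have "card (short T k A ((3 * real y + 1) * r)) \<le> card (short T k A ((real ?n + 1) * zone_radius t (Suc 0)))"
      proof (intro card_mono finite_short T short_mono)
        have "(3 * real y + 1) * r \<le> 2 ^ t * r" using y' by (intro mult_right_mono) (auto simp: r_def)
        then show "(3 * real y + 1) * r \<le> (real ?n + 1) * zone_radius t (Suc 0)"
          by (simp add: r_def zone_radius_def)
      qed
      also have "real \<dots> \<le> K0 * ?V" using zone[of 0] by (simp add: I_def)
      finally have c: "?c \<le> K0 * ?V" by simp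
      have "1 / (real y + 1) \<le> 3 / 2 ^ t" using y'(1) by (simp add: field_simps)
      then have "?c * (1 / (real y + 1)) \<le> K0 * ?V * (3 / 2 ^ t)"
        using K0 by (intro mult_mono c) auto
      moreover have "real (card (short T k A r)) \<le> 1 + ?c / (real y + 1)"
        using card_short_small[OF T, of r k A y] by (simp add: r_def add.commute)
      ultimately have "real (card (short T k A r)) \<le> 1 + K0 * ?V * (3 / 2 ^ t)" by simp
      moreover have "(real ?n + 1) * zone_radius t 0 = r" by (simp add: zone_radius_def r_def)
      ultimately show ?thesis
        by (simp add: zone_weight_def mult_ac)
    qed
    have z1: "zone_weight t ?m ?n 1 * card (short T k A ((real ?n + 1) * zone_radius t 1)) \<le> 3 * K0 * ?V / 2 ^ t"
    proof -
      \<comment> \<open>Of T = 2^t 2^t one factor is spent on the small radius 2^(-t); the other is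
        the gain.\<close>
      have "3 / ((4 ^ t) ^ ?n * zone_radius t 0) \<le> 3 / 2 ^ t"
      proof -
        have "real T * 1 \<le> real T ^ ?n" using T1 n1 by (simp add: self_le_power)
        then have "2 ^ t * 2 ^ t \<le> (4 ^ t :: real) ^ ?n" using T4 by (simp add: T_def)
        then show ?thesis by (simp add: zone_radius_def field_simps)
      qed
      then have "zone_weight t ?m ?n 1 \<le> (3 / 2 ^ t) ^ ?m"
        unfolding zone_weight_def by (auto intro!: power_mono simp: zone_radius_def)
      also have "\<dots> \<le> (3 / 2 ^ t) ^ 1"
        using t4 m1 by (intro power_decreasing) auto
      finally have "zone_weight t ?m ?n 1 \<le> 3 / 2 ^ t" by simp
      then have "zone_weight t ?m ?n 1 * card (short T k A ((real ?n + 1) * zone_radius t 1)) \<le> 3 / 2 ^ t * (K0 * ?V)"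
        using zone[of 0] by (intro mult_mono) (auto simp: I_def)
      then show ?thesis by (simp add: mult_ac)
    qed
    have z2: "zone_weight t ?m ?n (Suc (Suc i)) * card (short T k A ((real ?n + 1) * zone_radius t (Suc (Suc i))))
        \<le> K2 * ?V / real T" if "i < 2 * t * ?m" for i
    proof -
      \<comment> \<open>The part 2^(i m) cancels against the zone weight. What remains, 2^(i (n-1)),
        is at most T^(m (n-1)) on the last zone, so the denominator T^(n m) wins by T^m.\<close>
      have ex: "(i + 1) * (?d - 1) = i * ?m + i * (?n - 1) + (?d - 1)"
      proof -
        have "?d - 1 = ?m + (?n - 1)" using n1 by simp
        then show ?thesis by (simp only: distrib_left distrib_right mult_1 add.assoc)
      qed
      have "zone_weight t ?m ?n (Suc (Suc i)) = 3 ^ ?m / (real T ^ (?n * ?m) * 2 ^ (i * ?m))"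
        by (simp add: zone_weight_def zone_radius_def T_def power_divide power_mult_distrib power_mult)
      moreover have "real (card (short T k A ((real ?n + 1) * zone_radius t (Suc (Suc i))))) \<le> K0 * 2 ^ ((i + 1) * (?d - 1)) * ?V"
        using zone[of "Suc i"] that by (simp add: I_def)
      ultimately have "zone_weight t ?m ?n (Suc (Suc i)) * card (short T k A ((real ?n + 1) * zone_radius t (Suc (Suc i))))
        \<le> 3 ^ ?m / (real T ^ (?n * ?m) * 2 ^ (i * ?m)) * (K0 * 2 ^ ((i + 1) * (?d - 1)) * ?V)"
        by (simp only:) (rule mult_left_mono, assumption, simp)
      also have "\<dots> = K2 * ?V * 2 ^ (i * (?n - 1)) / real T ^ (?n * ?m)"
        unfolding ex power_add by (simp add: K2_def)
      also have "\<dots> \<le> K2 * ?V * real T ^ ((?n - 1) * ?m) / real T ^ (?n * ?m)"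
      proof (intro divide_right_mono mult_left_mono)
        have "(2::real) ^ (i * (?n - 1)) \<le> 2 ^ (2 * t * ?m * (?n - 1))"
          using that by (intro power_increasing mult_right_mono) auto
        also have "\<dots> = real T ^ ((?n - 1) * ?m)"
        proof -
          have "2 * t * ?m * (?n - 1) = 2 * (t * ((?n - 1) * ?m))" by (simp only: mult_ac)
          moreover have "real T = (2 ^ 2) ^ t" by (simp add: T_def)
          ultimately show ?thesis by (simp only: power_mult)
        qed
        finally show "(2::real) ^ (i * (?n - 1)) \<le> real T ^ ((?n - 1) * ?m)" .
      qed (use K0 in \<open>auto simp: K2_def\<close>)
      also have "\<dots> = K2 * ?V / real T ^ ?m"
      proof -
        have "?n * ?m = (?n - 1) * ?m + ?m" using n1 by (simp add: diff_mult_distrib)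
        then have "real T ^ (?n * ?m) = real T ^ ((?n - 1) * ?m) * real T ^ ?m"
          by (simp only: power_add)
        then show ?thesis using T by simp
      qed
      also have "\<dots> \<le> K2 * ?V / real T ^ 1"
        using T1 m1 K0 by (intro divide_left_mono power_increasing) (auto simp: K2_def)
      finally show ?thesis by simp
    qed
    have "?lhs = zone_weight t ?m ?n 0 * card (short T k A ((real ?n + 1) * zone_radius t 0))
      + (zone_weight t ?m ?n 1 * card (short T k A ((real ?n + 1) * zone_radius t 1))
      + (\<Sum>i<2 * t * ?m. zone_weight t ?m ?n (Suc (Suc i)) * card (short T k A ((real ?n + 1) * zone_radius t (Suc (Suc i))))))"
      unfolding I_def by (rule split)
    also have "\<dots> \<le> (1 + 3 * K0 * ?V / 2 ^ t) + (3 * K0 * ?V / 2 ^ t + (\<Sum>i<2 * t * ?m. K2 * ?V / real T))"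
      by (intro add_mono z0 z1 sum_mono z2) simp
    \<comment> \<open>The number of zones is linear in t, so one of the two factors 2^t of T
      outweighs it.\<close>
    also have "(\<Sum>i<2 * t * ?m. K2 * ?V / real T) = 2 * real ?m * K2 * ?V / 2 ^ t * (t / 2 ^ t)"
      by (simp add: T4)
    also have "\<dots> \<le> 2 * real ?m * K2 * ?V / 2 ^ t * 1"
    proof (rule mult_left_mono)
      show "t / 2 ^ t \<le> (1::real)" by (simp add: less_imp_le)
    qed (use K0 in \<open>simp add: K2_def\<close>)
    finally have "?lhs \<le> 1 + K1 / 2 ^ t * ?V"
      by (simp add: K1_def add_divide_distrib distrib_right)
    moreover have "K1 / 2 ^ t * ?V \<le> 1 / 2 * ?V"
      using t by (intro mult_right_mono) (auto simp: field_simps)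
    moreover have "1 \<le> C" using W0 C10 by (simp add: C_def)
    ultimately show ?thesis by linarith
  qed
  have "(\<Sum>J\<in>digits (T ^ (?m + ?n)). real (card (short T (k + 1) (child_matrix T k A J) 1)))
     \<le> real (T ^ (?m + ?n)) ^ (?m * ?n) * (card (short T k A 1) / 2 + C)" for k and A :: "real ^ 'n ^ 'm"
    using sum_children_le[of t k A, folded T_def]
    by (rule order_trans) (intro mult_left_mono key[unfolded I_def], simp)
  then show ?thesis using T2 C0 by blast
qed

section \<open>Cubes with few good levels\<close>

definition cube_matrix :: "nat \<Rightarrow> nat \<Rightarrow> int ^ 'n ^ 'm \<Rightarrow> real ^ 'n ^ 'm" where
  "cube_matrix T k I = scaled (1 / real T ^ ((CARD('m) + CARD('n)) * k)) I"

text \<open>Evaluated at the corner, so that it depends on the index alone. Within the cube A q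
  moves by at most n T^(-nk) when q is bounded by T^(mk), so the corner may stand for all matrices
  of the cube.\<close>

definition height :: "nat \<Rightarrow> nat \<Rightarrow> int ^ 'n ^ 'm \<Rightarrow> real" where
  "height T k I = real (card (short T k (cube_matrix T k I) 1))"

definition refine :: "nat \<Rightarrow> int ^ 'n ^ 'm \<Rightarrow> int ^ 'n ^ 'm \<Rightarrow> int ^ 'n ^ 'm" where
  "refine T I J = (\<chi> i j. int (T ^ (CARD('m) + CARD('n))) * I $ i $ j + J $ i $ j)"

definition coarsen :: "nat \<Rightarrow> int ^ 'n ^ 'm \<Rightarrow> int ^ 'n ^ 'm" where
  "coarsen T I = (\<chi> i j. I $ i $ j div int (T ^ (CARD('m) + CARD('n))))"

definition cube_index :: "nat \<Rightarrow> nat \<Rightarrow> real ^ 'n ^ 'm \<Rightarrow> int ^ 'n ^ 'm" where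
  "cube_index T k A = (\<chi> i j. \<lfloor>real T ^ ((CARD('m) + CARD('n)) * k) * A $ i $ j\<rfloor>)"

text \<open>I is read as a cube of level N. The recursion passes to the parent before testing, so
  the levels counted are 0 to N - 1.\<close>

primrec goods :: "nat \<Rightarrow> real \<Rightarrow> nat \<Rightarrow> int ^ 'n ^ 'm \<Rightarrow> nat" where
  "goods T H 0 I = 0"
| "goods T H (Suc N) I = goods T H N (coarsen T I) + (if height T N (coarsen T I) \<le> H then 1 else 0)"

primrec grid :: "nat \<Rightarrow> int ^ 'n ^ 'm \<Rightarrow> nat \<Rightarrow> (int ^ 'n ^ 'm) set" where
  "grid T I0 0 = {I0}"
| "grid T I0 (Suc N) = (\<lambda>(I, J). refine T I J) ` (grid T I0 N \<times> digits (T ^ (CARD('m) + CARD('n))))"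

lemma child_matrix_cube_matrix:
  assumes "T > 0"
  shows "child_matrix T k (cube_matrix T k I) J = cube_matrix T (Suc k) (refine T I (J :: int ^ 'n ^ 'm))"
  using assms
  by (simp add: child_matrix_def cube_matrix_def refine_def vec_eq_iff power_add field_simps)

lemma coarsen_refine:
  assumes "T > 0" "J \<in> digits (T ^ (CARD('m) + CARD('n)))"
  shows "coarsen T (refine T I (J :: int ^ 'n ^ 'm)) = I"
proof -
  have "(int (T ^ (CARD('m) + CARD('n))) * I $ i $ j + J $ i $ j) div int (T ^ (CARD('m) + CARD('n))) = I $ i $ j"
    for i j
  proof -
    have "0 \<le> J $ i $ j" "J $ i $ j < int (T ^ (CARD('m) + CARD('n)))"
      using assms(2) by (auto simp: digits_def)
    then show ?thesis using assms(1) by (simp add: div_pos_pos_trivial del: of_nat_power)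
  qed
  then show ?thesis by (simp add: coarsen_def refine_def vec_eq_iff)
qed

lemma finite_grid: "finite (grid T I0 N)"
  by (induction N) (auto intro: finite_digits)

lemma floor_mult_div:
  fixes x :: real and M :: nat
  assumes "M > 0"
  shows "\<lfloor>real M * x\<rfloor> div int M = \<lfloor>x\<rfloor>"
proof -
  have "\<lfloor>real M * x / real_of_int (int M)\<rfloor> = \<lfloor>real M * x\<rfloor> div int M"
    by (rule floor_divide_real_eq_div) simp
  then show ?thesis using assms by simp
qed

lemma coarsen_cube_index:
  assumes "T > 0"
  shows "coarsen T (cube_index T (Suc N) A) = cube_index T N A"
proof -
  have "\<lfloor>real T ^ ((CARD('b) + CARD('a)) * Suc N) * A $ i $ j\<rfloor> div int (T ^ (CARD('b) + CARD('a)))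
      = \<lfloor>real T ^ ((CARD('b) + CARD('a)) * N) * A $ i $ j\<rfloor>" for i j
    using floor_mult_div[of "T ^ (CARD('b) + CARD('a))" "real T ^ ((CARD('b) + CARD('a)) * N) * A $ i $ j"] assms
    by (simp add: power_add mult_ac)
  then show ?thesis by (simp only: coarsen_def cube_index_def vec_eq_iff vec_lambda_beta) simp
qed

lemma refine_digit:
  assumes "T > 0"
  obtains J where "J \<in> digits (T ^ (CARD('m) + CARD('n)))" "I = refine T (coarsen T I) (J :: int ^ 'n ^ 'm)"
proof
  let ?J = "(\<chi> i j. I $ i $ j mod int (T ^ (CARD('m) + CARD('n)))) :: int ^ 'n ^ 'm"
  show "?J \<in> digits (T ^ (CARD('m) + CARD('n)))"
    using assms by (simp add: digits_def del: of_nat_power)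
  show "I = refine T (coarsen T I) ?J"
    by (simp add: refine_def coarsen_def vec_eq_iff del: of_nat_power)
qed

lemma cube_index_in_grid:
  assumes "T > 0"
  shows "cube_index T N A \<in> grid T (cube_index T 0 A) N"
proof (induction N)
  case (Suc N)
  obtain J where "J \<in> digits (T ^ (CARD('b) + CARD('a)))"
    "cube_index T (Suc N) A = refine T (coarsen T (cube_index T (Suc N) A)) J"
    using refine_digit[OF assms] .
  then show ?case using Suc by (auto simp: coarsen_cube_index[OF assms] intro: rev_image_eqI)
qed simp

lemma goods_cube_index:
  assumes "T > 0"
  shows "goods T H N (cube_index T N A) = card {k. k < N \<and> height T k (cube_index T k A) \<le> H}"
proof (induction N)
  case (Suc N)
  have "{k. k < Suc N \<and> height T k (cube_index T k A) \<le> H} =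
    (if height T N (cube_index T N A) \<le> H then insert N {k. k < N \<and> height T k (cube_index T k A) \<le> H}
     else {k. k < N \<and> height T k (cube_index T k A) \<le> H})"
    by (auto simp: less_Suc_eq)
  then show ?case using Suc by (simp add: coarsen_cube_index[OF assms])
qed simp

text \<open>\<open>dims\<close> carries the two dimensions as types; T and C are the constants that
  the lemma \<open>drift\<close> supplies for these dimensions.\<close>

locale drifting =
  fixes T :: nat and C :: real and dims :: "(real ^ 'n ^ 'm) itself"
  assumes T: "T \<ge> 2" and C: "C > 0"
    and drift: "\<And>k. \<And>A :: real ^ 'n ^ 'm.
     (\<Sum>J\<in>digits (T ^ (CARD('m) + CARD('n))). real (card (short T (k + 1) (child_matrix T k A J) 1)))
     \<le> real (T ^ (CARD('m) + CARD('n))) ^ (CARD('m) * CARD('n)) * (card (short T k A 1) / 2 + C)"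
begin

text \<open>
  The height is halved on average up to an additive constant. While it exceeds \<open>8 C\<close> this gains
  a factor \<open>3/4\<close>; at the other levels the weight \<open>1/2\<close> does.
\<close>

lemma weighted_sum_le:
  "(\<Sum>I\<in>grid T I0 N. (1 / 2) ^ goods T (8 * C) N I * (height T N I + 4 * C))
    \<le> (3 / 4 * real (T ^ (CARD('m) + CARD('n))) ^ (CARD('m) * CARD('n))) ^ N
      * (height T 0 (I0 :: int ^ 'n ^ 'm) + 4 * C)"
proof (induction N)
  case 0
  then show ?case by simp
next
  case (Suc N)
  let ?M = "T ^ (CARD('m) + CARD('n))" and ?G = "goods T (8 * C)"
  let ?D = "digits ?M :: (int ^ 'n ^ 'm) set"
  let ?P = "real ?M ^ (CARD('m) * CARD('n))"
  have T0: "T > 0" using T by simp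
  have h0: "height T k I \<ge> 0" for k and I :: "int ^ 'n ^ 'm" by (simp add: height_def)
  have step: "(\<Sum>J\<in>?D. (1 / 2) ^ ?G (Suc N) (refine T I J) * (height T (Suc N) (refine T I J) + 4 * C))
      \<le> 3 / 4 * ?P * ((1 / 2) ^ ?G N I * (height T N I + 4 * C))" (is "?lhs \<le> _")
    for I :: "int ^ 'n ^ 'm"
  proof -
    define g :: real where "g = (if height T N I \<le> 8 * C then 1 / 2 else 1)"
    have "?lhs = (\<Sum>J\<in>?D. (1 / 2) ^ ?G N I * g * (height T (Suc N) (refine T I J) + 4 * C))"
      by (rule sum.cong) (auto simp: coarsen_refine[OF T0] g_def)
    also have "\<dots> = (1 / 2) ^ ?G N I * g * ((\<Sum>J\<in>?D. height T (Suc N) (refine T I J)) + ?P * (4 * C))"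
      by (simp add: sum_distrib_left[symmetric] sum.distrib card_digits power_mult)
    also have "\<dots> \<le> (1 / 2) ^ ?G N I * g * (?P * (height T N I / 2 + C) + ?P * (4 * C))"
    proof (intro mult_left_mono add_right_mono)
      show "(\<Sum>J\<in>?D. height T (Suc N) (refine T I J)) \<le> ?P * (height T N I / 2 + C)"
        using drift[of N "cube_matrix T N I"]
        by (simp add: height_def child_matrix_cube_matrix[OF T0])
    qed (simp add: g_def)
    also have "\<dots> = (1 / 2) ^ ?G N I * ?P * (g * (height T N I / 2 + 5 * C))"
      by (simp add: algebra_simps)
    \<comment> \<open>Write h for the height. At a good level g = 1/2, and h / 4 + 5 C / 2 is at
      most 3/4 (h + 4 C). Otherwise g = 1, and the inequality h / 2 + 5 C \<le> 3/4 (h + 4 C)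
      amounts to h \<ge> 8 C, which ties the shift 4 C to the threshold 8 C.\<close>
    also have "\<dots> \<le> (1 / 2) ^ ?G N I * ?P * (3 / 4 * (height T N I + 4 * C))"
      using C h0[of N I] by (intro mult_left_mono) (auto simp: g_def)
    finally show ?thesis by (simp only: mult_ac)
  qed
  have "(\<Sum>I\<in>grid T I0 (Suc N). (1 / 2) ^ ?G (Suc N) I * (height T (Suc N) I + 4 * C))
    \<le> (\<Sum>x\<in>grid T I0 N \<times> ?D. (1 / 2) ^ ?G (Suc N) ((\<lambda>(I, J). refine T I J) x)
        * (height T (Suc N) ((\<lambda>(I, J). refine T I J) x) + 4 * C))"
    unfolding grid.simps
    by (rule sum_image_le[of _ "\<lambda>I. (1 / 2) ^ ?G (Suc N) I * (height T (Suc N) I + 4 * C)", unfolded o_def])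
      (use C h0 in \<open>auto intro!: finite_cartesian_product finite_grid finite_digits mult_nonneg_nonneg add_nonneg_nonneg\<close>)
  also have "\<dots> = (\<Sum>I\<in>grid T I0 N. \<Sum>J\<in>?D. (1 / 2) ^ ?G (Suc N) (refine T I J)
        * (height T (Suc N) (refine T I J) + 4 * C))"
    by (subst sum.cartesian_product) (simp add: case_prod_unfold)
  also have "\<dots> \<le> (\<Sum>I\<in>grid T I0 N. 3 / 4 * ?P * ((1 / 2) ^ ?G N I * (height T N I + 4 * C)))"
    by (rule sum_mono) (rule step)
  also have "\<dots> \<le> 3 / 4 * ?P * ((3 / 4 * ?P) ^ N * (height T 0 I0 + 4 * C))"
    unfolding sum_distrib_left[symmetric] by (rule mult_left_mono[OF Suc]) simp
  finally show ?case by (simp add: mult_ac)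
qed

text \<open>Markov's inequality for the weighted sum. Since (5/6)^5 < 1/2, each counted cube has
  weight at least (5/6)^N, and h + 4 C is at least 4 C. As 3/4 = 9/10 times 5/6, a decay rate of
  9/10 is left over.\<close>

lemma card_few_goods:
  "real (card {I \<in> grid T I0 N. 5 * goods T (8 * C) N I \<le> N})
    \<le> ((height T 0 (I0 :: int ^ 'n ^ 'm) + 4 * C) / (4 * C))
      * (9 / 10 * real (T ^ (CARD('m) + CARD('n))) ^ (CARD('m) * CARD('n))) ^ N"
proof -
  let ?F = "{I \<in> grid T I0 N. 5 * goods T (8 * C) N I \<le> N}"
  let ?P = "real (T ^ (CARD('m) + CARD('n))) ^ (CARD('m) * CARD('n))"
  let ?h = "height T 0 I0 + 4 * C"
  have h0: "height T k I \<ge> 0" for k and I :: "int ^ 'n ^ 'm" by (simp add: height_def)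
  have "real (card ?F) * ((5 / 6) ^ N * (4 * C)) = (\<Sum>I\<in>?F. (5 / 6) ^ N * (4 * C))" by simp
  also have "\<dots> \<le> (\<Sum>I\<in>?F. (1 / 2) ^ goods T (8 * C) N I * (height T N I + 4 * C))"
  proof (rule sum_mono, rule mult_mono)
    fix I assume I: "I \<in> ?F"
    have "(5 / 6 :: real) ^ N \<le> (5 / 6) ^ (5 * goods T (8 * C) N I)"
      using I by (intro power_decreasing) auto
    also have "\<dots> = ((5 / 6) ^ 5) ^ goods T (8 * C) N I" by (rule power_mult)
    also have "\<dots> \<le> (1 / 2) ^ goods T (8 * C) N I"
      by (intro power_mono) (auto simp: power_divide)
    finally show "(5 / 6 :: real) ^ N \<le> (1 / 2) ^ goods T (8 * C) N I" .
  qed (use C h0 in auto)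
  also have "\<dots> \<le> (\<Sum>I\<in>grid T I0 N. (1 / 2) ^ goods T (8 * C) N I * (height T N I + 4 * C))"
    using C h0 by (intro sum_mono2 finite_grid) (auto intro!: mult_nonneg_nonneg add_nonneg_nonneg)
  also have "\<dots> \<le> (3 / 4 * ?P) ^ N * ?h" by (rule weighted_sum_le)
  also have "\<dots> = (9 / 10 * ?P) ^ N * ?h * (5 / 6) ^ N"
  proof -
    have "3 / 4 * ?P = 9 / 10 * ?P * (5 / 6)" by simp
    then show ?thesis by (simp only: power_mult_distrib mult_ac)
  qed
  finally have "real (card ?F) * (4 * C) * (5 / 6) ^ N \<le> (9 / 10 * ?P) ^ N * ?h * (5 / 6) ^ N"
    by (simp only: mult_ac)
  then have "real (card ?F) * (4 * C) \<le> (9 / 10 * ?P) ^ N * ?h" by simp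
  then show ?thesis using C by (simp add: field_simps)
qed

end

section \<open>Covering radius at good levels\<close>

text \<open>Dirichlet's pigeonhole argument: T^((mk+s)n) vectors q are sorted into T^((nk-s)m) boxes
  according to the fractional parts of A q. Some box receives at least T^(sd) of them, and their
  differences are short. The hypothesis on s makes nk - s a true difference of natural
  numbers.\<close>

lemma card_short_ge:
  fixes A :: "real ^ 'n ^ 'm"
  assumes T: "T > 0" and s: "s \<le> CARD('n) * k"
  shows "T ^ (s * CARD('n + 'm)) \<le> card (short T k A (real T ^ s))"
proof (rule ccontr)
  let ?m = "CARD('m)" and ?n = "CARD('n)" and ?d = "CARD('n + 'm)"
  assume "\<not> ?thesis"
  then have less: "card (short T k A (real T ^ s)) \<le> T ^ (s * ?d) - 1" by simp
  define X where "X = {q :: int ^ 'n. \<forall>j. q $ j \<in> {0..<int (T ^ (?m * k + s))}}"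
  define Aq where "Aq q i = (\<Sum>j\<in>UNIV. A $ i $ j * real_of_int (q $ j))" for q :: "int ^ 'n" and i
  define \<phi> :: "int ^ 'n \<Rightarrow> int ^ 'm" where "\<phi> q = (\<chi> i. \<lfloor>real (T ^ (?n * k - s)) * frac (Aq q i)\<rfloor>)" for q
  have finX: "finite X" unfolding X_def by (rule finite_vec_Pi) simp
  have cardX: "card X = T ^ ((?m * k + s) * ?n)"
    unfolding X_def card_vec_Pi by (simp add: power_mult del: of_nat_power)
  have img: "\<phi> ` X \<subseteq> {v. \<forall>i. v $ i \<in> {0..<int (T ^ (?n * k - s))}}"
  proof clarsimp
    fix q i
    have "real T ^ (?n * k - s) * frac (Aq q i) < real T ^ (?n * k - s)"
      using T frac_lt_1[of "Aq q i"] by simp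
    then show "0 \<le> \<phi> q $ i \<and> \<phi> q $ i < int T ^ (?n * k - s)"
      by (simp add: \<phi>_def floor_less_iff)
  qed
  then have "card (\<phi> ` X) \<le> card {v :: int ^ 'm. \<forall>i. v $ i \<in> {0..<int (T ^ (?n * k - s))}}"
    by (intro card_mono finite_vec_Pi) auto
  also have "\<dots> = T ^ ((?n * k - s) * ?m)"
    unfolding card_vec_Pi by (simp add: power_mult del: of_nat_power)
  finally have card_img: "card (\<phi> ` X) \<le> T ^ ((?n * k - s) * ?m)" .
  have "card X \<le> card (\<phi> ` X) * (T ^ (s * ?d) - 1)"
  proof (rule card_le_card_image_mult[OF finX])
    fix y assume "y \<in> \<phi> ` X"
    then obtain q0 where q0: "q0 \<in> X" "y = \<phi> q0" by blast
    \<comment> \<open>Pairing q - q0 with the difference of integer parts turns A q + p into a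
      difference of fractional parts, which is small within a box.\<close>
    define g :: "int ^ 'n \<Rightarrow> int ^ ('n + 'm)" where
      "g q = (\<chi> u. case u of Inl j \<Rightarrow> q $ j - q0 $ j | Inr i \<Rightarrow> \<lfloor>Aq q0 i\<rfloor> - \<lfloor>Aq q i\<rfloor>)" for q
    have "card {q \<in> X. \<phi> q = y} \<le> card (short T k A (real T ^ s))"
    proof (rule card_inj_on_le[of g])
      show "inj_on g {q \<in> X. \<phi> q = y}"
      proof (rule inj_onI)
        fix q q' assume "g q = g q'"
        then have "g q $ Inl j = g q' $ Inl j" for j by simp
        then show "q = q'" by (simp add: g_def vec_eq_iff)
      qed
      show "g ` {q \<in> X. \<phi> q = y} \<subseteq> short T k A (real T ^ s)"
      proof clarify
        fix q assume q: "q \<in> X" and "y = \<phi> q"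
        then have same: "\<phi> q = \<phi> q0" using q0 by simp
        show "g q \<in> short T k A (real T ^ s)" unfolding short_iff[OF T]
        proof (intro conjI allI)
          fix j
          have "\<bar>q $ j - q0 $ j\<bar> \<le> int (T ^ (?m * k + s))"
            using q q0(1) by (auto simp: X_def abs_le_iff dest!: spec[of _ j])
          then have "real_of_int \<bar>q $ j - q0 $ j\<bar> \<le> real_of_int (int (T ^ (?m * k + s)))"
            by (simp only: of_int_le_iff)
          then show "\<bar>real_of_int (g q $ Inl j)\<bar> \<le> real T ^ s * real T ^ (?m * k)"
            by (simp add: g_def power_add mult.commute)
        next
          fix i
          have "(\<Sum>j\<in>UNIV. A $ i $ j * real_of_int (g q $ Inl j)) = Aq q i - Aq q0 i"
            by (simp add: g_def Aq_def right_diff_distrib sum_subtractf)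
          then have eq: "(\<Sum>j\<in>UNIV. A $ i $ j * real_of_int (g q $ Inl j)) + g q $ Inr i
              = frac (Aq q i) - frac (Aq q0 i)"
            by (simp add: g_def frac_def)
          have "\<lfloor>real (T ^ (?n * k - s)) * frac (Aq q i)\<rfloor> = \<lfloor>real (T ^ (?n * k - s)) * frac (Aq q0 i)\<rfloor>"
            using arg_cong[OF same, of "\<lambda>v. v $ i"] by (simp add: \<phi>_def)
          then have "\<bar>real (T ^ (?n * k - s)) * frac (Aq q i) - real (T ^ (?n * k - s)) * frac (Aq q0 i)\<bar> \<le> 1"
            by linarith
          then have "real (T ^ (?n * k - s)) * \<bar>frac (Aq q i) - frac (Aq q0 i)\<bar> \<le> 1"
            by (simp add: right_diff_distrib[symmetric] abs_mult)
          moreover have "real T ^ (?n * k) = real T ^ (?n * k - s) * real T ^ s"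
            using s by (simp add: power_add[symmetric])
          ultimately show "\<bar>(\<Sum>j\<in>UNIV. A $ i $ j * real_of_int (g q $ Inl j)) + g q $ Inr i\<bar>
              \<le> real T ^ s / real T ^ (?n * k)"
            using T unfolding eq by (simp add: field_simps)
        qed
      qed
    qed (rule finite_short[OF T])
    then show "card {q \<in> X. \<phi> q = y} \<le> T ^ (s * ?d) - 1" using less by linarith
  qed
  also have "\<dots> \<le> T ^ ((?n * k - s) * ?m) * (T ^ (s * ?d) - 1)" by (rule mult_right_mono[OF card_img]) simp
  also have "\<dots> < T ^ ((?n * k - s) * ?m) * T ^ (s * ?d)" using T by simp
  also have "\<dots> = T ^ ((?m * k + s) * ?n)"
  proof -
    have "(?n * k - s) * ?m + s * ?d = (?m * k + s) * ?n"
    proof -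
      obtain r where r: "?n * k = s + r" using s le_Suc_ex by blast
      have "(?m * k + s) * ?n = ?m * (?n * k) + s * ?n" by (simp add: algebra_simps)
      then show ?thesis unfolding r by (simp add: algebra_simps)
    qed
    then show ?thesis by (simp only: power_add[symmetric])
  qed
  finally show False using cardX by simp
qed

lemma embed_sum:
  "embed T k A (\<chi> i. \<Sum>v\<in>B. c v * w v $ i) = (\<Sum>v\<in>B. real_of_int (c v) *\<^sub>R embed T k A (w v))"
proof -
  have "real_vec (\<chi> i. \<Sum>v\<in>B. c v * w v $ i) = (\<Sum>v\<in>B. real_of_int (c v) *\<^sub>R real_vec (w v))"
    by (simp add: vec_eq_iff)
  then show ?thesis
    unfolding embed_def
    by (simp add: linear_sum[OF matrix_vector_mul_linear, unfolded o_def] matrix_vector_mult_scaleR)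
qed

text \<open>Were the vectors of radius T^s contained in a hyperplane, there would be at most (4 d
  T^s)^(d-1) H of them, against at least T^(sd) by \<open>card_short_ge\<close>; the choice of s
  rules this out at all levels at once. Rounding coordinates in a basis of such vectors bounds the
  covering radius.\<close>

lemma lattice_covering:
  fixes H :: real
  assumes T: "T \<ge> 2"
  shows "\<exists>s. \<forall>k. \<forall>A :: real ^ 'n ^ 'm. s \<le> CARD('n) * k \<longrightarrow> real (card (short T k A 1)) \<le> H \<longrightarrow>
    (\<forall>x. \<exists>z. infnorm (embed T k A z - x) \<le> real CARD('n + 'm) * real T ^ s)"
proof -
  let ?n = "CARD('n)" and ?d = "CARD('n + 'm)"
  have T0: "T > 0" and T1: "real T > 1" using T by auto
  obtain s where s: "(4 * real ?d) ^ (?d - 1) * H < real T ^ s"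
    using real_arch_pow[OF T1] by blast
  have "\<exists>z. infnorm (embed T k A z - x) \<le> real ?d * real T ^ s"
    if k: "s \<le> ?n * k" and H: "real (card (short T k A 1)) \<le> H" for k and A :: "real ^ 'n ^ 'm" and x
  proof -
    have span: "span (embed T k A ` short T k A (real T ^ s)) = UNIV"
    proof (rule ccontr)
      assume ns: "\<not> ?thesis"
      have "real (T ^ (s * ?d)) \<le> real (card (short T k A (real T ^ s)))"
        using card_short_ge[OF T0 k] of_nat_le_iff by blast
      also have "\<dots> \<le> (4 * real ?d * real T ^ s) ^ (?d - 1) * card (short T k A 1)"
        by (rule card_short_not_spanning[OF T0 ns]) (use T1 in auto)
      also have "\<dots> \<le> (4 * real ?d * real T ^ s) ^ (?d - 1) * H"
        using H by (intro mult_left_mono) auto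
      also have "\<dots> = (real T ^ s) ^ (?d - 1) * ((4 * real ?d) ^ (?d - 1) * H)"
        by (simp only: power_mult_distrib mult_ac)
      also have "\<dots> < (real T ^ s) ^ (?d - 1) * real T ^ s"
        using s T1 by (intro mult_strict_left_mono) auto
      also have "\<dots> = (real T ^ s) ^ ?d"
        by (metis power_minus_mult zero_less_card_finite)
      finally show False by (simp add: power_mult)
    qed
    obtain B where B: "B \<subseteq> embed T k A ` short T k A (real T ^ s)" "independent B"
      "embed T k A ` short T k A (real T ^ s) \<subseteq> span B" "card B = dim (embed T k A ` short T k A (real T ^ s))"
      using basis_exists by blast
    have finB: "finite B" by (rule independent_imp_finite[OF B(2)])
    have cardB: "card B = ?d"
      using B(4) span dim_span[of "embed T k A ` short T k A (real T ^ s)"] by (simp add: dim_UNIV)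
    have "span B = UNIV"
      using span span_mono[OF B(3)] by (auto simp: span_span)
    then have "x \<in> range (\<lambda>u. \<Sum>v\<in>B. u v *\<^sub>R v)"
      using span_finite[OF finB] by simp
    then obtain u where u: "x = (\<Sum>v\<in>B. u v *\<^sub>R v)" by (rule rangeE)
    have "\<forall>v\<in>B. \<exists>z. z \<in> short T k A (real T ^ s) \<and> embed T k A z = v" using B(1) by blast
    then obtain w where w: "\<And>v. v \<in> B \<Longrightarrow> w v \<in> short T k A (real T ^ s) \<and> embed T k A (w v) = v"
      by metis
    define z where "z = (\<chi> i. \<Sum>v\<in>B. \<lfloor>u v\<rfloor> * w v $ i)"
    have "embed T k A z = (\<Sum>v\<in>B. \<lfloor>u v\<rfloor> *\<^sub>R v)"
      unfolding z_def embed_sum by (rule sum.cong) (auto simp: w)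
    then have diff: "x - embed T k A z = (\<Sum>v\<in>B. frac (u v) *\<^sub>R v)"
      by (simp add: u frac_def sum_subtractf scaleR_left_diff_distrib)
    have "infnorm (x - embed T k A z) \<le> real ?d * real T ^ s"
      unfolding infnorm_le_iff_cart
    proof
      fix i
      have "\<bar>(x - embed T k A z) $ i\<bar> = \<bar>\<Sum>v\<in>B. frac (u v) * v $ i\<bar>" by (simp add: diff)
      also have "\<dots> \<le> (\<Sum>v\<in>B. 1 * real T ^ s)"
      proof (rule order_trans[OF sum_abs], rule sum_mono)
        fix v assume "v \<in> B"
        then have "infnorm v \<le> real T ^ s" using w[of v] by (auto simp: short_def)
        then have "\<bar>v $ i\<bar> \<le> real T ^ s" by (simp add: infnorm_le_iff_cart)
        then show "\<bar>frac (u v) * v $ i\<bar> \<le> 1 * real T ^ s"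
          unfolding abs_mult by (intro mult_mono) (auto simp: less_imp_le[OF frac_lt_1])
      qed
      also have "\<dots> = real ?d * real T ^ s" by (simp only: sum_constant cardB mult_1)
      finally show "\<bar>(x - embed T k A z) $ i\<bar> \<le> real ?d * real T ^ s" .
    qed
    then show ?thesis by (metis infnorm_sub)
  qed
  then show ?thesis by blast
qed

text \<open>With a the covering radius, the lattice point is sought near 2 a in every q-coordinate,
  which forces q / T^(mk) between a and 3 a: large as well as bounded. The height concerns the
  corner of the cube; passing to A adds 3 n a to the error in units of T^(-nk), whence c = (3 n + 1)
  a.\<close>

lemma good_level_approximation:
  fixes H :: real
  assumes T: "T \<ge> 2"
  obtains c k0 where "c \<ge> 1" and "\<forall>k (A :: real ^ 'n ^ 'm) b. k \<ge> k0 \<longrightarrow>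
    height T k (cube_index T k A) \<le> H \<longrightarrow>
    (\<exists>q p. (\<forall>j. real T ^ (CARD('m) * k) \<le> real_of_int (q $ j) \<and> real_of_int (q $ j) \<le> c * real T ^ (CARD('m) * k))
      \<and> (\<forall>i. \<bar>(A *v real_vec q + real_vec p - b) $ i\<bar> \<le> c / real T ^ (CARD('n) * k)))"
proof -
  let ?m = "CARD('m)" and ?n = "CARD('n)"
  have T0: "T > 0" and T1: "real T \<ge> 1" using T by auto
  have Tp: "real T ^ e > 0" for e using T0 by simp
  have n1: "?n \<ge> 1" by (simp add: Suc_leI)
  obtain s where s: "\<And>k (A :: real ^ 'n ^ 'm) x. s \<le> ?n * k \<Longrightarrow> real (card (short T k A 1)) \<le> H \<Longrightarrow>
    \<exists>z. infnorm (embed T k A z - x) \<le> real CARD('n + 'm) * real T ^ s"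
    using lattice_covering[OF T, where 'n = 'n and 'm = 'm and H = H] by blast
  define a where "a = real CARD('n + 'm) * real T ^ s"
  have "1 * 1 \<le> real CARD('n + 'm) * real T ^ s"
    by (intro mult_mono one_le_power T1) (simp_all add: Suc_leI del: card_sum)
  then have a1: "a \<ge> 1" by (simp add: a_def)
  define c where "c = (3 * real ?n + 1) * a"
  have "real ?n \<ge> 1" using n1 by linarith
  then have c3: "3 * a \<le> c" unfolding c_def using a1 by (intro mult_right_mono) linarith+
  have "\<exists>q p. (\<forall>j. real T ^ (?m * k) \<le> real_of_int (q $ j) \<and> real_of_int (q $ j) \<le> c * real T ^ (?m * k))
      \<and> (\<forall>i. \<bar>(A *v real_vec q + real_vec p - b) $ i\<bar> \<le> c / real T ^ (?n * k))"
    if k: "k \<ge> s" and H: "height T k (cube_index T k A) \<le> H" for k b and A :: "real ^ 'n ^ 'm"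
  proof -
    define A' where "A' = cube_matrix T k (cube_index T k A)"
    have "1 * s \<le> ?n * k" using k n1 by (intro mult_mono) auto
    then have "s \<le> ?n * k" by simp
    moreover have "real (card (short T k A' 1)) \<le> H" using H by (simp add: A'_def height_def)
    ultimately obtain z where "infnorm (embed T k A' z -
        (\<chi> u. case u of Inl j \<Rightarrow> 2 * a | Inr i \<Rightarrow> real T ^ (?n * k) * b $ i)) \<le> a"
      using s[of k A'] unfolding a_def by blast
    then have z: "\<bar>(embed T k A' z -
        (\<chi> u. case u of Inl j \<Rightarrow> 2 * a | Inr i \<Rightarrow> real T ^ (?n * k) * b $ i)) $ u\<bar> \<le> a" for u
      by (simp only: infnorm_le_iff_cart)
    define q :: "int ^ 'n" where "q = (\<chi> j. z $ Inl j)"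
    define p :: "int ^ 'm" where "p = (\<chi> i. z $ Inr i)"
    have q: "a * real T ^ (?m * k) \<le> q $ j" "q $ j \<le> 3 * a * real T ^ (?m * k)" for j
    proof -
      have "\<bar>q $ j / real T ^ (?m * k) - 2 * a\<bar> \<le> a"
        using z[of "Inl j"] by (simp add: embed_Inl q_def)
      then have "a \<le> q $ j / real T ^ (?m * k)" "q $ j / real T ^ (?m * k) \<le> 3 * a" by linarith+
      then show "a * real T ^ (?m * k) \<le> q $ j" "q $ j \<le> 3 * a * real T ^ (?m * k)"
        using Tp by (simp_all add: pos_le_divide_eq pos_divide_le_eq)
    qed
    have p: "\<bar>(\<Sum>j\<in>UNIV. A' $ i $ j * q $ j) + p $ i - b $ i\<bar> \<le> a / real T ^ (?n * k)" for i
    proof -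
      have "\<bar>real T ^ (?n * k) * ((\<Sum>j\<in>UNIV. A' $ i $ j * q $ j) + p $ i - b $ i)\<bar> \<le> a"
        using z[of "Inr i"] by (simp add: embed_Inr q_def p_def right_diff_distrib)
      then show ?thesis using Tp by (simp add: abs_mult pos_le_divide_eq mult.commute)
    qed
    have AA': "\<bar>A $ i $ j - A' $ i $ j\<bar> \<le> 1 / real T ^ ((?m + ?n) * k)" for i j
    proof -
      define R where "R = real T ^ ((?m + ?n) * k)"
      have R: "R > 0" unfolding R_def by (rule Tp)
      have "\<bar>R * A $ i $ j - \<lfloor>R * A $ i $ j\<rfloor>\<bar> \<le> 1" by linarith
      moreover have "R * (A $ i $ j - A' $ i $ j) = R * A $ i $ j - \<lfloor>R * A $ i $ j\<rfloor>"
        using R by (simp add: A'_def cube_matrix_def cube_index_def R_def[symmetric] right_diff_distrib)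
      ultimately have "R * \<bar>A $ i $ j - A' $ i $ j\<bar> \<le> 1" using R by (metis abs_mult abs_of_pos)
      then have "\<bar>A $ i $ j - A' $ i $ j\<bar> \<le> 1 / R" using R by (simp add: pos_le_divide_eq mult.commute)
      then show ?thesis by (simp only: R_def)
    qed
    have "\<bar>(A *v real_vec q + real_vec p - b) $ i\<bar> \<le> c / real T ^ (?n * k)" for i
    proof -
      have "(A *v real_vec q + real_vec p - b) $ i
        = ((\<Sum>j\<in>UNIV. A' $ i $ j * q $ j) + p $ i - b $ i) + (\<Sum>j\<in>UNIV. (A $ i $ j - A' $ i $ j) * q $ j)"
        by (simp add: matrix_vector_mult_def left_diff_distrib sum_subtractf)
      moreover have "\<bar>\<Sum>j\<in>UNIV. (A $ i $ j - A' $ i $ j) * q $ j\<bar>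
          \<le> (\<Sum>j\<in>(UNIV :: 'n set). 1 / real T ^ ((?m + ?n) * k) * (3 * a * real T ^ (?m * k)))"
      proof (rule order_trans[OF sum_abs], rule sum_mono, unfold abs_mult, rule mult_mono[OF AA'])
        fix j
        have "0 \<le> a * real T ^ (?m * k)" using a1 Tp[of "?m * k"] by simp
        then show "\<bar>real_of_int (q $ j)\<bar> \<le> 3 * a * real T ^ (?m * k)" using q[of j] by linarith
      qed auto
      moreover have "\<dots> = 3 * real ?n * a / real T ^ (?n * k)"
        using T0 by (simp add: add_mult_distrib power_add field_simps)
      ultimately have "\<bar>(A *v real_vec q + real_vec p - b) $ i\<bar>
          \<le> a / real T ^ (?n * k) + 3 * real ?n * a / real T ^ (?n * k)"
        using p[of i] by linarith
      then show ?thesis by (simp add: c_def distrib_right add_divide_distrib add.commute)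
    qed
    moreover have "real T ^ (?m * k) \<le> q $ j \<and> q $ j \<le> c * real T ^ (?m * k)" for j
    proof
      have "1 * real T ^ (?m * k) \<le> a * real T ^ (?m * k)" using a1 Tp by (intro mult_right_mono) auto
      then show "real T ^ (?m * k) \<le> q $ j" using q(1)[of j] by linarith
      have "3 * a * real T ^ (?m * k) \<le> c * real T ^ (?m * k)" using c3 Tp by (intro mult_right_mono) auto
      then show "q $ j \<le> c * real T ^ (?m * k)" using q(2)[of j] by linarith
    qed
    ultimately show ?thesis by blast
  qed
  moreover have "c \<ge> 1" using c3 a1 by linarith
  ultimately show thesis using that by blast
qed

section \<open>Surviving cubes of targets\<close>

text \<open>The liminf condition with an explicit threshold Q, and with all p in place of the
  infimum over p. In this form the targets can be excluded cube by cube.\<close>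

definition avoiding :: "real \<Rightarrow> real \<Rightarrow> real ^ 'n ^ 'm \<Rightarrow> (real ^ 'm) set" where
  "avoiding \<epsilon> Q A = {b. \<forall>q p. norm (real_vec q) \<ge> Q \<longrightarrow>
     norm (real_vec q) powr (real CARD('n) / real CARD('m)) * norm (A *v real_vec q + real_vec p - b) \<ge> \<epsilon>}"

text \<open>Indexes cubes of side K T^(-nk), which is comparable to \<rho>; the constant K leaves
  room for the approximation error.\<close>

definition target_index :: "nat \<Rightarrow> nat \<Rightarrow> nat \<Rightarrow> nat \<Rightarrow> real ^ 'm \<Rightarrow> int ^ 'm" where
  "target_index T n K k b = (\<chi> i. \<lfloor>real T ^ (n * k) * (b $ i / real K)\<rfloor>)"

lemma target_index_div:
  assumes "T > 0"
  shows "target_index T n K (k + l) b $ i div int (T ^ (n * l)) = target_index T n K k b $ i"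
  using floor_mult_div[of "T ^ (n * l)" "real T ^ (n * k) * (b $ i / real K)"] assms
  by (simp add: target_index_def distrib_left power_add mult_ac)

lemma target_index_eq_imp_close:
  assumes "T > 0" "K > 0" "target_index T n K k b = target_index T n K k b'"
  shows "\<bar>(b - b') $ i\<bar> \<le> real K / real T ^ (n * k)"
proof -
  define R where "R = real T ^ (n * k) / real K"
  have R: "R > 0" using assms by (simp add: R_def)
  have "\<lfloor>R * b $ i\<rfloor> = \<lfloor>R * b' $ i\<rfloor>"
    using arg_cong[OF assms(3), of "\<lambda>v. v $ i"] by (simp add: target_index_def R_def)
  then have "\<bar>R * b $ i - R * b' $ i\<bar> \<le> 1" by linarith
  then have "R * \<bar>(b - b') $ i\<bar> \<le> 1"
    using R by (metis abs_mult abs_of_pos right_diff_distrib vector_minus_component)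
  then have "\<bar>(b - b') $ i\<bar> \<le> 1 / R" using R by (simp add: pos_le_divide_eq mult.commute)
  then show ?thesis by (simp add: R_def)
qed

lemma norm_le_card_mult:
  fixes x :: "real ^ 'd"
  assumes "\<And>i. \<bar>x $ i\<bar> \<le> r"
  shows "norm x \<le> real CARD('d) * r"
proof -
  have "norm x \<le> (\<Sum>i\<in>UNIV. \<bar>x $ i\<bar>)" by (rule norm_le_l1_cart)
  also have "\<dots> \<le> (\<Sum>i\<in>(UNIV :: 'd set). r)" by (rule sum_mono) (rule assms)
  finally show ?thesis by simp
qed

text \<open>A point A q + p found near the centre of a target cube lies in that cube, and all
  targets in its subcube L levels deeper are approximated better than \<epsilon>. \<open>K\<close>
  and \<open>L\<close> precede Q because the dimension bound has to be the same for every threshold;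
  only the first admissible level depends on Q.\<close>

lemma missed_subcube:
  fixes H \<epsilon> :: real
  assumes T: "T \<ge> 2" and \<epsilon>: "\<epsilon> > 0"
  shows "\<exists>K>0. \<exists>L>0. \<forall>Q. \<exists>k0. \<forall>k\<ge>k0. \<forall>A :: real ^ 'n ^ 'm. height T k (cube_index T k A) \<le> H \<longrightarrow>
    (\<forall>c. \<exists>e. (\<forall>i. e $ i div int (T ^ (CARD('n) * L)) = c $ i)
      \<and> e \<notin> target_index T CARD('n) K (k + L) ` avoiding \<epsilon> Q A)"
proof -
  let ?m = "CARD('m)" and ?n = "CARD('n)"
  have T0: "T > 0" and T1: "real T > 1" using T by auto
  have Tp: "real T ^ e > 0" for e using T0 by simp
  have n1: "?n \<ge> 1" and m1: "?m \<ge> 1" by (simp_all add: Suc_leI)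
  obtain c k1 where c1: "c \<ge> 1" and approx: "\<forall>k (A :: real ^ 'n ^ 'm) b. k \<ge> k1 \<longrightarrow>
    height T k (cube_index T k A) \<le> H \<longrightarrow>
    (\<exists>q p. (\<forall>j. real T ^ (?m * k) \<le> real_of_int (q $ j) \<and> real_of_int (q $ j) \<le> c * real T ^ (?m * k))
      \<and> (\<forall>i. \<bar>(A *v real_vec q + real_vec p - b) $ i\<bar> \<le> c / real T ^ (?n * k)))"
    using good_level_approximation[OF T, where 'n = 'n and 'm = 'm and H = H] .
  \<comment> \<open>In units of T^(-nk) the error is c and the side at least 4 c, so a point near
    the centre misses it by at most a quarter of the side and stays inside.\<close>
  define K where "K = nat \<lceil>4 * c\<rceil>"
  have K4: "real K \<ge> 4 * c" unfolding K_def by linarith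
  then have K0: "K > 0" using c1 by (intro gr0I) simp
  \<comment> \<open>D / T^(nl) bounds norm q^(n/m) times the diameter of a subcube l levels deeper:
    the first factor is at most a constant times T^(nk), so the level k drops out.\<close>
  define D where "D = (real ?n * c) powr (real ?n / real ?m) * (real ?m * real K)"
  have D0: "D > 0" unfolding D_def using n1 m1 c1 K0 by simp
  obtain L where L: "D / \<epsilon> < real T ^ L" using real_arch_pow[OF T1] by blast
  \<comment> \<open>The depth is L + 1, hence positive even for L = 0.\<close>
  have L0: "L + 1 > 0" by simp
  have Lbig: "D / real T ^ (?n * (L + 1)) < \<epsilon>"
  proof -
    have "L \<le> 1 * (L + 1)" by simp
    also have "\<dots> \<le> ?n * (L + 1)" using n1 by (rule mult_right_mono) simp
    finally have "real T ^ L \<le> real T ^ (?n * (L + 1))" using T1 by (intro power_increasing) auto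
    then have "D / \<epsilon> < real T ^ (?n * (L + 1))" using L by linarith
    then show ?thesis
      using \<epsilon> Tp[of "?n * (L + 1)"] by (simp only: pos_divide_less_eq mult.commute)
  qed
  have "\<exists>e. (\<forall>i. e $ i div int (T ^ (?n * (L + 1))) = a $ i)
      \<and> e \<notin> target_index T ?n K (k + (L + 1)) ` avoiding \<epsilon> Q A"
    if k: "k \<ge> k1" "Q \<le> real T ^ k" and H: "height T k (cube_index T k A) \<le> H"
    for k Q and A :: "real ^ 'n ^ 'm" and a :: "int ^ 'm"
  proof -
    define b where "b = (\<chi> i. (a $ i + 1 / 2) * real K / real T ^ (?n * k))"
    obtain q p where q: "\<And>j. real T ^ (?m * k) \<le> q $ j" "\<And>j. q $ j \<le> c * real T ^ (?m * k)"
      and p: "\<And>i. \<bar>(A *v real_vec q + real_vec p - b) $ i\<bar> \<le> c / real T ^ (?n * k)"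
      using approx[rule_format, OF k(1) H, of b] by blast
    define z where "z = A *v real_vec q + real_vec p"
    define e where "e = target_index T ?n K (k + (L + 1)) z"
    have "target_index T ?n K k z $ i = a $ i" for i
    proof -
      define R where "R = real T ^ (?n * k) / real K"
      have R: "R > 0" using T0 K0 by (simp add: R_def)
      have "R * b $ i = a $ i + 1 / 2" using T0 K0 by (simp add: R_def b_def)
      moreover have "\<bar>R * (z $ i - b $ i)\<bar> \<le> 1 / 4"
      proof -
        have "\<bar>z $ i - b $ i\<bar> \<le> c / real T ^ (?n * k)" using p[of i] by (simp add: z_def)
        then have "R * \<bar>z $ i - b $ i\<bar> \<le> R * (c / real T ^ (?n * k))" using R by (intro mult_left_mono) auto
        also have "\<dots> = c / real K" using T0 by (simp add: R_def)
        also have "\<dots> \<le> 1 / 4" using K4 K0 by (simp add: pos_divide_le_eq)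
        finally show ?thesis using R by (simp add: abs_mult)
      qed
      ultimately have "\<bar>R * z $ i - (a $ i + 1 / 2)\<bar> \<le> 1 / 4" by (simp add: right_diff_distrib)
      then have "\<lfloor>R * z $ i\<rfloor> = a $ i" by linarith
      then show ?thesis by (simp add: target_index_def R_def)
    qed
    then have "\<forall>i. e $ i div int (T ^ (?n * (L + 1))) = a $ i"
      unfolding e_def by (metis target_index_div[OF T0])
    moreover have "e \<notin> target_index T ?n K (k + (L + 1)) ` avoiding \<epsilon> Q A"
    proof
      assume "e \<in> target_index T ?n K (k + (L + 1)) ` avoiding \<epsilon> Q A"
      then obtain b' where b': "b' \<in> avoiding \<epsilon> Q A" "target_index T ?n K (k + (L + 1)) z = target_index T ?n K (k + (L + 1)) b'"
        by (auto simp: e_def)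
      have "norm (z - b') \<le> real ?m * (real K / real T ^ (?n * (k + (L + 1))))"
        by (rule norm_le_card_mult) (rule target_index_eq_imp_close[OF T0 K0 b'(2)])
      moreover have "norm (real_vec q) powr (real ?n / real ?m) \<le> (real ?n * c) powr (real ?n / real ?m) * real T ^ (?n * k)"
      proof -
        have "norm (real_vec q) \<le> real ?n * (c * real T ^ (?m * k))"
        proof (rule norm_le_card_mult)
          fix j show "\<bar>real_vec q $ j\<bar> \<le> c * real T ^ (?m * k)"
            unfolding real_vec_nth using q[of j] Tp[of "?m * k"] by linarith
        qed
        then have "norm (real_vec q) powr (real ?n / real ?m) \<le> (real ?n * (c * real T ^ (?m * k))) powr (real ?n / real ?m)"
          by (intro powr_mono2) auto
        also have "\<dots> = (real ?n * c) powr (real ?n / real ?m) * (real T ^ (?m * k)) powr (real ?n / real ?m)"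
          using c1 by (simp add: powr_mult mult.assoc[symmetric])
        also have "(real T ^ (?m * k)) powr (real ?n / real ?m) = real T ^ (?n * k)"
        proof -
          have "real T ^ (?m * k) = real T powr (real (?m * k))"
            using T0 by (simp only: powr_realpow of_nat_0_less_iff)
          then have "(real T ^ (?m * k)) powr (real ?n / real ?m) = real T powr (real (?m * k) * (real ?n / real ?m))"
            by (simp add: powr_powr)
          also have "real (?m * k) * (real ?n / real ?m) = real (?n * k)" by simp
          finally show ?thesis using T0 by (simp only: powr_realpow of_nat_0_less_iff)
        qed
        finally show ?thesis .
      qed
      ultimately have "norm (real_vec q) powr (real ?n / real ?m) * norm (z - b')
        \<le> ((real ?n * c) powr (real ?n / real ?m) * real T ^ (?n * k)) * (real ?m * (real K / real T ^ (?n * (k + (L + 1)))))"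
        by (intro mult_mono) auto
      also have "\<dots> = D / real T ^ (?n * (L + 1))"
      proof -
        have "real T ^ (?n * (k + (L + 1))) = real T ^ (?n * k) * real T ^ (?n * (L + 1))"
          by (simp only: distrib_left[of ?n k] power_add)
        then show ?thesis using T0 by (simp only: D_def) simp
      qed
      also have "\<dots> < \<epsilon>" by (rule Lbig)
      finally have "norm (real_vec q) powr (real ?n / real ?m) * norm (z - b') < \<epsilon>" .
      moreover have "norm (real_vec q) \<ge> Q"
      proof -
        fix j :: 'n
        have "1 * k \<le> ?m * k" using m1 by (rule mult_right_mono) simp
        then have "real T ^ k \<le> real T ^ (?m * k)" using T1 by (intro power_increasing) auto
        also have "\<dots> \<le> \<bar>real_vec q $ j\<bar>" using q(1)[of j] by simp
        also have "\<dots> \<le> norm (real_vec q)" by (rule component_le_norm_cart)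
        finally show ?thesis using k(2) by linarith
      qed
      ultimately show False using b'(1) by (auto simp: avoiding_def z_def not_le[symmetric])
    qed
    ultimately show ?thesis by blast
  qed
  note * = this
  have "\<exists>k0. \<forall>k\<ge>k0. \<forall>A :: real ^ 'n ^ 'm. height T k (cube_index T k A) \<le> H \<longrightarrow>
    (\<forall>a. \<exists>e. (\<forall>i. e $ i div int (T ^ (?n * (L + 1))) = a $ i)
      \<and> e \<notin> target_index T ?n K (k + (L + 1)) ` avoiding \<epsilon> Q A)" for Q
  proof -
    obtain k2 where k2: "Q < real T ^ k2" using real_arch_pow[OF T1] by blast
    have "Q \<le> real T ^ k" if "k \<ge> max k1 k2" for k
    proof -
      have "real T ^ k2 \<le> real T ^ k" using that T1 by (intro power_increasing) auto
      then show ?thesis using k2 by linarith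
    qed
    then show ?thesis using * by (intro exI[of _ "max k1 k2"]) simp
  qed
  note ** = this
  show ?thesis
    by (rule exI[of _ K], rule conjI[OF K0], rule exI[of _ "L + 1"], rule conjI[OF L0], rule allI, rule **)
qed

text \<open>Drops that start less than L levels apart overlap, so only one in L good levels is
  exploited. The induction goes down from N to the last good level k with k + L \<le> N.\<close>

lemma monotone_decay:
  fixes \<nu> :: "nat \<Rightarrow> real" and L :: nat
  assumes mono: "\<And>k l. \<nu> (k + l) \<le> \<nu> k" and \<theta>: "0 \<le> \<theta>" and L: "L > 0"
    and drop: "\<And>k. k \<in> G \<Longrightarrow> \<nu> (k + L) \<le> \<theta> * \<nu> k"
  shows "L * j \<le> card (G \<inter> {..<N}) \<Longrightarrow> \<nu> N \<le> \<theta> ^ j * \<nu> 0"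
proof (induction j arbitrary: N)
  case 0
  then show ?case using mono[of 0 N] by simp
next
  case (Suc j)
  have "card (G \<inter> {..<N}) \<le> card {..<N}" by (intro card_mono) auto
  then have LN: "L \<le> N" using Suc.prems by simp
  have fin: "finite (G \<inter> {..N - L})" by simp
  have tail: "card {N - L + 1..<N} < L" using L LN by simp
  have ne: "G \<inter> {..N - L} \<noteq> {}"
  proof
    assume "G \<inter> {..N - L} = {}"
    then have "G \<inter> {..<N} \<subseteq> {N - L + 1..<N}" by force
    then have "card (G \<inter> {..<N}) \<le> card {N - L + 1..<N}" by (intro card_mono) auto
    then show False using tail Suc.prems by simp
  qed
  define k where "k = Max (G \<inter> {..N - L})"
  have k: "k \<in> G" "k \<le> N - L" using Max_in[OF fin ne] by (auto simp: k_def)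
  have kmax: "x \<le> k" if "x \<in> G" "x \<le> N - L" for x
    using Max_ge[OF fin, of x] that by (simp add: k_def)
  \<comment> \<open>k and the L - 1 levels above N - L use up at most L good levels, so at least L j
    remain below k.\<close>
  have "G \<inter> {..<N} \<subseteq> (G \<inter> {..<k}) \<union> ({k} \<union> {N - L + 1..<N})"
    using kmax by force
  then have "card (G \<inter> {..<N}) \<le> card ((G \<inter> {..<k}) \<union> ({k} \<union> {N - L + 1..<N}))"
    by (intro card_mono) auto
  also have "\<dots> \<le> card (G \<inter> {..<k}) + card ({k} \<union> {N - L + 1..<N})" by (rule card_Un_le)
  also have "card ({k} \<union> {N - L + 1..<N}) \<le> card {k} + card {N - L + 1..<N}" by (rule card_Un_le)
  finally have "L * j \<le> card (G \<inter> {..<k})" using tail Suc.prems by simp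
  then have IH: "\<nu> k \<le> \<theta> ^ j * \<nu> 0" by (rule Suc.IH)
  have "\<nu> N = \<nu> ((k + L) + (N - (k + L)))" using k LN by simp
  also have "\<dots> \<le> \<nu> (k + L)" by (rule mono)
  also have "\<dots> \<le> \<theta> * \<nu> k" by (rule drop[OF k(1)])
  also have "\<dots> \<le> \<theta> * (\<theta> ^ j * \<nu> 0)" by (rule mult_left_mono[OF IH \<theta>])
  finally show ?case by simp
qed

section \<open>Counting the target cubes that meet a set\<close>

definition subcubes :: "int \<Rightarrow> int ^ 'm \<Rightarrow> (int ^ 'm) set" where
  "subcubes D c = {e. \<forall>i. e $ i div D = c $ i}"

lemma subcubes_eq:
  assumes "D > 0"
  shows "subcubes D c = {e. \<forall>i. e $ i \<in> {D * c $ i..<D * c $ i + D}}"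
proof -
  have "x div D = y \<longleftrightarrow> x \<in> {D * y..<D * y + D}" for x y :: int
  proof
    assume "x div D = y"
    then have "D * y + x mod D = x" using mult_div_mod_eq[of D x] by simp
    then show "x \<in> {D * y..<D * y + D}"
      unfolding atLeastLessThan_iff
      using pos_mod_bound[OF assms, of x] pos_mod_sign[OF assms, of x] by linarith
  next
    assume "x \<in> {D * y..<D * y + D}"
    then show "x div D = y" by (intro int_div_pos_eq[of _ _ _ "x - D * y"]) auto
  qed
  then show ?thesis by (simp add: subcubes_def)
qed

lemma finite_subcubes: "D > 0 \<Longrightarrow> finite (subcubes D c)"
  by (simp add: subcubes_eq finite_vec_Pi del: atLeastLessThan_iff)

lemma card_subcubes:
  assumes "D > 0"
  shows "card (subcubes D (c :: int ^ 'm)) = nat D ^ CARD('m)"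
proof -
  have "card (subcubes D c) = (\<Prod>i\<in>(UNIV :: 'm set). card {D * c $ i..<D * c $ i + D})"
    unfolding subcubes_eq[OF assms] by (rule card_vec_Pi)
  then show ?thesis by simp
qed

text \<open>The divisor is the number of level k subcubes of one cube of level 0; with it the
  quotient cannot increase with k.\<close>

definition survivor_density :: "nat \<Rightarrow> nat \<Rightarrow> nat \<Rightarrow> (real ^ 'm) set \<Rightarrow> nat \<Rightarrow> real" where
  "survivor_density T n K E k = real (card (target_index T n K k ` E)) / real T ^ (n * k * CARD('m))"

context
  fixes T n K :: nat and E :: "(real ^ 'm) set"
  assumes T: "T > 0"
begin

lemma target_index_in_subcubes:
  "target_index T n K (k + l) b \<in> subcubes (int (T ^ (n * l))) (target_index T n K k b)"
  by (simp add: subcubes_def target_index_div[OF T] del: of_nat_power)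

lemma finite_target_index:
  assumes "finite (target_index T n K k ` E)"
  shows "finite (target_index T n K (k + l) ` E)"
proof (rule finite_subset)
  show "target_index T n K (k + l) ` E \<subseteq> (\<Union>c\<in>target_index T n K k ` E. subcubes (int (T ^ (n * l))) c)"
    using target_index_in_subcubes by blast
  show "finite (\<Union>c\<in>target_index T n K k ` E. subcubes (int (T ^ (n * l))) c)"
    using assms T by (intro finite_UN_I finite_subcubes) auto
qed

lemma card_target_index_le:
  assumes fin: "finite (target_index T n K k ` E)"
    and w: "\<And>c. card (subcubes (int (T ^ (n * l))) c \<inter> target_index T n K (k + l) ` E) \<le> w"
  shows "card (target_index T n K (k + l) ` E) \<le> card (target_index T n K k ` E) * w"
proof -
  let ?S = "target_index T n K (k + l) ` E"
  define f :: "int ^ 'm \<Rightarrow> int ^ 'm" where "f e = (\<chi> i. e $ i div int (T ^ (n * l)))" for e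
  have f: "f (target_index T n K (k + l) b) = target_index T n K k b" for b :: "real ^ 'm"
    by (simp add: f_def vec_eq_iff target_index_div[OF T] del: of_nat_power)
  have "card ?S \<le> card (f ` ?S) * w"
  proof (rule card_le_card_image_mult[OF finite_target_index[OF fin]])
    fix c
    have "{x \<in> ?S. f x = c} = subcubes (int (T ^ (n * l))) c \<inter> ?S"
      by (auto simp: subcubes_def f_def vec_eq_iff)
    then show "card {x \<in> ?S. f x = c} \<le> w" using w by simp
  qed
  moreover have "f ` ?S = target_index T n K k ` E" by (simp add: image_image f)
  ultimately show ?thesis by simp
qed

lemma survivor_density_mono:
  assumes fin: "\<And>k. finite (target_index T n K k ` E)"
  shows "survivor_density T n K E (k + l) \<le> survivor_density T n K E k"
proof -
  have "card (target_index T n K (k + l) ` E) \<le> card (target_index T n K k ` E) * T ^ (n * l * CARD('m))"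
  proof (rule card_target_index_le[OF fin])
    fix c :: "int ^ 'm"
    have "card (subcubes (int (T ^ (n * l))) c \<inter> target_index T n K (k + l) ` E)
        \<le> card (subcubes (int (T ^ (n * l))) c)"
      using T by (intro card_mono finite_subcubes) auto
    also have "\<dots> = T ^ (n * l * CARD('m))"
      using T by (subst card_subcubes) (simp_all add: power_mult nat_power_eq)
    finally show "card (subcubes (int (T ^ (n * l))) c \<inter> target_index T n K (k + l) ` E) \<le> T ^ (n * l * CARD('m))" .
  qed
  then have "real (card (target_index T n K (k + l) ` E))
      \<le> real (card (target_index T n K k ` E) * T ^ (n * l * CARD('m)))" by (simp only: of_nat_le_iff)
  then show ?thesis
    using T by (simp add: survivor_density_def add_mult_distrib add_mult_distrib2 power_add field_simps)
qed

lemma survivor_density_missed: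
  assumes fin: "\<And>k. finite (target_index T n K k ` E)"
    and missed: "\<And>c. \<exists>e\<in>subcubes (int (T ^ (n * l))) c. e \<notin> target_index T n K (k + l) ` E"
  shows "survivor_density T n K E (k + l) \<le> (1 - 1 / real T ^ (n * l * CARD('m))) * survivor_density T n K E k"
proof -
  let ?P = "T ^ (n * l * CARD('m))"
  have P: "?P \<ge> 1" using T by simp
  have "card (target_index T n K (k + l) ` E) \<le> card (target_index T n K k ` E) * (?P - 1)"
  proof (rule card_target_index_le[OF fin])
    fix c :: "int ^ 'm"
    have D: "int (T ^ (n * l)) > 0" using T by simp
    obtain e where e: "e \<in> subcubes (int (T ^ (n * l))) c" "e \<notin> target_index T n K (k + l) ` E"
      using missed by blast
    have "card (subcubes (int (T ^ (n * l))) c \<inter> target_index T n K (k + l) ` E)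
        \<le> card (subcubes (int (T ^ (n * l))) c - {e})"
      using e(2) by (intro card_mono finite_Diff finite_subcubes[OF D]) auto
    also have "\<dots> = card (subcubes (int (T ^ (n * l))) c) - 1"
      by (rule card_Diff_singleton[OF e(1)])
    also have "card (subcubes (int (T ^ (n * l))) c) = ?P"
      using card_subcubes[OF D, of c] by (simp add: power_mult nat_power_eq)
    finally show "card (subcubes (int (T ^ (n * l))) c \<inter> target_index T n K (k + l) ` E) \<le> ?P - 1" .
  qed
  then have "real (card (target_index T n K (k + l) ` E))
      \<le> real (card (target_index T n K k ` E) * (?P - 1))" by (simp only: of_nat_le_iff)
  also have "\<dots> = real (card (target_index T n K k ` E)) * (real T ^ (n * l * CARD('m)) - 1)"
    using P by (simp add: of_nat_diff)
  finally have le: "real (card (target_index T n K (k + l) ` E))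
      \<le> real (card (target_index T n K k ` E)) * (real T ^ (n * l * CARD('m)) - 1)" .
  have pw: "real T ^ (n * (k + l) * CARD('m)) = real T ^ (n * k * CARD('m)) * real T ^ (n * l * CARD('m))"
    by (simp add: add_mult_distrib add_mult_distrib2 power_add)
  have "survivor_density T n K E (k + l) \<le> real (card (target_index T n K k ` E)) * (real T ^ (n * l * CARD('m)) - 1)
      / (real T ^ (n * k * CARD('m)) * real T ^ (n * l * CARD('m)))"
    unfolding survivor_density_def pw by (intro divide_right_mono le) simp
  also have "\<dots> = (1 - 1 / real T ^ (n * l * CARD('m))) * survivor_density T n K E k"
    using T by (simp add: survivor_density_def field_simps)
  finally show ?thesis .
qed

lemma finite_target_index_bounded:
  assumes "K > 0" and bdd: "\<And>b i. b \<in> E \<Longrightarrow> \<bar>b $ i\<bar> \<le> R"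
  shows "finite (target_index T n K k ` E)"
proof -
  have "target_index T n K 0 ` E \<subseteq> {v. \<forall>i. v $ i \<in> {\<lfloor>- R / K\<rfloor>..\<lfloor>R / K\<rfloor>}}"
  proof (clarsimp simp: target_index_def)
    fix b i assume "b \<in> E"
    then have "- R \<le> b $ i" "b $ i \<le> R" using bdd[of b i] by (auto simp: abs_le_iff)
    then show "\<lfloor>- (R / real K)\<rfloor> \<le> \<lfloor>b $ i / real K\<rfloor> \<and> \<lfloor>b $ i / real K\<rfloor> \<le> \<lfloor>R / real K\<rfloor>"
      using divide_right_mono[of "- R" "b $ i" "real K"] divide_right_mono[of "b $ i" R "real K"]
      by (auto intro!: floor_mono)
  qed
  then have "finite (target_index T n K 0 ` E)"
    by (rule finite_subset) (intro finite_vec_Pi finite_atLeastAtMost_int)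
  from finite_target_index[OF this, of k] show ?thesis by simp
qed

end

section \<open>Dimension bounds\<close>

text \<open>A liminf at least \<epsilon> gives an inequality for all large q only with a smaller
  constant, here \<epsilon> / 2. The infimum in \<open>dist_int\<close> is compared with its value
  at -p.\<close>

lemma Bad_imp_avoiding:
  fixes A :: "real ^ 'n ^ 'm"
  assumes "\<epsilon> > 0" "b \<in> Bad A \<epsilon>"
  obtains Q where "b \<in> avoiding (\<epsilon> / 2) Q A"
proof -
  have "ereal (\<epsilon> / 2) < ereal \<epsilon>" using assms(1) by simp
  then have "eventually (\<lambda>q :: real ^ 'n. ereal (\<epsilon> / 2) <
      ereal (norm q powr (real CARD('n) / real CARD('m)) * dist_int (A *v q - b))) int_vecs_at_infinity"
    using assms(2) unfolding Bad_def is_bad_for_def le_Liminf_iff by blast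
  then obtain Q where Q: "\<And>q :: real ^ 'n. norm q \<ge> Q \<Longrightarrow> q \<in> int_vecs \<Longrightarrow>
      \<epsilon> / 2 < norm q powr (real CARD('n) / real CARD('m)) * dist_int (A *v q - b)"
    unfolding int_vecs_at_infinity_def eventually_inf_principal eventually_at_infinity by auto
  have "b \<in> avoiding (\<epsilon> / 2) Q A"
    unfolding avoiding_def
  proof (intro CollectI allI impI)
    fix q :: "int ^ 'n" and p :: "int ^ 'm" assume q: "norm (real_vec q) \<ge> Q"
    have "\<epsilon> / 2 < norm (real_vec q) powr (real CARD('n) / real CARD('m)) * dist_int (A *v real_vec q - b)"
      by (rule Q[OF q]) (simp add: int_vecs_def)
    also have "\<dots> \<le> norm (real_vec q) powr (real CARD('n) / real CARD('m)) * norm (A *v real_vec q + real_vec p - b)"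
    proof (rule mult_left_mono)
      have "dist_int (A *v real_vec q - b) \<le> norm (A *v real_vec q - b - (- real_vec p))"
        unfolding dist_int_def
        by (rule cINF_lower) (auto simp: int_vecs_def intro!: bdd_belowI2[where m = 0])
      then show "dist_int (A *v real_vec q - b) \<le> norm (A *v real_vec q + real_vec p - b)"
        by (simp add: algebra_simps)
    qed simp
    finally show "\<epsilon> / 2 \<le> norm (real_vec q) powr (real CARD('n) / real CARD('m)) * norm (A *v real_vec q + real_vec p - b)"
      by simp
  qed
  then show thesis by (rule that)
qed

lemma power_div_le_powr:
  fixes \<theta> :: real and L g :: nat
  assumes "0 < \<theta>" "\<theta> < 1" "L > 0"
  shows "\<theta> ^ (g div L) \<le> \<theta> powr (real g / real L - 1)"
proof -
  have "g < L * (g div L + 1)" using assms(3) by (simp add: dividend_less_times_div)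
  then have "real g < real (L * (g div L + 1))" by (simp only: of_nat_less_iff)
  then have "real g < real L * (real (g div L) + 1)" by (simp add: algebra_simps)
  then have "real g / real L - 1 \<le> real (g div L)"
    using assms(3) by (simp add: field_simps)
  then have "\<theta> powr (real (g div L)) \<le> \<theta> powr (real g / real L - 1)"
    using assms by (intro powr_mono') auto
  then show ?thesis using assms(1) by (simp add: powr_realpow)
qed

text \<open>Infinitely many N suffice because a null set requires just one economical cover below
  each scale. \<delta> is obtained before A, since the theorem needs one \<delta> for all
  matrices.\<close>

lemma frequently_good_imp_Bad_null:
  fixes H \<epsilon> :: real
  assumes T: "T \<ge> 2" and \<epsilon>: "\<epsilon> > 0"
  obtains \<delta> where "0 < \<delta>" "2 * \<delta> < 1" "\<forall>A :: real ^ 'n ^ 'm.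
    (\<forall>N0. \<exists>N\<ge>N0. N < 5 * card {k. k < N \<and> height T k (cube_index T k A) \<le> H}) \<longrightarrow>
    hausdorff_measure (real CARD('m) - 2 * \<delta>) (Bad A \<epsilon>) = 0"
proof -
  let ?m = "CARD('m)" and ?n = "CARD('n)"
  have T0: "T > 0" and T1: "real T > 1" using T by auto
  have n1: "real ?n \<ge> 1" and m1: "real ?m \<ge> 1" by (simp_all add: Suc_leI)
  have "\<epsilon> / 2 > 0" using \<epsilon> by simp
  from missed_subcube[OF T this, where 'n = 'n and 'm = 'm and H = H]
  obtain K L where K: "K > 0" and L: "L > 0" and
    missed: "\<forall>Q. \<exists>k0. \<forall>k\<ge>k0. \<forall>A :: real ^ 'n ^ 'm. height T k (cube_index T k A) \<le> H \<longrightarrow>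
    (\<forall>c. \<exists>e. (\<forall>i. e $ i div int (T ^ (?n * L)) = c $ i)
      \<and> e \<notin> target_index T ?n K (k + L) ` avoiding (\<epsilon> / 2) Q A)"
    by (elim exE conjE)
  define P where "P = real T ^ (?n * L * ?m)"
  have P: "P > 1" unfolding P_def using T1 L by (intro one_less_power) auto
  define \<theta> where "\<theta> = 1 - 1 / P"
  have \<theta>: "0 < \<theta>" "\<theta> < 1" using P by (simp_all add: \<theta>_def)
  \<comment> \<open>With N / 5 good levels the density falls to about \<theta>^(N / (5 L)) = x^N
    x^N. One factor x^N pays for lowering the exponent from m to m - 2 \<delta>, the other makes the
    sums tend to 0.\<close>
  define x where "x = \<theta> powr (1 / (10 * real L))"
  have x: "0 < x" "x < 1"
    using \<theta> L powr_less_mono2[of "1 / (10 * real L)" \<theta> 1] by (simp_all add: x_def)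
  \<comment> \<open>The second entry solves T^(2 \<delta> n) = 1 / x, the cost per level of the
    lower exponent; the entry 1 / 4 keeps m - 2 \<delta> positive.\<close>
  define \<delta> where "\<delta> = min (1 / 4) (- ln x / (2 * real ?n * ln (real T)))"
  have lnT: "ln (real T) > 0" using T1 by simp
  have "ln x < 0" using x by simp
  then have "0 < - ln x / (2 * real ?n * ln (real T))"
    using lnT n1 by (intro divide_pos_pos mult_pos_pos) auto
  then have \<delta>: "\<delta> > 0" "2 * \<delta> < 1" by (auto simp: \<delta>_def)
  have T\<delta>: "real T powr (2 * \<delta> * real ?n) \<le> 1 / x"
  proof -
    have "\<delta> \<le> - ln x / (2 * real ?n * ln (real T))" by (simp add: \<delta>_def)
    then have "\<delta> * (2 * real ?n * ln (real T)) \<le> - ln x"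
      using lnT n1 by (subst (asm) pos_le_divide_eq) auto
    then have "2 * \<delta> * real ?n * ln (real T) \<le> ln (1 / x)"
      using x by (simp add: ln_div mult_ac)
    then have "exp (2 * \<delta> * real ?n * ln (real T)) \<le> exp (ln (1 / x))" by (simp only: exp_le_cancel_iff)
    then show ?thesis using x T0 by (simp add: powr_def)
  qed
  define s where "s = real ?m - 2 * \<delta>"
  have s0: "s > 0" unfolding s_def using m1 \<delta> by linarith
  have null: "hausdorff_measure s E = 0"
    if good: "\<forall>N0. \<exists>N\<ge>N0. N < 5 * card {k. k < N \<and> height T k (cube_index T k A) \<le> H}"
      and E: "E \<subseteq> avoiding (\<epsilon> / 2) Q A" and bdd: "\<And>b i. b \<in> E \<Longrightarrow> \<bar>b $ i\<bar> \<le> R"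
    for A :: "real ^ 'n ^ 'm" and E Q R
  proof (rule hausdorff_measure_zero_fibres[OF s0])
    fix r e :: real assume r: "r > 0" and e: "e > 0"
    have fin: "finite (target_index T ?n K k ` E)" for k
      by (rule finite_target_index_bounded[OF T0 K bdd])
    define \<nu> where "\<nu> = survivor_density T ?n K E"
    have \<nu>0: "\<nu> k \<ge> 0" for k by (simp add: \<nu>_def survivor_density_def)
    obtain k0 where k0: "\<And>k (A :: real ^ 'n ^ 'm) c. k \<ge> k0 \<Longrightarrow> height T k (cube_index T k A) \<le> H \<Longrightarrow>
      \<exists>e. (\<forall>i. e $ i div int (T ^ (?n * L)) = c $ i) \<and> e \<notin> target_index T ?n K (k + L) ` avoiding (\<epsilon> / 2) Q A"
      using missed by meson
    define G where "G = {k. k \<ge> k0 \<and> height T k (cube_index T k A) \<le> H}"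
    have drop: "\<nu> (k + L) \<le> \<theta> * \<nu> k" if "k \<in> G" for k
      unfolding \<nu>_def \<theta>_def P_def
    proof (rule survivor_density_missed[OF T0 fin])
      fix c :: "int ^ 'm"
      obtain e where e: "\<forall>i. e $ i div int (T ^ (?n * L)) = c $ i"
        "e \<notin> target_index T ?n K (k + L) ` avoiding (\<epsilon> / 2) Q A"
        using k0[of k A c] \<open>k \<in> G\<close> by (auto simp: G_def)
      show "\<exists>e\<in>subcubes (int (T ^ (?n * L))) c. e \<notin> target_index T ?n K (k + L) ` E"
      proof
        show "e \<in> subcubes (int (T ^ (?n * L))) c" using e(1) by (simp add: subcubes_def)
        show "e \<notin> target_index T ?n K (k + L) ` E" using e(2) E by blast
      qed
    qed
    have decay: "\<nu> N \<le> \<theta> ^ (card (G \<inter> {..<N}) div L) * \<nu> 0" for N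
      by (rule monotone_decay[where G = G and L = L])
        (use \<theta> L drop in \<open>auto simp: \<nu>_def intro: survivor_density_mono[OF T0 fin]\<close>)
    define C0 where "C0 = \<theta> powr (- real k0 / real L - 1) * \<nu> 0 * (real ?m * real K) powr s"
    have bound: "real (card (target_index T ?n K N ` E)) * (real ?m * (real K / real T ^ (?n * N))) powr s \<le> C0 * x ^ N"
      if N: "N < 5 * card {k. k < N \<and> height T k (cube_index T k A) \<le> H}" for N
    proof -
      define g where "g = card (G \<inter> {..<N})"
      \<comment> \<open>The good levels below k0, where no missed subcube is available, are given
        away; together with the rounding in \<open>div L\<close> they cost the power of \<theta> in
        \<open>C0\<close>.\<close>
      have "{k. k < N \<and> height T k (cube_index T k A) \<le> H} \<subseteq> (G \<inter> {..<N}) \<union> {..<k0}"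
        by (auto simp: G_def)
      then have "card {k. k < N \<and> height T k (cube_index T k A) \<le> H} \<le> card ((G \<inter> {..<N}) \<union> {..<k0})"
        by (intro card_mono) auto
      also have "\<dots> \<le> g + k0" unfolding g_def using card_Un_le[of "G \<inter> {..<N}" "{..<k0}"] by simp
      finally have "5 * card {k. k < N \<and> height T k (cube_index T k A) \<le> H} \<le> 5 * (g + k0)"
        by (rule mult_le_mono2)
      with N have "N < 5 * (g + k0)" by (rule less_le_trans)
      then have "real N < real (5 * (g + k0))" by (simp only: of_nat_less_iff)
      then have "real N / 5 - real k0 \<le> real g" by simp
      then have "(real N / 5 - real k0) / real L \<le> real g / real L" by (rule divide_right_mono) simp
      then have gL: "real N / (5 * real L) - real k0 / real L - 1 \<le> real g / real L - 1"
        by (simp add: diff_divide_distrib mult.commute)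
      have "\<theta> ^ (g div L) \<le> \<theta> powr (real g / real L - 1)" by (rule power_div_le_powr[OF \<theta> L])
      also have "\<dots> \<le> \<theta> powr (real N / (5 * real L) - real k0 / real L - 1)"
        using \<theta> gL by (intro powr_mono') auto
      also have "\<dots> = \<theta> powr (real N / (5 * real L)) * \<theta> powr (- real k0 / real L - 1)"
      proof -
        have "real N / (5 * real L) - real k0 / real L - 1 = real N / (5 * real L) + (- real k0 / real L - 1)"
          by simp
        then show ?thesis by (simp only: powr_add)
      qed
      also have "\<theta> powr (real N / (5 * real L)) = (x ^ N) * (x ^ N)"
      proof -
        have "x ^ N = \<theta> powr (1 / (10 * real L) * real N)"
          using x(1) powr_realpow[of x N] by (simp only: x_def powr_powr)
        then have "x ^ N * x ^ N = \<theta> powr (1 / (10 * real L) * real N + 1 / (10 * real L) * real N)"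
          by (simp only: powr_add)
        also have "1 / (10 * real L) * real N + 1 / (10 * real L) * real N = real N / (5 * real L)"
          using L by (simp add: field_simps)
        finally show ?thesis by simp
      qed
      finally have \<theta>g: "\<theta> ^ (g div L) \<le> (x ^ N * x ^ N) * \<theta> powr (- real k0 / real L - 1)" .
      have \<nu>N: "\<nu> N \<le> (x ^ N * x ^ N) * \<theta> powr (- real k0 / real L - 1) * \<nu> 0"
        using decay[of N] mult_right_mono[OF \<theta>g \<nu>0[of 0]] by (simp add: g_def)
      have "real (card (target_index T ?n K N ` E)) = \<nu> N * real T ^ (?n * N * ?m)"
        using T0 by (simp add: \<nu>_def survivor_density_def)
      moreover have "(real ?m * (real K / real T ^ (?n * N))) powr s
          = (real ?m * real K) powr s * (real T ^ (?n * N)) powr (- s)"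
        using T0 K by (simp add: powr_divide powr_minus field_simps)
      moreover have "real T ^ (?n * N * ?m) * (real T ^ (?n * N)) powr (- s) = (real T powr (2 * \<delta> * real ?n)) ^ N"
      proof -
        have "real T ^ (?n * N * ?m) = real T powr real (?n * N * ?m)"
          "real T ^ (?n * N) = real T powr real (?n * N)"
          using T0 by (simp_all only: powr_realpow of_nat_0_less_iff)
        then have "real T ^ (?n * N * ?m) * (real T ^ (?n * N)) powr (- s)
          = real T powr (real (?n * N * ?m) + real (?n * N) * - s)"
          by (simp add: powr_powr powr_add[symmetric])
        also have "real (?n * N * ?m) + real (?n * N) * - s = 2 * \<delta> * real ?n * real N"
          by (simp add: s_def algebra_simps)
        also have "real T powr (2 * \<delta> * real ?n * real N) = (real T powr (2 * \<delta> * real ?n)) ^ N"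
          using T0 powr_realpow[of "real T powr (2 * \<delta> * real ?n)" N] by (simp add: powr_powr)
        finally show ?thesis .
      qed
      ultimately have "real (card (target_index T ?n K N ` E)) * (real ?m * (real K / real T ^ (?n * N))) powr s
          = \<nu> N * (real ?m * real K) powr s * (real T powr (2 * \<delta> * real ?n)) ^ N"
        by (simp add: mult_ac)
      also have "\<dots> \<le> ((x ^ N * x ^ N) * \<theta> powr (- real k0 / real L - 1) * \<nu> 0) * (real ?m * real K) powr s * (1 / x) ^ N"
        using x \<theta> \<nu>0 by (intro mult_mono power_mono \<nu>N T\<delta> mult_nonneg_nonneg) auto
      also have "\<dots> = C0 * x ^ N" using x by (simp add: C0_def field_simps)
      finally show ?thesis .
    qed
    have "(\<lambda>N. C0 * x ^ N) \<longlonglongrightarrow> C0 * 0"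
      using x by (intro tendsto_mult tendsto_const LIMSEQ_realpow_zero) auto
    then have ev1: "eventually (\<lambda>N. C0 * x ^ N < e) sequentially"
      using e by (intro order_tendstoD) auto
    have "(\<lambda>N. real ?m * real K * (1 / real T ^ ?n) ^ N) \<longlonglongrightarrow> real ?m * real K * 0"
      using T1 by (intro tendsto_mult tendsto_const LIMSEQ_realpow_zero) (auto intro!: one_less_power)
    then have ev2: "eventually (\<lambda>N. real ?m * real K * (1 / real T ^ ?n) ^ N < r) sequentially"
      using r by (intro order_tendstoD) auto
    obtain N0 where N0: "\<And>N. N \<ge> N0 \<Longrightarrow> C0 * x ^ N < e" "\<And>N. N \<ge> N0 \<Longrightarrow> real ?m * real K * (1 / real T ^ ?n) ^ N < r"
      using eventually_conj[OF ev1 ev2] unfolding eventually_sequentially by blast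
    obtain N where N: "N \<ge> N0" "N < 5 * card {k. k < N \<and> height T k (cube_index T k A) \<le> H}"
      using good by blast
    let ?\<rho> = "real ?m * (real K / real T ^ (?n * N))"
    have "?\<rho> \<le> r" using N0(2)[OF N(1)] by (simp add: power_mult power_one_over divide_inverse power_inverse)
    moreover have "0 \<le> ?\<rho>" by simp
    moreover have "\<forall>b\<in>E. \<forall>b'\<in>E. target_index T ?n K N b = target_index T ?n K N b' \<longrightarrow> norm (b - b') \<le> ?\<rho>"
      by (intro ballI impI norm_le_card_mult target_index_eq_imp_close[OF T0 K])
    moreover have "real (card (target_index T ?n K N ` E)) * ?\<rho> powr s \<le> e"
      using bound[OF N(2)] N0(1)[OF N(1)] by linarith
    ultimately show "\<exists>(\<phi> :: real ^ 'm \<Rightarrow> int ^ 'm) \<rho>. finite (\<phi> ` E) \<and> 0 \<le> \<rho> \<and> \<rho> \<le> r \<and>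
      (\<forall>x\<in>E. \<forall>y\<in>E. \<phi> x = \<phi> y \<longrightarrow> norm (x - y) \<le> \<rho>) \<and> real (card (\<phi> ` E)) * \<rho> powr s \<le> e"
      using fin by blast
  qed
  have "hausdorff_measure s (Bad A \<epsilon>) = 0"
    if good: "\<forall>N0. \<exists>N\<ge>N0. N < 5 * card {k. k < N \<and> height T k (cube_index T k A) \<le> H}"
    for A :: "real ^ 'n ^ 'm"
  proof -
    \<comment> \<open>The norm bound makes the number of cubes finite at each level; threshold and
      norm bound run together through the natural numbers, so countably many pieces exhaust the
      set.\<close>
    define E where "E i = avoiding (\<epsilon> / 2) (real i) A \<inter> {b. norm b \<le> real i}" for i
    have "hausdorff_measure s (E i) = 0" for i
    proof (rule null[OF good])
      show "E i \<subseteq> avoiding (\<epsilon> / 2) (real i) A" by (simp add: E_def)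
      show "\<bar>b $ j\<bar> \<le> real i" if "b \<in> E i" for b j
        using that component_le_norm_cart[of b j] by (simp add: E_def)
    qed
    then have "hausdorff_measure s (\<Union>i. E i) = 0" by (rule hausdorff_measure_UN_zero)
    moreover have "Bad A \<epsilon> \<subseteq> (\<Union>i. E i)"
    proof
      fix b assume "b \<in> Bad A \<epsilon>"
      then obtain Q where Q: "b \<in> avoiding (\<epsilon> / 2) Q A" by (rule Bad_imp_avoiding[OF \<epsilon>])
      obtain i where i: "max Q (norm b) \<le> real i" using real_arch_simple by blast
      have "b \<in> E i" using Q i by (auto simp: E_def avoiding_def)
      then show "b \<in> (\<Union>i. E i)" by blast
    qed
    ultimately show ?thesis using hausdorff_measure_mono[of "Bad A \<epsilon>" "\<Union>i. E i" s] by simp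
  qed
  then show thesis using that[OF \<delta>] by (simp add: s_def)
qed

section \<open>The set of matrices with few good levels\<close>

lemma norm_matrix_le:
  fixes X :: "real ^ 'n ^ 'm"
  assumes "\<And>i j. \<bar>X $ i $ j\<bar> \<le> r"
  shows "norm X \<le> real (CARD('m) * CARD('n)) * r"
proof -
  have "norm X \<le> (\<Sum>i\<in>UNIV. norm (X $ i))"
    unfolding norm_vec_def by (rule L2_set_le_sum) simp
  also have "\<dots> \<le> (\<Sum>i\<in>(UNIV :: 'm set). real CARD('n) * r)"
    by (rule sum_mono) (rule norm_le_card_mult[OF assms])
  finally show ?thesis by simp
qed

lemma cube_index_eq_imp_close:
  fixes A B :: "real ^ 'n ^ 'm"
  assumes "T > 0" "cube_index T k A = cube_index T k B"
  shows "norm (A - B) \<le> real (CARD('m) * CARD('n)) * (1 / real T ^ ((CARD('m) + CARD('n)) * k))"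
proof (rule norm_matrix_le)
  fix i j
  define R where "R = real T ^ ((CARD('m) + CARD('n)) * k)"
  have R: "R > 0" using assms by (simp add: R_def)
  have "\<lfloor>R * A $ i $ j\<rfloor> = \<lfloor>R * B $ i $ j\<rfloor>"
    using arg_cong[OF assms(2), of "\<lambda>v. v $ i $ j"] by (simp add: cube_index_def R_def)
  then have "\<bar>R * A $ i $ j - R * B $ i $ j\<bar> \<le> 1" by linarith
  then have "R * \<bar>(A - B) $ i $ j\<bar> \<le> 1"
    using R by (metis abs_mult abs_of_pos right_diff_distrib vector_minus_component)
  then have "\<bar>(A - B) $ i $ j\<bar> \<le> 1 / R" using R by (simp add: pos_le_divide_eq mult.commute)
  then show "\<bar>(A - B) $ i $ j\<bar> \<le> 1 / real T ^ ((CARD('m) + CARD('n)) * k)" by (simp only: R_def)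
qed

context drifting
begin

text \<open>With M = T^(m+n) and D = m n, a multiple of (9/10 M^D)^N cubes of side M^(-N) covers
  each bounded piece. Lowering the exponent from D to D - \<sigma> multiplies each summand by a
  constant times M^(\<sigma> N), which a small \<sigma> keeps below the gain.\<close>

lemma rarely_good_null:
  obtains \<sigma> where "0 < \<sigma>" "2 * \<sigma> \<le> 1" "hausdorff_measure (real (CARD('m) * CARD('n)) - \<sigma>)
    {A :: real ^ 'n ^ 'm. \<exists>N0. \<forall>N\<ge>N0. 5 * card {k. k < N \<and> height T k (cube_index T k A) \<le> 8 * C} \<le> N} = 0"
proof -
  let ?m = "CARD('m)" and ?n = "CARD('n)"
  define M where "M = real T ^ (?m + ?n)"
  have T0: "T > 0" using T by simp
  have "real T > 1" using T by simp
  then have M1: "M > 1" unfolding M_def by (intro one_less_power) auto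
  then have lnM: "ln M > 0" by simp
  \<comment> \<open>The choice gives M^\<sigma> \<le> 19/18, and 9/10 times 19/18 is 19/20 < 1; the
    entry 1 / 2 keeps D - \<sigma> positive.\<close>
  define \<sigma> :: real where "\<sigma> = min (1 / 2) (ln (19 / 18) / ln M)"
  have \<sigma>: "0 < \<sigma>" "2 * \<sigma> \<le> 1" using lnM by (auto simp: \<sigma>_def)
  have "\<sigma> * ln M \<le> ln (19 / 18)"
    using lnM pos_le_divide_eq[of "ln M" \<sigma> "ln (19 / 18)"] by (simp add: \<sigma>_def)
  then have "exp (\<sigma> * ln M) \<le> exp (ln (19 / 18))" by (simp only: exp_le_cancel_iff)
  then have M\<sigma>: "M powr \<sigma> \<le> 19 / 18" using M1 by (simp add: powr_def)
  define D where "D = real (?m * ?n)"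
  have "1 * 1 \<le> ?m * ?n" by (intro mult_le_mono) (simp_all add: Suc_leI)
  then have D1: "D \<ge> 1" unfolding D_def by linarith
  define s where "s = D - \<sigma>"
  have s0: "s > 0" using D1 \<sigma> by (simp add: s_def)
  define g where "g N A = card {k. k < N \<and> height T k (cube_index T k A) \<le> 8 * C}" for N and A :: "real ^ 'n ^ 'm"
  \<comment> \<open>The index i bounds both the level from which on good levels are few and the
    norm, so that each piece meets finitely many unit cubes.\<close>
  define F where "F i = {A :: real ^ 'n ^ 'm. (\<forall>N\<ge>i. 5 * g N A \<le> N) \<and> norm A \<le> real i}" for i
  have null: "hausdorff_measure s (F i) = 0" for i
  proof (rule hausdorff_measure_zero_fibres[OF s0])
    fix r e :: real assume r: "r > 0" and e: "e > 0"
    define B :: "(int ^ 'n ^ 'm) set" where "B = {I. \<forall>a. I $ a \<in> {v. \<forall>b. v $ b \<in> {- int i..int i}}}"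
    have finB: "finite B" unfolding B_def by (intro finite_vec_Pi) simp
    have index0: "cube_index T 0 A \<in> B" if "A \<in> F i" for A
    proof -
      have "\<bar>A $ a $ b\<bar> \<le> real i" for a b
        using that component_le_norm_cart[of "A $ a" b] Finite_Cartesian_Product.norm_nth_le[of A a]
        by (simp add: F_def)
      then have "- real i \<le> A $ a $ b \<and> A $ a $ b \<le> real i" for a b by (simp add: abs_le_iff minus_le_iff)
      then have "- int i \<le> \<lfloor>A $ a $ b\<rfloor> \<and> \<lfloor>A $ a $ b\<rfloor> \<le> int i" for a b
        by (simp add: le_floor_iff floor_le_iff less_eq_real_def) (smt (verit, best))
      then show ?thesis by (simp add: B_def cube_index_def)
    qed
    define W where "W = (\<Sum>I0\<in>B. (height T 0 I0 + 4 * C) / (4 * C))"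
    define S where "S N = (\<Union>I0\<in>B. {I \<in> grid T I0 N. 5 * goods T (8 * C) N I \<le> N})" for N
    have finS: "finite (S N)" for N unfolding S_def
      by (rule finite_UN_I[OF finB]) (rule finite_subset[OF _ finite_grid], blast)
    have cardS: "real (card (S N)) \<le> W * (9 / 10 * M powr D) ^ N" for N
    proof -
      have MD: "real (T ^ (?m + ?n)) ^ (?m * ?n) = M powr D"
        using M1 powr_realpow[of M "?m * ?n"] by (simp only: M_def D_def of_nat_power)
      have "card (S N) \<le> (\<Sum>I0\<in>B. card {I \<in> grid T I0 N. 5 * goods T (8 * C) N I \<le> N})"
        unfolding S_def by (rule card_UN_le[OF finB])
      then have "real (card (S N)) \<le> (\<Sum>I0\<in>B. real (card {I \<in> grid T I0 N. 5 * goods T (8 * C) N I \<le> N}))"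
        by (simp only: of_nat_sum[symmetric] of_nat_le_iff)
      also have "\<dots> \<le> (\<Sum>I0\<in>B. (height T 0 I0 + 4 * C) / (4 * C) * (9 / 10 * M powr D) ^ N)"
        by (rule sum_mono) (rule card_few_goods[unfolded MD])
      finally show ?thesis by (simp only: W_def sum_distrib_right)
    qed
    have sub: "cube_index T N ` F i \<subseteq> S N" if "N \<ge> i" for N
    proof
      fix I assume "I \<in> cube_index T N ` F i"
      then obtain A where A: "A \<in> F i" "I = cube_index T N A" by blast
      then have "5 * goods T (8 * C) N I \<le> N"
        using that by (simp add: goods_cube_index[OF T0] F_def g_def)
      then show "I \<in> S N"
        using A index0[OF A(1)] cube_index_in_grid[OF T0, of N A] by (auto simp: S_def)
    qed
    have W0: "W \<ge> 0" unfolding W_def using C by (intro sum_nonneg divide_nonneg_nonneg) (auto simp: height_def)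
    have bound: "real (card (cube_index T N ` F i)) * (D * (1 / M ^ N)) powr s \<le> W * D powr s * (19 / 20) ^ N"
      if "N \<ge> i" for N
    proof -
      have "(D * (1 / M ^ N)) powr s = D powr s * (M powr (- s)) ^ N"
      proof -
        have "1 / M ^ N = M powr (- real N)" using M1 by (simp add: powr_minus_divide powr_realpow)
        moreover have "(M powr (- s)) ^ N = (M powr (- s)) powr real N"
          using M1 by (subst powr_realpow) auto
        ultimately have "(1 / M ^ N) powr s = (M powr (- s)) ^ N"
          by (simp add: powr_powr mult.commute)
        moreover have "(D * (1 / M ^ N)) powr s = D powr s * (1 / M ^ N) powr s"
          by (rule powr_mult)
        ultimately show ?thesis by (simp only:)
      qed
      moreover have "real (card (cube_index T N ` F i)) \<le> W * (9 / 10 * M powr D) ^ N"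
        using card_mono[OF finS sub[OF that]] cardS[of N] by linarith
      ultimately have "real (card (cube_index T N ` F i)) * (D * (1 / M ^ N)) powr s
          \<le> W * (9 / 10 * M powr D) ^ N * (D powr s * (M powr (- s)) ^ N)"
        by (simp only:) (rule mult_right_mono, assumption, simp)
      also have "\<dots> = W * D powr s * (9 / 10 * (M powr D * M powr (- s))) ^ N"
        by (simp only: power_mult_distrib mult_ac)
      also have "M powr D * M powr (- s) = M powr \<sigma>" by (simp add: powr_add[symmetric] s_def)
      also have "W * D powr s * (9 / 10 * M powr \<sigma>) ^ N \<le> W * D powr s * (19 / 20) ^ N"
        using M\<sigma> W0 by (intro mult_left_mono power_mono) auto
      finally show ?thesis .
    qed
    have "(\<lambda>N. W * D powr s * (19 / 20) ^ N) \<longlonglongrightarrow> W * D powr s * 0"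
      by (intro tendsto_mult tendsto_const LIMSEQ_realpow_zero) auto
    then have ev1: "eventually (\<lambda>N. W * D powr s * (19 / 20) ^ N < e) sequentially"
      using e by (intro order_tendstoD) auto
    have "(\<lambda>N. D * (1 / M) ^ N) \<longlonglongrightarrow> D * 0"
      using M1 by (intro tendsto_mult tendsto_const LIMSEQ_realpow_zero) auto
    then have ev2: "eventually (\<lambda>N. D * (1 / M) ^ N < r) sequentially"
      using r by (intro order_tendstoD) auto
    obtain N where N: "N \<ge> i" "W * D powr s * (19 / 20) ^ N < e" "D * (1 / M) ^ N < r"
      using eventually_happens'[OF _ eventually_conj[OF eventually_ge_at_top[of i] eventually_conj[OF ev1 ev2]]]
      by auto
    let ?\<rho> = "D * (1 / M ^ N)"
    have "finite (cube_index T N ` F i)" using finite_subset[OF sub[OF N(1)] finS] .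
    moreover have "?\<rho> \<le> r" using N(3) by (simp add: power_one_over)
    moreover have "0 \<le> ?\<rho>" using D1 M1 by simp
    moreover have "\<forall>x\<in>F i. \<forall>y\<in>F i. cube_index T N x = cube_index T N y \<longrightarrow> norm (x - y) \<le> ?\<rho>"
      using cube_index_eq_imp_close[OF T0, where 'n = 'n and 'm = 'm and k = N] by (simp add: D_def M_def power_mult)
    moreover have "real (card (cube_index T N ` F i)) * ?\<rho> powr s \<le> e"
      using bound[OF N(1)] N(2) by linarith
    ultimately show "\<exists>(\<phi> :: real ^ 'n ^ 'm \<Rightarrow> int ^ 'n ^ 'm) \<rho>. finite (\<phi> ` F i) \<and> 0 \<le> \<rho> \<and> \<rho> \<le> r \<and>
      (\<forall>x\<in>F i. \<forall>y\<in>F i. \<phi> x = \<phi> y \<longrightarrow> norm (x - y) \<le> \<rho>) \<and> real (card (\<phi> ` F i)) * \<rho> powr s \<le> e"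
      by blast
  qed
  have "{A :: real ^ 'n ^ 'm. \<exists>N0. \<forall>N\<ge>N0. 5 * card {k. k < N \<and> height T k (cube_index T k A) \<le> 8 * C} \<le> N} \<subseteq> (\<Union>i. F i)"
  proof
    fix A :: "real ^ 'n ^ 'm"
    assume "A \<in> {A. \<exists>N0. \<forall>N\<ge>N0. 5 * card {k. k < N \<and> height T k (cube_index T k A) \<le> 8 * C} \<le> N}"
    then obtain N0 where N0: "\<forall>N\<ge>N0. 5 * g N A \<le> N" by (auto simp: g_def)
    obtain i where i: "norm A \<le> real i" using real_arch_simple by blast
    have "A \<in> F (max N0 i)" using N0 i by (auto simp: F_def)
    then show "A \<in> (\<Union>i. F i)" by blast
  qed
  then have "hausdorff_measure s {A :: real ^ 'n ^ 'm. \<exists>N0. \<forall>N\<ge>N0. 5 * card {k. k < N \<and> height T k (cube_index T k A) \<le> 8 * C} \<le> N}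
      \<le> hausdorff_measure s (\<Union>i. F i)" by (rule hausdorff_measure_mono)
  also have "\<dots> = 0" by (rule hausdorff_measure_UN_zero) (rule null)
  finally show thesis using that[OF \<sigma>] by (simp add: s_def D_def)
qed

end

theorem theorem1p4:
  fixes \<epsilon> :: real
  assumes "\<epsilon> > 0"
  shows "\<exists>\<delta>>0. hausdorff_dim {A :: real ^ 'n ^ 'm.
             hausdorff_dim (Bad A \<epsilon>) \<ge> ereal (real CARD('m) - \<delta>)}
           < ereal (real (CARD('m) * CARD('n)))"
proof -
  obtain T C where T: "T \<ge> 2" and C: "C > 0" and drift: "\<forall>k. \<forall>A :: real ^ 'n ^ 'm.
     (\<Sum>J\<in>digits (T ^ (CARD('m) + CARD('n))). real (card (short T (k + 1) (child_matrix T k A J) 1)))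
     \<le> real (T ^ (CARD('m) + CARD('n))) ^ (CARD('m) * CARD('n)) * (card (short T k A 1) / 2 + C)"
    using drift[where 'n = 'n and 'm = 'm] by (elim exE conjE)
  interpret drifting T C "TYPE(real ^ 'n ^ 'm)"
    by (rule drifting.intro[OF T C]) (rule drift[rule_format])
  obtain \<sigma> where \<sigma>: "0 < \<sigma>" "2 * \<sigma> \<le> 1" and null: "hausdorff_measure (real (CARD('m) * CARD('n)) - \<sigma>)
    {A :: real ^ 'n ^ 'm. \<exists>N0. \<forall>N\<ge>N0. 5 * card {k. k < N \<and> height T k (cube_index T k A) \<le> 8 * C} \<le> N} = 0"
    by (rule rarely_good_null)
  obtain \<delta> where \<delta>: "0 < \<delta>" "2 * \<delta> < 1" and bad: "\<forall>A :: real ^ 'n ^ 'm.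
    (\<forall>N0. \<exists>N\<ge>N0. N < 5 * card {k. k < N \<and> height T k (cube_index T k A) \<le> 8 * C}) \<longrightarrow>
    hausdorff_measure (real CARD('m) - 2 * \<delta>) (Bad A \<epsilon>) = 0"
    by (rule frequently_good_imp_Bad_null[OF T assms])
  let ?X = "{A :: real ^ 'n ^ 'm. hausdorff_dim (Bad A \<epsilon>) \<ge> ereal (real CARD('m) - \<delta>)}"
  have "?X \<subseteq> {A. \<exists>N0. \<forall>N\<ge>N0. 5 * card {k. k < N \<and> height T k (cube_index T k A) \<le> 8 * C} \<le> N}"
  proof (rule subsetI, rule ccontr)
    fix A :: "real ^ 'n ^ 'm"
    assume A: "A \<in> ?X" and "A \<notin> {A. \<exists>N0. \<forall>N\<ge>N0. 5 * card {k. k < N \<and> height T k (cube_index T k A) \<le> 8 * C} \<le> N}"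
    then have "\<forall>N0. \<exists>N\<ge>N0. N < 5 * card {k. k < N \<and> height T k (cube_index T k A) \<le> 8 * C}"
      by (simp add: not_le)
    then have "hausdorff_measure (real CARD('m) - 2 * \<delta>) (Bad A \<epsilon>) = 0" using bad by blast
    moreover have "real CARD('m) \<ge> 1" by (simp add: Suc_leI)
    ultimately have "hausdorff_dim (Bad A \<epsilon>) \<le> ereal (real CARD('m) - 2 * \<delta>)"
      using \<delta> by (intro hausdorff_dim_le) linarith+
    \<comment> \<open>The bound at m - 2 \<delta> is not strict; the gap of one \<delta> provides
      the contradiction to a dimension of at least m - \<delta>.\<close>
    also have "\<dots> < ereal (real CARD('m) - \<delta>)" using \<delta> by simp
    finally show False using A by simp
  qed
  from hausdorff_measure_mono[OF this, of "real (CARD('m) * CARD('n)) - \<sigma>"]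
  have "hausdorff_measure (real (CARD('m) * CARD('n)) - \<sigma>) ?X = 0"
    unfolding null by simp
  moreover have "real (CARD('m) * CARD('n)) - \<sigma> \<ge> 0"
  proof -
    have "1 * 1 \<le> CARD('m) * CARD('n)" by (intro mult_le_mono) (simp_all add: Suc_leI)
    then have "1 \<le> real (CARD('m) * CARD('n))" by linarith
    then show ?thesis using \<sigma> by linarith
  qed
  ultimately have "hausdorff_dim ?X \<le> ereal (real (CARD('m) * CARD('n)) - \<sigma>)"
    by (intro hausdorff_dim_le)
  also have "\<dots> < ereal (real (CARD('m) * CARD('n)))" using \<sigma> by simp
  finally show ?thesis using \<delta>(1) by (intro exI[of _ \<delta>] conjI)
qed

end
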